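(* Let $\xi_0,\xi_1,\dots$ be nondegenerate i.i.d. complex random variables with $\mathbb{P}(\xi_0=0)=0$ and $\mathbb{E}\log(1+|\xi_0|)<\infty$. Suppose there exist a function $p:[0,\infty)\to[0,\infty)$, a number $T_0\in(0,\infty)$, a sequence of positive integers $L_n\to\infty$, and a sequence of real numbers $\delta_n\in(-T_0,T_0)$ (not necessarily positive) with $\delta_n\to 0$, such that $(T_0-\delta_n)L_n$ is an integer for every $n$, and: (1) $p(t)>0$ for $t\in[0,T_0)$ and $p(t)=0$ for $t>T_0$; (2) $p$ is continuous on $[0,T_0]$; (3) $\lim_{n\to\infty}\sup_{0\le k\le (T_0-\delta_n)L_n}\big|\,|p_{k,n}|^{1/L_n}-p\big(\tfrac{k}{L_n}\wedge T_0\big)\big|=0$, where $p_{k,n}$ are deterministic complex coefficients. Consider the random polynomials $$F_n(z)=\sum_{k=0}^{(T_0-\delta_n)L_n}\xi_k\,p_{k,n}\,z^k .$$ Let $I(s)=\sup_{t\ge 0}\big(st+\log p(t)\big)$ (the Legendre–Fenchel transform of $-\log p$, with $\log 0=-\infty$). Then the random measure $\frac{1}{L_n}\mu_{F_n}$ converges in probability to the deterministic rotationally invariant measure $\mu$ on $\mathbb{C}$ determined by $$\mu(\mathbb{D}_r)=I'(\log r),\qquad r>0,$$ where $I'$ denotes the left derivative of $I$.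
   Context: For a polynomial $f$, $\mu_f=\sum_{z:\,f(z)=0}\delta_z$ is the counting measure of its zeros (with multiplicity). $\mathbb{D}_r$ is the open disk of radius $r$ centered at $0$. $a\wedge b=\min\{a,b\}$. A sequence of random measures $\nu_n$ converges in probability to a deterministic measure $\nu$ if $\int\phi\,d\nu_n\to\int\phi\,d\nu$ in probability for every smooth compactly supported test function $\phi$ on $\mathbb{C}$. *)

theory Defs
  imports "HOL-Probability.Probability" "HOL-Computational_Algebra.Polynomial"
begin

coinductive smooth_fun :: "('a::real_normed_vector \<Rightarrow> real) \<Rightarrow> bool" where
  "(\<And>x. (f has_derivative f' x) (at x)) \<Longrightarrow> (\<And>v. smooth_fun (\<lambda>x. f' x v))
     \<Longrightarrow> smooth_fun f"

definition test_fun :: "(complex \<Rightarrow> real) \<Rightarrow> bool" where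
  "test_fun \<phi> \<longleftrightarrow> smooth_fun \<phi> \<and> compact (closure {z. \<phi> z \<noteq> 0})"

text \<open>Integral of phi against the zero counting measure (with multiplicity) of q.
  For q = 0 the zero set is infinite and the sum is 0 by convention.\<close>
definition zero_measure_integral :: "complex poly \<Rightarrow> (complex \<Rightarrow> real) \<Rightarrow> real" where
  "zero_measure_integral q \<phi> = (\<Sum>z\<in>{z. poly q z = 0}. real (order z q) * \<phi> z)"

text \<open>I(s) = sup_{t \<ge> 0} (s t + log p t), with log 0 = -infinity (such t are dropped).\<close>
definition legendre_I :: "(real \<Rightarrow> real) \<Rightarrow> real \<Rightarrow> real" where
  "legendre_I p s = Sup {s * t + ln (p t) | t. 0 \<le> t \<and> p t > 0}"

end

theory Submission
  imports Defs "HOL-Complex_Analysis.Complex_Analysis"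
    "HOL-Computational_Algebra.Fundamental_Theorem_Algebra" "HOL-Real_Asymp.Real_Asymp"
begin

text \<open>
  Write A(s) for the mean of log |F| over the circle of radius exp s, that is, the logarithm of the modulus
  of the leading coefficient plus the sum of max(s, log |w|) over the zeros w. The key step is
  A(s) / L \<longlongrightarrow> I(s) in probability for every s.

  Upper bound: by the logarithmic moment no coefficient variable exceeds exp(e L), so |F| is at most
  exp(L (I(s) + e)) on the circle. Lower bound: A(s) is, up to degree * log 2 / N, at least the average of
  log |F| over N equally spaced points of the circle. To bound |F| from below at one point, pick a fixed
  number of well separated indices near the maximizer of s t + log p(t) and move s slightly so that the
  corresponding terms have very different sizes. Revealing the variables from the largest term down, each
  of them must hit a ball of probability at most q < 1, so F is exponentially small only with probability
  about q to the number of indices. Since A is Lipschitz in s with constant the degree, moving s is harmless.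

  Differences of A(s) in s determine the radial distribution of the zeros, and the limit is read off
  from I. The gap between the maximum of log |F| on the circle and A(s) bounds all Fourier modes: for m > 0
  the sum over the zeros of min(|w|/r, r/|w|)^m exp(-i m arg w) is at most 2 m times that gap. Both families
  of functions together span a uniformly dense subset of the compactly supported continuous functions, and
  the total masses are bounded.
\<close>

subsection \<open>Zeros of a polynomial and its modulus on circles\<close>

lemma monom_diff_one_eq_prod_roots_unity:
  assumes "n > 0"
  shows "monom 1 n - 1 = (\<Prod>k<n. [:- cis (2 * pi * real k / real n), 1:])"
proof -
  define q :: "complex poly" where "q = monom 1 n - 1"
  have poly_q: "poly q z = z ^ n - 1" for z
    by (simp add: q_def poly_monom)
  have "degree q = n"
    unfolding q_def diff_conv_add_uminus using assms
    by (subst degree_add_eq_left) (auto simp: degree_monom_eq)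
  then have lead: "lead_coeff q = 1"
    using assms by (simp add: q_def)
  have "poly (pderiv q) z \<noteq> 0" if "poly q z = 0" for z
  proof -
    have "z \<noteq> 0"
      using that assms poly_q by (auto simp: zero_power)
    moreover have "pderiv q = monom (of_nat n) (n - 1)"
      by (simp add: q_def pderiv_diff pderiv_monom)
    ultimately show ?thesis
      using assms by (simp add: poly_monom)
  qed
  then have "rsquarefree q"
    by (auto simp: rsquarefree_roots)
  then have "q = (\<Prod>z | z ^ n = 1. [:- z, 1:])"
    using complex_poly_decompose_rsquarefree[of q] lead by (simp add: poly_q)
  also have "\<dots> = (\<Prod>k<n. [:- cis (2 * pi * real k / real n), 1:])"
    by (rule prod.reindex_bij_betw[OF Complex.bij_betw_roots_unity[OF assms], symmetric])
  finally show ?thesis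
    by (simp add: q_def)
qed

lemma prod_diff_roots_unity:
  fixes x y :: complex
  assumes "n > 0"
  shows "(\<Prod>k<n. x - cis (2 * pi * real k / real n) * y) = x ^ n - y ^ n"
proof (cases "y = 0")
  case True
  then show ?thesis
    using assms by simp
next
  case False
  have "x - u * y = y * (x / y - u)" for u
    using False by (simp add: right_diff_distrib mult.commute)
  then have "(\<Prod>k<n. x - cis (2 * pi * real k / real n) * y) =
      y ^ n * (\<Prod>k<n. x / y - cis (2 * pi * real k / real n))"
    by (simp add: prod.distrib)
  also have "\<dots> = y ^ n * ((x / y) ^ n - 1)"
    using arg_cong[OF monom_diff_one_eq_prod_roots_unity[OF assms], of "\<lambda>q. poly q (x / y)"]
    by (simp add: poly_prod poly_monom)
  also have "\<dots> = x ^ n - y ^ n"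
    using False by (simp add: field_simps)
  finally show ?thesis .
qed

lemma norm_less_one_imp_norm_one_minus_pos:
  fixes x :: "'a :: real_normed_algebra_1"
  shows "norm x < 1 \<Longrightarrow> 0 < norm (1 - x)"
  by (metis eq_iff_diff_eq_0 less_irrefl norm_one zero_less_norm_iff)

lemma ln_cmod_one_minus_power:
  fixes x :: complex
  assumes "n > 0" "cmod x < 1"
  shows "ln (cmod (1 - x ^ n)) = (\<Sum>k<n. ln (cmod (1 - cis (2 * pi * real k / real n) * x)))"
proof -
  have "cmod (1 - x ^ n) = (\<Prod>k<n. cmod (1 - cis (2 * pi * real k / real n) * x))"
    using prod_diff_roots_unity[OF assms(1), of 1 x] by (simp add: prod_norm)
  moreover have "0 < cmod (1 - cis t * x)" for t
    using assms(2) by (intro norm_less_one_imp_norm_one_minus_pos) (simp add: norm_mult)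
  ultimately show ?thesis
    by (simp add: ln_prod less_imp_neq[symmetric])
qed

lemma abs_zero_measure_integral_le:
  assumes "\<And>z. \<bar>\<phi> z\<bar> \<le> B"
  shows "\<bar>zero_measure_integral q \<phi>\<bar> \<le> real (degree q) * B"
proof (cases "q = 0")
  case True
  have "infinite (UNIV :: complex set)"
    by (rule infinite_UNIV_char_0)
  with True show ?thesis
    by (simp add: zero_measure_integral_def)
next
  case False
  have "0 \<le> B"
    using assms[of 0] by linarith
  have "\<bar>zero_measure_integral q \<phi>\<bar> \<le> (\<Sum>z | poly q z = 0. real (order z q) * B)"
    unfolding zero_measure_integral_def
    by (rule order_trans[OF sum_abs], intro sum_mono) (simp add: abs_mult assms mult_left_mono)
  also have "\<dots> = real (\<Sum>z | poly q z = 0. order z q) * B"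
    by (simp add: sum_distrib_right)
  also have "\<dots> \<le> real (degree q) * B"
    using sum_order_le_degree[OF False] \<open>0 \<le> B\<close> by (intro mult_right_mono of_nat_mono)
  finally show ?thesis .
qed

lemma zero_measure_integral_add:
  "zero_measure_integral q (\<lambda>z. f z + g z) = zero_measure_integral q f + zero_measure_integral q g"
  by (simp add: zero_measure_integral_def ring_distribs sum.distrib)

lemma zero_measure_integral_diff:
  "zero_measure_integral q (\<lambda>z. f z - g z) = zero_measure_integral q f - zero_measure_integral q g"
  by (simp add: zero_measure_integral_def ring_distribs sum_subtractf)

lemma zero_measure_integral_mult_left:
  "zero_measure_integral q (\<lambda>z. c * f z) = c * zero_measure_integral q f"
  by (simp add: zero_measure_integral_def sum_distrib_left mult_ac)

lemma zero_measure_integral_sum: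
  "zero_measure_integral q (\<lambda>z. \<Sum>i\<in>I. f i z) = (\<Sum>i\<in>I. zero_measure_integral q (f i))"
  unfolding zero_measure_integral_def by (subst sum.swap) (simp add: sum_distrib_left)

lemma zero_measure_integral_mono:
  "(\<And>z. poly q z = 0 \<Longrightarrow> f z \<le> g z) \<Longrightarrow> zero_measure_integral q f \<le> zero_measure_integral q g"
  unfolding zero_measure_integral_def by (intro sum_mono mult_left_mono) auto

lemma ln_prod_power_order:
  assumes "q \<noteq> 0" "\<And>w. poly q w = 0 \<Longrightarrow> 0 < f w"
  shows "ln (\<Prod>w | poly q w = 0. f w ^ order w q) = zero_measure_integral q (\<lambda>w. ln (f w))"
proof -
  have "finite {w. poly q w = 0}"
    using assms(1) by (rule poly_roots_finite)
  moreover have "f w ^ order w q \<noteq> 0" if "w \<in> {w. poly q w = 0}" for w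
    using assms(2)[of w] that by simp
  ultimately have "ln (\<Prod>w | poly q w = 0. f w ^ order w q) =
      (\<Sum>w | poly q w = 0. ln (f w ^ order w q))"
    by (intro ln_prod)
  also have "\<dots> = zero_measure_integral q (\<lambda>w. ln (f w))"
    unfolding zero_measure_integral_def
    using assms(2) by (intro sum.cong refl) (simp add: ln_realpow)
  finally show ?thesis .
qed

lemma poly_eq_prod_roots:
  fixes q :: "complex poly"
  shows "poly q z = lead_coeff q * (\<Prod>w | poly q w = 0. (z - w) ^ order w q)"
  by (subst (1) complex_poly_decompose[symmetric]) (simp add: poly_prod)

lemma cmod_poly_eq_prod_roots:
  "cmod (poly q z) = cmod (lead_coeff q) * (\<Prod>w | poly q w = 0. cmod (z - w) ^ order w q)"
  by (subst poly_eq_prod_roots) (simp add: norm_mult norm_power flip: prod_norm)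

lemma ln_cmod_poly:
  assumes "poly q z \<noteq> 0"
  shows "ln (cmod (poly q z)) =
    ln (cmod (lead_coeff q)) + zero_measure_integral q (\<lambda>w. ln (cmod (z - w)))"
proof -
  have "q \<noteq> 0"
    using assms by auto
  moreover have pos: "0 < cmod (z - w)" if "poly q w = 0" for w
    using assms that by auto
  moreover have "0 < (\<Prod>w | poly q w = 0. cmod (z - w) ^ order w q)"
    using pos by (intro prod_pos) auto
  ultimately show ?thesis
    unfolding cmod_poly_eq_prod_roots by (simp add: ln_mult_pos ln_prod_power_order)
qed

text \<open>By Jensen's formula, this is the mean of log |q| over the circle of radius r.\<close>

definition log_mahler :: "complex poly \<Rightarrow> real \<Rightarrow> real" where
  "log_mahler q r = ln (cmod (lead_coeff q)) + zero_measure_integral q (\<lambda>w. ln (max r (cmod w)))"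

lemma ln_max: "0 < x \<Longrightarrow> 0 < y \<Longrightarrow> ln (max x y) = max (ln x) (ln y)" for x y :: real
  by (auto simp: max_def)

lemma log_mahler_lipschitz:
  assumes "0 < r" "0 < r'"
  shows "\<bar>log_mahler q r - log_mahler q r'\<bar> \<le> real (degree q) * \<bar>ln r - ln r'\<bar>"
proof -
  have "\<bar>ln (max r (cmod w)) - ln (max r' (cmod w))\<bar> \<le> \<bar>ln r - ln r'\<bar>" for w
    using assms by (cases "w = 0") (auto simp: ln_max)
  from abs_zero_measure_integral_le[OF this, of q] show ?thesis
    by (simp add: log_mahler_def zero_measure_integral_diff)
qed

lemma sum_ln_cmod_diff_circle_le:
  assumes r: "r > 0" and n: "n > 0"
    and nz: "\<And>k. k < n \<Longrightarrow> of_real r * cis (2 * pi * real k / real n) \<noteq> w"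
  shows "(\<Sum>k<n. ln (cmod (of_real r * cis (2 * pi * real k / real n) - w)))
    \<le> real n * ln (max r (cmod w)) + ln 2"
proof -
  have pos: "0 < cmod (of_real r * cis (2 * pi * real k / real n) - w)" if "k < n" for k
    using nz[OF that] by simp
  have prod_eq: "(\<Prod>k<n. cmod (of_real r * cis (2 * pi * real k / real n) - w)) =
      cmod (w ^ n - of_real r ^ n)"
    unfolding prod_diff_roots_unity[OF n, symmetric]
    by (simp add: norm_minus_commute mult.commute flip: prod_norm)
  have "(\<Sum>k<n. ln (cmod (of_real r * cis (2 * pi * real k / real n) - w))) =
      ln (cmod (w ^ n - of_real r ^ n))"
    unfolding prod_eq[symmetric] using pos by (intro ln_prod[symmetric]) fastforce+
  also have "\<dots> \<le> ln (2 * max r (cmod w) ^ n)"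
  proof (rule ln_mono)
    show "0 < cmod (w ^ n - of_real r ^ n)"
      unfolding prod_eq[symmetric] using pos by (intro prod_pos) auto
    have "cmod (w ^ n - of_real r ^ n) \<le> cmod w ^ n + r ^ n"
      using norm_triangle_ineq4[of "w ^ n" "of_real r ^ n"] r by (simp add: norm_power)
    also have "\<dots> \<le> max r (cmod w) ^ n + max r (cmod w) ^ n"
      using r by (intro add_mono power_mono) auto
    finally show "cmod (w ^ n - of_real r ^ n) \<le> 2 * max r (cmod w) ^ n"
      by simp
  qed
  also have "\<dots> = real n * ln (max r (cmod w)) + ln 2"
    using r by (simp add: ln_mult_pos ln_realpow less_max_iff_disj)
  finally show ?thesis .
qed

lemma log_mahler_ge_average:
  assumes q: "q \<noteq> 0" and r: "r > 0" and n: "n > 0"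
    and nz: "\<And>k. k < n \<Longrightarrow> poly q (of_real r * cis (2 * pi * real k / real n)) \<noteq> 0"
  shows "(\<Sum>k<n. ln (cmod (poly q (of_real r * cis (2 * pi * real k / real n))))) / real n
    - real (degree q) * ln 2 / real n \<le> log_mahler q r"
proof -
  let ?z = "\<lambda>k. of_real r * cis (2 * pi * real k / real n)"
  have "(\<Sum>k<n. ln (cmod (poly q (?z k)))) =
      real n * ln (cmod (lead_coeff q)) + zero_measure_integral q (\<lambda>w. \<Sum>k<n. ln (cmod (?z k - w)))"
    using nz by (simp add: ln_cmod_poly sum.distrib zero_measure_integral_sum)
  also have "zero_measure_integral q (\<lambda>w. \<Sum>k<n. ln (cmod (?z k - w))) \<le>
      zero_measure_integral q (\<lambda>w. real n * ln (max r (cmod w)) + ln 2)"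
    using nz by (intro zero_measure_integral_mono sum_ln_cmod_diff_circle_le r n) auto
  also have "\<dots> = real n * zero_measure_integral q (\<lambda>w. ln (max r (cmod w))) +
      zero_measure_integral q (\<lambda>w. ln 2)"
    by (simp add: zero_measure_integral_add zero_measure_integral_mult_left)
  also have "zero_measure_integral q (\<lambda>w. ln 2) \<le> real (degree q) * ln 2"
    using abs_zero_measure_integral_le[of "\<lambda>_. ln 2" "ln 2" q] by simp
  finally have "(\<Sum>k<n. ln (cmod (poly q (?z k)))) \<le> real n * log_mahler q r + real (degree q) * ln 2"
    by (simp add: log_mahler_def ring_distribs)
  then show ?thesis
    using n by (simp add: field_simps)
qed

lemma log_mahler_ge_of_large_values:
  assumes n: "n > 0" and s: "s \<le> s'"
    and large: "\<And>k. k < n \<Longrightarrow> exp v < cmod (poly q (of_real (exp s') * cis (2 * pi * real k / real n)))"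
  shows "v - real (degree q) * (ln 2 / real n + (s' - s)) \<le> log_mahler q (exp s)"
proof -
  let ?z = "\<lambda>k. of_real (exp s') * cis (2 * pi * real k / real n)"
  have nz: "poly q (?z k) \<noteq> 0" if "k < n" for k
    using large[OF that] exp_gt_zero[of v] by (metis less_asym norm_zero)
  then have q: "q \<noteq> 0"
    using n by force
  have "v = (\<Sum>k<n. v) / real n"
    using n by simp
  also have "\<dots> \<le> (\<Sum>k<n. ln (cmod (poly q (?z k)))) / real n"
  proof (intro divide_right_mono sum_mono)
    fix k
    assume "k \<in> {..<n}"
    then show "v \<le> ln (cmod (poly q (?z k)))"
      using large[of k] nz[of k] by (simp add: ln_ge_iff)
  qed simp
  also have "\<dots> \<le> log_mahler q (exp s') + real (degree q) * ln 2 / real n"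
    using log_mahler_ge_average[OF q exp_gt_zero n nz] by simp
  also have "log_mahler q (exp s') \<le> log_mahler q (exp s) + real (degree q) * (s' - s)"
    using log_mahler_lipschitz[of "exp s'" "exp s" q] s by simp
  finally show ?thesis
    by (simp add: algebra_simps)
qed

definition disc_fold :: "real \<Rightarrow> complex \<Rightarrow> complex" where
  "disc_fold r w = (if cmod w \<le> r then cnj w / of_real r else of_real r / w)"

lemma cmod_disc_fold_le_1: "r > 0 \<Longrightarrow> cmod (disc_fold r w) \<le> 1"
  by (auto simp: disc_fold_def norm_divide divide_simps)

lemma disc_fold_rotate: "disc_fold r (cis \<theta> * w) = cis (- \<theta>) * disc_fold r w"
  by (simp add: disc_fold_def norm_mult cis_cnj divide_inverse inverse_mult_distrib mult_ac
      flip: cis_inverse)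

lemma continuous_on_disc_fold:
  assumes "r > 0"
  shows "continuous_on A (disc_fold r)"
proof -
  have "continuous_on ({w. cmod w \<le> r} \<union> {w. r \<le> cmod w}) (disc_fold r)"
    unfolding disc_fold_def
  proof (rule continuous_on_cases)
    show "closed {w. cmod w \<le> r}" "closed {w. r \<le> cmod w}"
      by (intro closed_Collect_le continuous_intros)+
    show "continuous_on {w. cmod w \<le> r} (\<lambda>w. cnj w / of_real r)"
      "continuous_on {w. r \<le> cmod w} (\<lambda>w. of_real r / w)"
      using assms by (auto intro!: continuous_intros)
    have "cnj w / of_real (cmod w) = of_real (cmod w) / w" for w
      using complex_norm_square[of w] by (cases "w = 0") (auto simp: field_simps power2_eq_square)
    then show "\<forall>w. w \<in> {w. cmod w \<le> r} \<and> \<not> cmod w \<le> r \<or> w \<in> {w. r \<le> cmod w} \<and> cmod w \<le> r \<longrightarrow>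
        cnj w / of_real r = of_real r / w"
      by (metis antisym mem_Collect_eq)
  qed
  moreover have "{w. cmod w \<le> r} \<union> {w. r \<le> cmod w} = UNIV"
    by auto
  ultimately show ?thesis
    by (metis continuous_on_subset subset_UNIV)
qed

lemma max_cmod_mult_cmod_one_minus_disc_fold:
  assumes r: "r > 0" and \<zeta>: "cmod \<zeta> = 1"
  shows "max r (cmod w) * cmod (1 - \<zeta> * disc_fold r w) = cmod (of_real r * \<zeta> - w)"
proof (cases "cmod w \<le> r")
  case True
  have "\<zeta> * cnj \<zeta> = 1"
    using \<zeta> complex_norm_square[of \<zeta>] by simp
  then have "of_real r * (1 - \<zeta> * disc_fold r w) = \<zeta> * cnj (of_real r * \<zeta> - w)"
    using True r by (simp add: disc_fold_def algebra_simps)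
  then have "r * cmod (1 - \<zeta> * disc_fold r w) = cmod (of_real r * \<zeta> - w)"
    using r \<zeta> by (metis abs_of_pos complex_mod_cnj mult_1 norm_mult norm_of_real)
  then show ?thesis
    using True by (simp add: max_def)
next
  case False
  then have "w \<noteq> 0"
    using r by auto
  then have "w * (1 - \<zeta> * disc_fold r w) = w - of_real r * \<zeta>"
    using False by (simp add: disc_fold_def field_simps)
  then have "cmod w * cmod (1 - \<zeta> * disc_fold r w) = cmod (of_real r * \<zeta> - w)"
    by (metis norm_minus_commute norm_mult)
  then show ?thesis
    using False by (simp add: max_def)
qed

text \<open>Replacing every factor z - w of q by a multiple of 1 - \<zeta> * disc_fold r w, where z = r \<zeta>, keeps the
  modulus on the circle and removes all zeros from the disc.\<close>

lemma log_mahler_disc_fold_le: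
  assumes q: "q \<noteq> 0" and r: "r > 0" and B: "\<And>z. cmod z = r \<Longrightarrow> cmod (poly q z) \<le> B"
    and \<zeta>: "cmod \<zeta> < 1"
  shows "log_mahler q r + zero_measure_integral q (\<lambda>w. ln (cmod (1 - \<zeta> * disc_fold r w))) \<le> ln B"
proof -
  define G where "G \<zeta> = lead_coeff q * (\<Prod>w | poly q w = 0.
      (of_real (max r (cmod w)) * (1 - \<zeta> * disc_fold r w)) ^ order w q)" for \<zeta>
  have max_pos: "0 < max r (cmod w)" for w
    using r by (simp add: less_max_iff_disj)
  have cmod_G: "cmod (G \<zeta>) = cmod (lead_coeff q) * (\<Prod>w | poly q w = 0.
      (max r (cmod w) * cmod (1 - \<zeta> * disc_fold r w)) ^ order w q)" for \<zeta>
    using max_pos by (simp add: G_def norm_mult norm_power abs_of_pos flip: prod_norm)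
  have boundary: "cmod (G \<zeta>) = cmod (poly q (of_real r * \<zeta>))" if "cmod \<zeta> = 1" for \<zeta>
    unfolding cmod_G cmod_poly_eq_prod_roots
    using max_cmod_mult_cmod_one_minus_disc_fold[OF r that] by simp
  have hol: "G holomorphic_on A" for A
    unfolding G_def by (intro holomorphic_intros)
  have G_le: "cmod (G \<zeta>) \<le> B"
  proof (rule maximum_modulus_frontier[of G "cball 0 1"])
    show "continuous_on (closure (cball 0 1)) G"
      using hol by (rule holomorphic_on_imp_continuous_on)
  qed (use B boundary r \<zeta> hol in \<open>auto simp: frontier_cball sphere_def norm_mult\<close>)
  have factor_pos: "0 < max r (cmod w) * cmod (1 - \<zeta> * disc_fold r w)" for w
  proof -
    have "cmod (\<zeta> * disc_fold r w) < 1"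
      using mult_left_mono[OF cmod_disc_fold_le_1[OF r, of w], of "cmod \<zeta>"] \<zeta> by (simp add: norm_mult)
    then show ?thesis
      using max_pos by (intro mult_pos_pos norm_less_one_imp_norm_one_minus_pos)
  qed
  have prod_pos: "0 < (\<Prod>w | poly q w = 0. (max r (cmod w) * cmod (1 - \<zeta> * disc_fold r w)) ^ order w q)"
    by (intro prod_pos zero_less_power factor_pos)
  have lead_pos: "0 < cmod (lead_coeff q)"
    using q by simp
  have "ln (cmod (G \<zeta>)) = ln (cmod (lead_coeff q)) +
      zero_measure_integral q (\<lambda>w. ln (max r (cmod w) * cmod (1 - \<zeta> * disc_fold r w)))"
    unfolding cmod_G ln_prod_power_order[OF q factor_pos, symmetric]
    by (rule ln_mult_pos[OF lead_pos prod_pos])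
  also have "\<dots> = log_mahler q r + zero_measure_integral q (\<lambda>w. ln (cmod (1 - \<zeta> * disc_fold r w)))"
    unfolding log_mahler_def add.assoc zero_measure_integral_add[symmetric]
    using max_pos factor_pos by (simp add: ln_mult_pos zero_less_mult_iff)
  finally show ?thesis
    using ln_mono[OF G_le] mult_pos_pos[OF lead_pos prod_pos] by (simp only: cmod_G)
qed

lemma log_mahler_le:
  assumes "q \<noteq> 0" "r > 0" "\<And>z. cmod z = r \<Longrightarrow> cmod (poly q z) \<le> B"
  shows "log_mahler q r \<le> ln B"
  using log_mahler_disc_fold_le[OF assms, of 0] by (simp add: zero_measure_integral_def)

lemma cmod_less_cmod_diff_of_real:
  assumes "Re u < T" "0 < T"
  shows "cmod u < cmod (of_real (2 * T) - u)"
proof -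
  have "(2 * T) * Re u < (2 * T) * T"
    using assms by simp
  then have "(cmod u)\<^sup>2 < (cmod (of_real (2 * T) - u))\<^sup>2"
    unfolding cmod_power2 by (simp add: power2_eq_square algebra_simps)
  then show ?thesis
    using power2_less_imp_less norm_ge_zero by blast
qed

text \<open>Compose with the Moebius map u / (2 T - u) from the half plane Re u < T to the disc.\<close>

lemma half_plane_schwarz:
  assumes hol: "h holomorphic_on ball 0 1" and h0: "h 0 = 0"
    and Re_h: "\<And>z. cmod z < 1 \<Longrightarrow> Re (h z) < T"
  shows "cmod (deriv h 0) \<le> 2 * T"
proof -
  have T: "0 < T"
    using Re_h[of 0] h0 by simp
  define f where "f z = h z / (of_real (2 * T) - h z)" for z
  have less: "cmod (h z) < cmod (of_real (2 * T) - h z)" if "cmod z < 1" for z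
    using Re_h[OF that] T by (rule cmod_less_cmod_diff_of_real)
  have nz: "of_real (2 * T) - h z \<noteq> 0" if "cmod z < 1" for z
    using less[OF that] by auto
  have "f holomorphic_on ball 0 1"
    unfolding f_def using nz by (intro holomorphic_intros hol) auto
  moreover have "cmod (f z) < 1" if "cmod z < 1" for z
    using less[OF that] nz[OF that] by (simp add: f_def norm_divide)
  ultimately have "cmod (deriv f 0) \<le> 1"
    by (intro Schwarz_Lemma(2)[of f 0]) (auto simp: f_def h0)
  moreover have "(f has_field_derivative deriv h 0 / of_real (2 * T)) (at 0)"
  proof -
    have "(h has_field_derivative deriv h 0) (at 0)"
      using hol by (rule holomorphic_derivI) auto
    from DERIV_divide[OF this DERIV_diff[OF DERIV_const[of "of_real (2 * T)"] this]] show ?thesis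
      unfolding f_def using T h0 by (simp add: field_simps)
  qed
  ultimately show ?thesis
    using T by (simp add: DERIV_imp_deriv norm_divide)
qed

lemma cmod_sum_le_of_sum_ln_le:
  fixes b :: "'i \<Rightarrow> complex" and n :: "'i \<Rightarrow> real"
  assumes b: "\<And>w. cmod (b w) \<le> 1"
    and le: "\<And>\<zeta>. cmod \<zeta> < 1 \<Longrightarrow> (\<Sum>w\<in>S. n w * ln (cmod (1 - \<zeta> * b w))) \<le> T"
  shows "cmod (\<Sum>w\<in>S. n w *\<^sub>R b w) \<le> 2 * T"
proof (rule field_le_epsilon)
  fix e :: real
  assume e: "0 < e"
  define h where "h \<zeta> = (\<Sum>w\<in>S. n w *\<^sub>R Ln (1 - \<zeta> * b w))" for \<zeta>
  have less: "cmod (\<zeta> * b w) < 1" if "cmod \<zeta> < 1" for \<zeta> w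
    using mult_left_mono[OF b[of w], of "cmod \<zeta>"] that by (simp add: norm_mult)
  have "0 < Re (1 - \<zeta> * b w)" if "cmod \<zeta> < 1" for \<zeta> w
    using less[OF that, of w] complex_Re_le_cmod[of "\<zeta> * b w"]
    unfolding minus_complex.sel one_complex.sel by linarith
  then have nonpos: "1 - \<zeta> * b w \<notin> \<real>\<^sub>\<le>\<^sub>0" if "cmod \<zeta> < 1" for \<zeta> w
    using that unfolding complex_nonpos_Reals_iff not_le[symmetric] by blast
  have "h holomorphic_on ball 0 1"
    unfolding h_def scaleR_conv_of_real by (intro holomorphic_intros nonpos) simp
  moreover have "Re (h \<zeta>) < T + e / 2" if "cmod \<zeta> < 1" for \<zeta>
  proof -
    have "Re (Ln (1 - \<zeta> * b w)) = ln (cmod (1 - \<zeta> * b w))" for w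
      using nonpos[OF that, of w] by (intro Re_Ln) auto
    then show ?thesis
      using le[OF that] e by (simp add: h_def)
  qed
  ultimately have "cmod (deriv h 0) \<le> 2 * (T + e / 2)"
    by (intro half_plane_schwarz) (auto simp: h_def)
  moreover have "(h has_field_derivative (\<Sum>w\<in>S. - (n w *\<^sub>R b w))) (at 0)"
    unfolding h_def scaleR_conv_of_real by (auto intro!: derivative_eq_intros sum.cong)
  ultimately show "cmod (\<Sum>w\<in>S. n w *\<^sub>R b w) \<le> 2 * T + e"
    by (simp add: DERIV_imp_deriv sum_negf)
qed

lemma disc_fold_power_log_le:
  assumes q: "q \<noteq> 0" and r: "r > 0" and m: "m > 0"
    and B: "\<And>z. cmod z = r \<Longrightarrow> cmod (poly q z) \<le> B" and \<zeta>: "cmod \<zeta> < 1"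
  shows "zero_measure_integral q (\<lambda>w. ln (cmod (1 - \<zeta> * disc_fold r w ^ m)))
    \<le> real m * (ln B - log_mahler q r)"
proof -
  obtain u where u: "\<zeta> = u ^ m"
    using m by (auto intro: exists_complex_root[of m \<zeta>])
  then have "cmod u ^ m < 1"
    using \<zeta> by (simp add: norm_power)
  then have cmod_u: "cmod u < 1"
    by (metis not_le one_le_power)
  have "cmod (u * disc_fold r w) < 1" for w
    using mult_left_mono[OF cmod_disc_fold_le_1[OF r, of w], of "cmod u"] cmod_u
    by (simp add: norm_mult)
  then have "ln (cmod (1 - \<zeta> * disc_fold r w ^ m)) =
      (\<Sum>k<m. ln (cmod (1 - cis (2 * pi * real k / real m) * u * disc_fold r w)))" for w
    using ln_cmod_one_minus_power[OF m, of "u * disc_fold r w"]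
    by (simp add: u power_mult_distrib mult.assoc)
  then have "zero_measure_integral q (\<lambda>w. ln (cmod (1 - \<zeta> * disc_fold r w ^ m))) =
      (\<Sum>k<m. zero_measure_integral q
        (\<lambda>w. ln (cmod (1 - cis (2 * pi * real k / real m) * u * disc_fold r w))))"
    by (simp add: zero_measure_integral_sum)
  also have "\<dots> \<le> (\<Sum>k<m. ln B - log_mahler q r)"
  proof (rule sum_mono)
    fix k
    have "cmod (cis (2 * pi * real k / real m) * u) < 1"
      using cmod_u by (simp add: norm_mult)
    from log_mahler_disc_fold_le[OF q r B this]
    show "zero_measure_integral q (\<lambda>w. ln (cmod (1 - cis (2 * pi * real k / real m) * u * disc_fold r w)))
        \<le> ln B - log_mahler q r"
      by simp
  qed
  finally show ?thesis
    by simp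
qed

lemma disc_fold_moment_le:
  assumes q: "q \<noteq> 0" and r: "r > 0" and m: "m > 0"
    and B: "\<And>z. cmod z = r \<Longrightarrow> cmod (poly q z) \<le> B"
  shows "\<bar>zero_measure_integral q (\<lambda>w. Re (c * disc_fold r w ^ m))\<bar>
    \<le> 2 * cmod c * real m * (ln B - log_mahler q r)"
proof -
  let ?S = "\<Sum>w | poly q w = 0. real (order w q) *\<^sub>R disc_fold r w ^ m"
  have S_le: "cmod ?S \<le> 2 * (real m * (ln B - log_mahler q r))"
    using disc_fold_power_log_le[OF q r m B] cmod_disc_fold_le_1[OF r] unfolding zero_measure_integral_def
    by (intro cmod_sum_le_of_sum_ln_le) (auto simp: norm_power intro: power_le_one)
  have "zero_measure_integral q (\<lambda>w. Re (c * disc_fold r w ^ m)) = Re (c * ?S)"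
    by (simp only: zero_measure_integral_def sum_distrib_left mult_scaleR_right Re_sum scaleR_complex.sel)
  also have "\<bar>\<dots>\<bar> \<le> cmod c * cmod ?S"
    using abs_Re_le_cmod[of "c * ?S"] by (simp only: norm_mult)
  also have "\<dots> \<le> cmod c * (2 * (real m * (ln B - log_mahler q r)))"
    using S_le by (intro mult_left_mono) auto
  finally show ?thesis
    by (simp only: mult_ac)
qed

subsection \<open>Convergence in probability as a filter\<close>

text \<open>Convergence in probability is convergence along this filter. The exceptional events only have to cover
  the bad set, whose own measurability is never needed.\<close>

definition whp :: "'a measure \<Rightarrow> (nat \<times> 'a) filter" where
  "whp M = Abs_filter (\<lambda>P. \<forall>e>0. \<forall>\<^sub>F n in sequentially.
     \<exists>E\<in>sets M. measure M E \<le> e \<and> (\<forall>\<omega>\<in>space M - E. P (n, \<omega>)))"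

context prob_space
begin

lemma eventually_whp:
  "eventually P (whp M) \<longleftrightarrow> (\<forall>e>0. \<forall>\<^sub>F n in sequentially.
     \<exists>E\<in>events. prob E \<le> e \<and> (\<forall>\<omega>\<in>space M - E. P (n, \<omega>)))"
proof -
  let ?covered = "\<lambda>P n e. \<exists>E\<in>events. prob E \<le> e \<and> (\<forall>\<omega>\<in>space M - E. P (n, \<omega>))"
  have covered_conj: "?covered (\<lambda>x. P x \<and> Q x) n e" if "?covered P n (e / 2)" "?covered Q n (e / 2)"
    for P Q n e
  proof -
    from that obtain E E' where "E \<in> events" "prob E \<le> e / 2" "\<forall>\<omega>\<in>space M - E. P (n, \<omega>)"
      and "E' \<in> events" "prob E' \<le> e / 2" "\<forall>\<omega>\<in>space M - E'. Q (n, \<omega>)"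
      by blast
    then show ?thesis
      using measure_Un_le[of E M E'] by (intro bexI[of _ "E \<union> E'"]) auto
  qed
  have "is_filter (\<lambda>P. \<forall>e>0. \<forall>\<^sub>F n in sequentially. ?covered P n e)"
  proof
    show "\<forall>e>0. \<forall>\<^sub>F n in sequentially. ?covered (\<lambda>x. True) n e"
      by (auto intro!: bexI[of _ "{}"])
  next
    fix P Q
    assume PQ: "\<forall>e>0. \<forall>\<^sub>F n in sequentially. ?covered P n e" "\<forall>e>0. \<forall>\<^sub>F n in sequentially. ?covered Q n e"
    show "\<forall>e>0. \<forall>\<^sub>F n in sequentially. ?covered (\<lambda>x. P x \<and> Q x) n e"
    proof (intro allI impI)
      fix e :: real
      assume "0 < e"
      then have "\<forall>\<^sub>F n in sequentially. ?covered P n (e / 2)" "\<forall>\<^sub>F n in sequentially. ?covered Q n (e / 2)"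
        using PQ half_gt_zero by blast+
      then show "\<forall>\<^sub>F n in sequentially. ?covered (\<lambda>x. P x \<and> Q x) n e"
        by eventually_elim (rule covered_conj)
    qed
  next
    fix P Q :: "nat \<times> 'a \<Rightarrow> bool"
    assume PQ: "\<forall>x. P x \<longrightarrow> Q x" and P: "\<forall>e>0. \<forall>\<^sub>F n in sequentially. ?covered P n e"
    show "\<forall>e>0. \<forall>\<^sub>F n in sequentially. ?covered Q n e"
    proof (intro allI impI)
      fix e :: real
      assume "0 < e"
      with P have "\<forall>\<^sub>F n in sequentially. ?covered P n e"
        by blast
      then show "\<forall>\<^sub>F n in sequentially. ?covered Q n e"
        by (rule eventually_mono) (use PQ in blast)
    qed
  qed
  then show ?thesis
    unfolding whp_def by (rule eventually_Abs_filter)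
qed

lemma eventually_sequentially_imp_whp:
  assumes "eventually Q sequentially"
  shows "\<forall>\<^sub>F (n, \<omega>) in whp M. Q n"
  unfolding eventually_whp
proof (intro allI impI)
  fix e :: real
  assume "0 < e"
  from assms show "\<forall>\<^sub>F n in sequentially. \<exists>E\<in>events. prob E \<le> e \<and>
      (\<forall>\<omega>\<in>space M - E. case (n, \<omega>) of (n, \<omega>) \<Rightarrow> Q n)"
    by eventually_elim (use \<open>0 < e\<close> in \<open>auto intro!: bexI[of _ "{}"]\<close>)
qed

lemma eventually_whp_imp_tendsto_prob:
  assumes "eventually P (whp M)"
  shows "(\<lambda>n. prob {\<omega>\<in>space M. \<not> P (n, \<omega>)}) \<longlonglongrightarrow> 0"
proof (rule tendstoI)
  fix e :: real
  assume e: "0 < e"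
  then have "\<forall>\<^sub>F n in sequentially. \<exists>E\<in>events. prob E \<le> e / 2 \<and> (\<forall>\<omega>\<in>space M - E. P (n, \<omega>))"
    using assms half_gt_zero unfolding eventually_whp by blast
  then show "\<forall>\<^sub>F n in sequentially. dist (prob {\<omega>\<in>space M. \<not> P (n, \<omega>)}) 0 < e"
  proof eventually_elim
    case (elim n)
    then obtain E where E: "E \<in> events" "prob E \<le> e / 2" "\<forall>\<omega>\<in>space M - E. P (n, \<omega>)"
      by blast
    have "prob {\<omega>\<in>space M. \<not> P (n, \<omega>)} \<le> prob E"
      using E by (cases "{\<omega>\<in>space M. \<not> P (n, \<omega>)} \<in> events")
        (auto intro!: finite_measure_mono simp: measure_notin_sets)
    then show ?case
      using E e by simp
  qed
qed

lemma union_bound_event: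
  fixes Y :: "nat \<Rightarrow> 'a \<Rightarrow> real"
  assumes [measurable]: "\<And>j. random_variable borel (Y j)" and "0 < N"
    and le: "\<And>j. j < N \<Longrightarrow> prob {\<omega>\<in>space M. Y j \<omega> \<le> v} \<le> \<theta> / real N"
  shows "\<exists>E\<in>events. prob E \<le> \<theta> \<and> (\<forall>\<omega>\<in>space M - E. \<forall>j<N. v < Y j \<omega>)"
proof (intro bexI conjI)
  let ?E = "\<Union>j\<in>{..<N}. {\<omega>\<in>space M. Y j \<omega> \<le> v}"
  have "prob ?E \<le> (\<Sum>j<N. prob {\<omega>\<in>space M. Y j \<omega> \<le> v})"
    by (intro measure_UNION_le) auto
  also have "\<dots> \<le> (\<Sum>j<N. \<theta> / real N)"
    by (intro sum_mono le) simp
  finally show "prob ?E \<le> \<theta>"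
    using \<open>0 < N\<close> by simp
  show "?E \<in> events"
    by measurable
  show "\<forall>\<omega>\<in>space M - ?E. \<forall>j<N. v < Y j \<omega>"
    by (auto simp: not_le)
qed

lemma integrable_imp_tail_tendsto_0:
  fixes X :: "'a \<Rightarrow> real"
  assumes X: "integrable M X"
  shows "((\<lambda>t. t * prob {\<omega>\<in>space M. t < X \<omega>}) \<longlongrightarrow> 0) at_top"
proof -
  have [measurable]: "X \<in> borel_measurable M"
    using X by auto
  define A where "A t = {\<omega>\<in>space M. t < X \<omega>}" for t
  have [measurable]: "A t \<in> events" for t
    unfolding A_def by measurable
  have "((\<lambda>t. \<integral>\<omega>. X \<omega> * indicator (A t) \<omega> \<partial>M) \<longlongrightarrow> (\<integral>\<omega>. 0 \<partial>M)) at_top"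
  proof (rule integral_dominated_convergence_at_top[where w = "\<lambda>\<omega>. \<bar>X \<omega>\<bar>"])
    show "AE \<omega> in M. ((\<lambda>t. X \<omega> * indicator (A t) \<omega>) \<longlongrightarrow> 0) at_top"
    proof (rule AE_I2)
      fix \<omega>
      have "\<forall>\<^sub>F t in at_top. X \<omega> * indicator (A t) \<omega> = 0"
        using eventually_ge_at_top[of "X \<omega>"] by eventually_elim (auto simp: A_def indicator_def)
      then show "((\<lambda>t. X \<omega> * indicator (A t) \<omega>) \<longlongrightarrow> 0) at_top"
        by (rule tendsto_eventually)
    qed
  qed (use X in \<open>auto simp: indicator_def\<close>)
  then have expectation_lim: "((\<lambda>t. \<integral>\<omega>. X \<omega> * indicator (A t) \<omega> \<partial>M) \<longlongrightarrow> 0) at_top"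
    by simp
  have markov: "\<forall>\<^sub>F t in at_top. t * prob (A t) \<le> (\<integral>\<omega>. X \<omega> * indicator (A t) \<omega> \<partial>M)"
  proof (rule always_eventually, rule allI)
    fix t
    have "t * prob (A t) = (\<integral>\<omega>. t * indicator (A t) \<omega> \<partial>M)"
      by simp
    also have "\<dots> \<le> (\<integral>\<omega>. X \<omega> * indicator (A t) \<omega> \<partial>M)"
      using X by (intro integral_mono integrable_real_mult_indicator) (auto simp: indicator_def A_def)
    finally show "t * prob (A t) \<le> (\<integral>\<omega>. X \<omega> * indicator (A t) \<omega> \<partial>M)" .
  qed
  have "\<forall>\<^sub>F t in at_top. 0 \<le> t * prob (A t)"
    using eventually_ge_at_top[of 0] by eventually_elim simp
  from tendsto_sandwich[OF this markov tendsto_const expectation_lim] show ?thesis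
    unfolding A_def .
qed

end

subsection \<open>Concentration functions and lacunary sums\<close>

definition concentration :: "'a measure \<Rightarrow> ('a \<Rightarrow> 'b :: metric_space) \<Rightarrow> real \<Rightarrow> real" where
  "concentration M X r = (SUP b. measure M {\<omega>\<in>space M. dist (X \<omega>) b \<le> r})"

context prob_space
begin

lemma prob_dist_le_concentration: "prob {\<omega>\<in>space M. dist (X \<omega>) b \<le> r} \<le> concentration M X r"
  unfolding concentration_def by (rule cSUP_upper) (auto intro: bdd_aboveI2)

lemma concentration_least:
  "(\<And>b. prob {\<omega>\<in>space M. dist (X \<omega>) b \<le> r} \<le> q) \<Longrightarrow> concentration M X r \<le> q"
  unfolding concentration_def by (rule cSUP_least) auto

lemma concentration_nonneg: "0 \<le> concentration M X r"
  by (rule order_trans[OF measure_nonneg prob_dist_le_concentration])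

lemma concentration_cong_distr:
  assumes [measurable]: "random_variable borel X" "random_variable borel Y"
    and "distr M borel X = distr M borel Y"
  shows "concentration M X r = concentration M Y r"
proof -
  have "prob {\<omega>\<in>space M. dist (X \<omega>) b \<le> r} = prob {\<omega>\<in>space M. dist (Y \<omega>) b \<le> r}" for b
  proof -
    have "prob {\<omega>\<in>space M. dist (Z \<omega>) b \<le> r} = measure (distr M borel Z) (cball b r)"
      if [measurable]: "random_variable borel Z" for Z
      by (subst measure_distr) (auto intro!: arg_cong[where f = prob] simp: dist_commute)
    with assms show ?thesis
      by simp
  qed
  then show ?thesis
    by (simp add: concentration_def)
qed

lemma concentration_le_perturb:
  fixes X Y :: "'a \<Rightarrow> 'b :: {second_countable_topology, metric_space}"
  assumes [measurable]: "random_variable borel Y" and E: "E \<in> events"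
    and eq: "\<And>\<omega>. \<omega> \<in> space M \<Longrightarrow> \<omega> \<notin> E \<Longrightarrow> X \<omega> = Y \<omega>"
  shows "concentration M X r \<le> concentration M Y r + prob E"
proof (rule concentration_least)
  fix b
  have "prob {\<omega>\<in>space M. dist (X \<omega>) b \<le> r} \<le> prob ({\<omega>\<in>space M. dist (Y \<omega>) b \<le> r} \<union> E)"
    using E eq by (intro finite_measure_mono) auto
  also have "\<dots> \<le> prob {\<omega>\<in>space M. dist (Y \<omega>) b \<le> r} + prob E"
    using E by (intro measure_Un_le) measurable
  finally show "prob {\<omega>\<in>space M. dist (X \<omega>) b \<le> r} \<le> concentration M Y r + prob E"
    using prob_dist_le_concentration[of Y b r] by linarith
qed

lemma AE_tendsto_of_prob_dist_le:
  fixes X :: "'a \<Rightarrow> 'b :: {second_countable_topology, metric_space}"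
  assumes [measurable]: "random_variable borel X"
    and b: "\<And>n. 1 - (1/2) ^ n \<le> prob {\<omega>\<in>space M. dist (X \<omega>) (b n) \<le> (1/2) ^ n}"
  shows "AE \<omega> in M. b \<longlonglongrightarrow> X \<omega>"
proof -
  define A where "A n = space M - {\<omega>\<in>space M. dist (X \<omega>) (b n) \<le> (1/2) ^ n}" for n
  have [measurable]: "A n \<in> events" for n
    unfolding A_def by measurable
  have "prob (A n) \<le> (1/2) ^ n" for n
    using b[of n] by (simp add: A_def prob_compl)
  then have "summable (\<lambda>n. prob (A n))"
    by (intro summable_comparison_test[OF _ summable_geometric[of "1/2"]]) auto
  then have "AE \<omega> in M. \<forall>\<^sub>F n in sequentially. \<omega> \<in> space M - A n"
    by (intro borel_cantelli_AE1) (auto simp: emeasure_eq_measure)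
  then show ?thesis
  proof eventually_elim
    case (elim \<omega>)
    then have "\<forall>\<^sub>F n in sequentially. norm (dist (b n) (X \<omega>)) \<le> (1/2) ^ n"
      by eventually_elim (auto simp: A_def dist_commute)
    then have "(\<lambda>n. dist (b n) (X \<omega>)) \<longlonglongrightarrow> 0"
      by (rule Lim_null_comparison) (auto intro: LIMSEQ_realpow_zero)
    then show ?case
      by (simp flip: tendsto_dist_iff)
  qed
qed

text \<open>If balls of radius 2^-n carried mass 1 - 2^-n, then by Borel-Cantelli their centers would converge to
  X almost surely.\<close>

lemma nondegenerate_imp_concentration_less_1:
  fixes X :: "'a \<Rightarrow> 'b :: {second_countable_topology, metric_space}"
  assumes X: "random_variable borel X" and nondeg: "\<not> (\<exists>c. AE \<omega> in M. X \<omega> = c)"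
  obtains r where "0 < r" "concentration M X r < 1"
proof -
  have False if ge: "\<And>r. 0 < r \<Longrightarrow> \<not> concentration M X r < 1"
  proof -
    have "\<exists>b. 1 - (1/2) ^ n \<le> prob {\<omega>\<in>space M. dist (X \<omega>) b \<le> (1/2) ^ n}" for n
    proof -
      have "1 - (1/2) ^ n < concentration M X ((1/2) ^ n)"
        using ge[of "(1/2) ^ n"] by (simp add: not_less order_less_le_trans[of _ 1])
      then show ?thesis
        using concentration_least[of X "(1/2) ^ n" "1 - (1/2) ^ n"] by (meson linear not_le)
    qed
    then obtain b where "\<And>n. 1 - (1/2) ^ n \<le> prob {\<omega>\<in>space M. dist (X \<omega>) (b n) \<le> (1/2) ^ n}"
      by metis
    then have b_lim: "AE \<omega> in M. b \<longlonglongrightarrow> X \<omega>"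
      by (rule AE_tendsto_of_prob_dist_le[OF X])
    then obtain c where c: "b \<longlonglongrightarrow> c"
      using eventually_happens[of _ "ae_filter M"] ae_filter_bot by blast
    from b_lim have "AE \<omega> in M. X \<omega> = c"
      by eventually_elim (rule LIMSEQ_unique[OF _ c])
    with nondeg show False
      by blast
  qed
  then show ?thesis
    using that by blast
qed

lemma prob_indep_var_le:
  assumes ind: "indep_var S X T Y" and A: "A \<in> sets S" and E: "E \<in> sets (S \<Otimes>\<^sub>M T)" and q: "0 \<le> q"
    and section_le: "\<And>x. x \<in> A \<Longrightarrow> prob {\<omega>\<in>space M. (x, Y \<omega>) \<in> E} \<le> q"
  shows "prob {\<omega>\<in>space M. X \<omega> \<in> A \<and> (X \<omega>, Y \<omega>) \<in> E} \<le> prob {\<omega>\<in>space M. X \<omega> \<in> A} * q"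
proof -
  have [measurable]: "random_variable S X" "random_variable T Y"
    and joint: "distr M S X \<Otimes>\<^sub>M distr M T Y = distr M (S \<Otimes>\<^sub>M T) (\<lambda>\<omega>. (X \<omega>, Y \<omega>))"
    using ind unfolding indep_var_distribution_eq by auto
  note [measurable] = A E
  interpret Y: prob_space "distr M T Y"
    by (rule prob_space_distr) simp
  define E' where "E' = E \<inter> A \<times> space T"
  have E'[measurable]: "E' \<in> sets (S \<Otimes>\<^sub>M T)"
    unfolding E'_def by measurable
  have slice_le: "emeasure (distr M T Y) (Pair x -` E') \<le> ennreal q * indicator A x" for x
  proof (cases "x \<in> A")
    case True
    have "emeasure (distr M T Y) (Pair x -` E') = emeasure M {\<omega>\<in>space M. (x, Y \<omega>) \<in> E'}"
      using measurable_Pair1_compose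
      by (subst emeasure_distr) (auto intro!: arg_cong[where f = "emeasure M"])
    also have "{\<omega>\<in>space M. (x, Y \<omega>) \<in> E'} = {\<omega>\<in>space M. (x, Y \<omega>) \<in> E}"
      using True measurable_space[of Y M T] by (auto simp: E'_def)
    finally show ?thesis
      using section_le[OF True] True q by (simp add: emeasure_eq_measure ennreal_leI)
  next
    case False
    then have "Pair x -` E' = {}"
      by (auto simp: E'_def)
    then show ?thesis
      by simp
  qed
  have "emeasure M {\<omega>\<in>space M. X \<omega> \<in> A \<and> (X \<omega>, Y \<omega>) \<in> E} =
      emeasure (distr M (S \<Otimes>\<^sub>M T) (\<lambda>\<omega>. (X \<omega>, Y \<omega>))) E'"
    using measurable_space[of Y M T]
    by (subst emeasure_distr) (auto simp: E'_def intro!: arg_cong[where f = "emeasure M"])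
  also have "\<dots> = (\<integral>\<^sup>+x. emeasure (distr M T Y) (Pair x -` E') \<partial>distr M S X)"
    unfolding joint[symmetric] by (rule Y.emeasure_pair_measure_alt) (simp cong: sets_pair_measure_cong)
  also have "\<dots> \<le> (\<integral>\<^sup>+x. ennreal q * indicator A x \<partial>distr M S X)"
    by (rule nn_integral_mono) (rule slice_le)
  also have "\<dots> = ennreal q * emeasure (distr M S X) A"
    by (rule nn_integral_cmult_indicator) simp
  also have "emeasure (distr M S X) A = emeasure M {\<omega>\<in>space M. X \<omega> \<in> A}"
    by (subst emeasure_distr) (auto intro!: arg_cong[where f = "emeasure M"])
  finally show ?thesis
    using q by (simp add: emeasure_eq_measure ennreal_mult[symmetric] mult.commute)
qed

lemma prob_indep_add_le:
  fixes X Y :: "'a \<Rightarrow> 'b :: {second_countable_topology, real_normed_vector}"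
  assumes ind: "indep_var borel X borel Y" and A: "A \<in> sets borel"
  shows "prob {\<omega>\<in>space M. X \<omega> \<in> A \<and> dist (X \<omega> + Y \<omega>) b \<le> r} \<le>
    prob {\<omega>\<in>space M. X \<omega> \<in> A} * concentration M Y r"
proof -
  define E where "E = {x \<in> space (borel \<Otimes>\<^sub>M borel). dist (fst x + snd x :: 'b) b \<le> r}"
  have E: "E \<in> sets (borel \<Otimes>\<^sub>M borel)"
    unfolding E_def by measurable
  have "prob {\<omega>\<in>space M. (x, Y \<omega>) \<in> E} \<le> concentration M Y r" for x
    using prob_dist_le_concentration[of Y "b - x" r]
    by (simp add: E_def space_pair_measure dist_norm algebra_simps)
  from prob_indep_var_le[OF ind A E concentration_nonneg this] show ?thesis
    by (simp add: E_def space_pair_measure)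
qed

lemma concentration_indep_add_le:
  fixes X Y :: "'a \<Rightarrow> 'b :: {second_countable_topology, real_normed_vector}"
  assumes "indep_var borel X borel Y"
  shows "concentration M (\<lambda>\<omega>. X \<omega> + Y \<omega>) r \<le> concentration M Y r"
proof (rule concentration_least)
  show "prob {\<omega>\<in>space M. dist (X \<omega> + Y \<omega>) b \<le> r} \<le> concentration M Y r" for b
    using prob_indep_add_le[OF assms, of UNIV b r] prob_space by simp
qed

lemma concentration_indep_add_le_mult:
  fixes X Y :: "'a \<Rightarrow> 'b :: {second_countable_topology, real_normed_vector}"
  assumes indep: "indep_var borel X borel Y"
    and determined: "\<And>\<omega> b. dist (X \<omega> + Y \<omega>) b \<le> r \<Longrightarrow> dist (X \<omega>) b \<le> s"
  shows "concentration M (\<lambda>\<omega>. X \<omega> + Y \<omega>) r \<le> concentration M X s * concentration M Y r"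
proof (rule concentration_least)
  fix b
  have "{\<omega>\<in>space M. dist (X \<omega> + Y \<omega>) b \<le> r} = {\<omega>\<in>space M. X \<omega> \<in> cball b s \<and> dist (X \<omega> + Y \<omega>) b \<le> r}"
    using determined by (auto simp: dist_commute[of b])
  also have "prob \<dots> \<le> prob {\<omega>\<in>space M. X \<omega> \<in> cball b s} * concentration M Y r"
    by (rule prob_indep_add_le[OF indep]) simp
  also have "\<dots> \<le> concentration M X s * concentration M Y r"
    using prob_dist_le_concentration[of X b s]
    by (intro mult_right_mono concentration_nonneg) (simp add: dist_commute[of b])
  finally show "prob {\<omega>\<in>space M. dist (X \<omega> + Y \<omega>) b \<le> r} \<le> concentration M X s * concentration M Y r" .
qed

lemma indep_vars_imp_indep_var_sum:
  fixes X :: "'i \<Rightarrow> 'a \<Rightarrow> 'b :: {second_countable_topology, topological_comm_monoid_add}"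
  assumes indep: "indep_vars (\<lambda>_. borel) X I" and disj: "A \<inter> B = {}" and sub: "A \<subseteq> I" "B \<subseteq> I"
  shows "indep_var borel (\<lambda>\<omega>. \<Sum>i\<in>A. X i \<omega>) borel (\<lambda>\<omega>. \<Sum>i\<in>B. X i \<omega>)"
proof -
  have "indep_var borel ((\<lambda>f. \<Sum>i\<in>A. f i) \<circ> (\<lambda>\<omega>. restrict (\<lambda>i. X i \<omega>) A))
      borel ((\<lambda>f. \<Sum>i\<in>B. f i) \<circ> (\<lambda>\<omega>. restrict (\<lambda>i. X i \<omega>) B))"
    by (intro indep_var_compose[OF indep_var_restrict[OF indep disj sub]]) auto
  then show ?thesis
    by (simp add: comp_def cong: sum.cong)
qed

end

definition lacunary_on :: "'i set \<Rightarrow> real \<Rightarrow> ('i \<Rightarrow> real) \<Rightarrow> bool" where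
  "lacunary_on K B u \<longleftrightarrow> (\<forall>j\<in>K. \<forall>k\<in>K. j \<noteq> k \<longrightarrow> B * u j \<le> u k \<or> B * u k \<le> u j)"

lemma lacunary_on_subset: "lacunary_on K B u \<Longrightarrow> S \<subseteq> K \<Longrightarrow> lacunary_on S B u"
  unfolding lacunary_on_def by blast

lemma lacunary_on_norm_sum_le:
  fixes x :: "'i \<Rightarrow> 'b :: real_normed_vector"
  assumes lac: "lacunary_on (insert k S) B u" and "k \<notin> S" and top: "\<And>j. j \<in> S \<Longrightarrow> u j \<le> u k"
    and u: "0 < u k" and x: "\<And>j. j \<in> S \<Longrightarrow> norm (x j) \<le> R * u j"
    and B: "1 < B" "2 * R * real (card S) \<le> c * B" and R: "0 \<le> R"
  shows "norm (\<Sum>j\<in>S. x j) \<le> c * u k / 2"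
proof -
  have x_le: "norm (x j) \<le> R * (u k / B)" if j: "j \<in> S" for j
  proof -
    have "u k < B * u k"
      using B u by simp
    then have "\<not> B * u k \<le> u j"
      using top[OF j] by linarith
    moreover have "j \<noteq> k"
      using j \<open>k \<notin> S\<close> by auto
    ultimately have "B * u j \<le> u k"
      using lac j unfolding lacunary_on_def by auto
    then have "u j \<le> u k / B"
      using B by (simp add: field_simps)
    then show ?thesis
      using x[OF j] R by (meson mult_left_mono order_trans)
  qed
  have "norm (\<Sum>j\<in>S. x j) \<le> real (card S) * (R * (u k / B))"
    by (rule sum_norm_bound) (rule x_le)
  also have "\<dots> = (2 * R * real (card S)) * (u k / (2 * B))"
    by simp
  also have "\<dots> \<le> (c * B) * (u k / (2 * B))"
    using B u by (intro mult_right_mono) auto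
  also have "\<dots> = c * u k / 2"
    using B by simp
  finally show ?thesis .
qed

context prob_space
begin

text \<open>Knowing a lacunary sum up to \<eta> determines its largest term up to c * u k, because the remaining ones are
  bounded by half of that; then the argument is repeated for the remaining sum.\<close>

lemma concentration_lacunary_sum:
  fixes X :: "'i \<Rightarrow> 'a \<Rightarrow> 'b :: {second_countable_topology, real_normed_vector}"
  assumes "finite K" and "indep_vars (\<lambda>_. borel) X K" and "lacunary_on K B u"
    and "\<And>k. k \<in> K \<Longrightarrow> 0 < u k" and "\<And>k. k \<in> K \<Longrightarrow> 2 * \<eta> \<le> c * u k"
    and "\<And>k \<omega>. k \<in> K \<Longrightarrow> norm (X k \<omega>) \<le> R * u k"
    and "\<And>k. k \<in> K \<Longrightarrow> concentration M (X k) (c * u k) \<le> q"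
    and B: "1 < B" and "2 * R * real (card K) \<le> c * B" and R: "0 \<le> R"
  shows "concentration M (\<lambda>\<omega>. \<Sum>k\<in>K. X k \<omega>) \<eta> \<le> q ^ card K"
  using assms(1-7,9)
proof (induction K rule: finite_ranking_induct[where f = u])
  case empty
  then show ?case
    by (auto intro: concentration_least)
next
  case (insert k S)
  show ?case
  proof (cases "k \<in> S")
    case True
    with insert show ?thesis
      by (simp add: insert_absorb)
  next
    case False
    note prems = insert.prems
    have card_S: "2 * R * real (card S) \<le> c * B"
      using prems(7) R insert.hyps False
        mult_left_mono[of "real (card S)" "real (card (insert k S))" "2 * R"] by simp
    have IH: "concentration M (\<lambda>\<omega>. \<Sum>j\<in>S. X j \<omega>) \<eta> \<le> q ^ card S"
      using prems card_S
      by (intro insert.IH indep_vars_subset[OF prems(1)] lacunary_on_subset[OF prems(2)]) auto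
    have indep: "indep_var borel (X k) borel (\<lambda>\<omega>. \<Sum>j\<in>S. X j \<omega>)"
      using indep_vars_imp_indep_var_sum[OF prems(1), of "{k}" S] False by auto
    have determined: "dist (X k \<omega>) b \<le> c * u k" if "dist (X k \<omega> + (\<Sum>j\<in>S. X j \<omega>)) b \<le> \<eta>" for \<omega> b
    proof -
      have "norm (\<Sum>j\<in>S. X j \<omega>) \<le> c * u k / 2"
        using insert.hyps prems False
        by (intro lacunary_on_norm_sum_le[OF prems(2) False _ _ _ B card_S R]) auto
      then have "dist (X k \<omega>) (X k \<omega> + (\<Sum>j\<in>S. X j \<omega>)) \<le> c * u k / 2"
        by (simp add: dist_norm)
      then show ?thesis
        using dist_triangle[of "X k \<omega>" b "X k \<omega> + (\<Sum>j\<in>S. X j \<omega>)"] that prems(4)[of k] by auto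
    qed
    have "concentration M (\<lambda>\<omega>. X k \<omega> + (\<Sum>j\<in>S. X j \<omega>)) \<eta> \<le>
        concentration M (X k) (c * u k) * concentration M (\<lambda>\<omega>. \<Sum>j\<in>S. X j \<omega>) \<eta>"
      by (rule concentration_indep_add_le_mult[OF indep determined])
    also have "\<dots> \<le> q * q ^ card S"
      using prems(6)[of k] IH concentration_nonneg order_trans
      by (intro mult_mono concentration_nonneg) blast+
    finally show ?thesis
      using insert.hyps False by simp
  qed
qed

text \<open>Truncate the lacunary terms and discard all others.\<close>

lemma concentration_sum_le_lacunary:
  fixes X :: "'i \<Rightarrow> 'a \<Rightarrow> 'b :: {second_countable_topology, real_normed_vector}"
  assumes D: "finite D" and K: "K \<subseteq> D" and indep: "indep_vars (\<lambda>_. borel) X D"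
    and lac: "lacunary_on K B u" and u: "\<And>k. k \<in> K \<Longrightarrow> 0 < u k" and \<eta>: "\<And>k. k \<in> K \<Longrightarrow> 2 * \<eta> \<le> c * u k"
    and tail: "\<And>k. k \<in> K \<Longrightarrow> prob {\<omega>\<in>space M. R * u k < norm (X k \<omega>)} \<le> \<tau>"
    and conc: "\<And>k. k \<in> K \<Longrightarrow> concentration M (X k) (c * u k) + \<tau> \<le> q"
    and B: "1 < B" "2 * R * real (card K) \<le> c * B" and R: "0 \<le> R"
  shows "concentration M (\<lambda>\<omega>. \<Sum>k\<in>D. X k \<omega>) \<eta> \<le> q ^ card K + real (card K) * \<tau>"
proof -
  have finK: "finite K"
    using D K finite_subset by blast
  have [measurable]: "random_variable borel (X k)" if "k \<in> K" for k
    using indep K that unfolding indep_vars_def by blast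
  define E where "E k = {\<omega>\<in>space M. R * u k < norm (X k \<omega>)}" for k
  define Y where "Y k \<omega> = (if norm (X k \<omega>) \<le> R * u k then X k \<omega> else 0)" for k \<omega>
  have E: "E k \<in> events" "prob (E k) \<le> \<tau>" if "k \<in> K" for k
    unfolding E_def using that tail by auto
  have Y_eq: "Y k \<omega> = X k \<omega>" if "\<omega> \<in> space M" "\<omega> \<notin> E k" for k \<omega>
    using that by (auto simp: E_def Y_def)
  have meas_Y: "random_variable borel (Y k)" if "k \<in> K" for k
    using that unfolding Y_def by measurable
  have indep_Y: "indep_vars (\<lambda>_. borel) Y K"
    unfolding Y_def by (rule indep_vars_compose2[OF indep_vars_subset[OF indep K]]) measurable
  have conc_Y: "concentration M (Y k) (c * u k) \<le> q" if "k \<in> K" for k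
    using concentration_le_perturb[of "X k" "E k" "Y k" "c * u k"] Y_eq E conc that by fastforce
  have "concentration M (\<lambda>\<omega>. \<Sum>k\<in>D. X k \<omega>) \<eta> \<le> concentration M (\<lambda>\<omega>. \<Sum>k\<in>K. X k \<omega>) \<eta>"
    using concentration_indep_add_le[OF indep_vars_imp_indep_var_sum[OF indep, of "D - K" K], of \<eta>] K
    by (simp add: sum.subset_diff[OF K D] Diff_disjoint Int_commute)
  also have "\<dots> \<le> concentration M (\<lambda>\<omega>. \<Sum>k\<in>K. Y k \<omega>) \<eta> + prob (\<Union>k\<in>K. E k)"
    using finK E meas_Y Y_eq
    by (intro concentration_le_perturb borel_measurable_sum) (auto intro!: sum.cong)
  also have "concentration M (\<lambda>\<omega>. \<Sum>k\<in>K. Y k \<omega>) \<eta> \<le> q ^ card K"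
    using u R
    by (intro concentration_lacunary_sum[OF finK indep_Y lac u \<eta> _ conc_Y B R])
      (auto simp: Y_def intro: mult_nonneg_nonneg less_imp_le)
  also have "prob (\<Union>k\<in>K. E k) \<le> (\<Sum>k\<in>K. prob (E k))"
    using finK E by (intro measure_UNION_le) auto
  also have "\<dots> \<le> (\<Sum>k\<in>K. \<tau>)"
    using E by (intro sum_mono) auto
  finally show ?thesis
    by simp
qed

end

lemma exists_in_interval_far_from_finite:
  fixes y :: "'i \<Rightarrow> real"
  assumes "finite I" and \<rho>: "0 < \<rho>"
  obtains x where "s \<le> x" "x \<le> s + 2 * \<rho> * real (card I)" "\<And>i. i \<in> I \<Longrightarrow> \<rho> \<le> \<bar>x - y i\<bar>"
proof -
  define x where "x l = s + 2 * \<rho> * real l" for l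
  have "\<exists>l\<le>card I. \<forall>i\<in>I. \<rho> \<le> \<bar>x l - y i\<bar>"
  proof (rule ccontr)
    assume "\<not> ?thesis"
    then obtain f where f: "\<And>l. l \<le> card I \<Longrightarrow> f l \<in> I \<and> \<bar>x l - y (f l)\<bar> < \<rho>"
      by (metis not_le)
    have "inj_on f {..card I}"
    proof (rule linorder_inj_onI)
      fix l l' :: nat
      assume l: "l < l'" "l \<in> {..card I}" "l' \<in> {..card I}"
      have "2 * \<rho> * 1 \<le> 2 * \<rho> * (real l' - real l)"
        using l \<rho> by (intro mult_left_mono) auto
      then have "2 * \<rho> \<le> x l' - x l"
        by (simp add: x_def algebra_simps)
      then show "f l \<noteq> f l'"
        using f[of l] f[of l'] l by auto
    qed (rule linear)
    then have "card {..card I} \<le> card I"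
      using f \<open>finite I\<close> by (intro card_inj_on_le[of f]) auto
    then show False
      by simp
  qed
  then obtain l where "l \<le> card I" "\<forall>i\<in>I. \<rho> \<le> \<bar>x l - y i\<bar>"
    by blast
  then show ?thesis
    using \<rho> by (intro that[of "x l"]) (auto simp: x_def)
qed

lemma exists_lacunary_exp_shift:
  fixes K :: "nat set" and u :: "nat \<Rightarrow> real"
  assumes fin: "finite K" and g: "0 < g" and B: "1 < B" and u: "\<And>k. k \<in> K \<Longrightarrow> 0 < u k"
    and sep: "\<And>i j. i \<in> K \<Longrightarrow> j \<in> K \<Longrightarrow> i \<noteq> j \<Longrightarrow> g \<le> \<bar>real i - real j\<bar>"
  obtains s' where "s \<le> s'" "s' \<le> s + 2 * (ln B / g) * real ((card K)\<^sup>2)"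
    "lacunary_on K B (\<lambda>k. u k * exp (s' * real k))"
proof -
  define y where "y = (\<lambda>(i, j). (ln (u j) - ln (u i)) / (real i - real j))"
  have "0 < ln B / g"
    using B g by simp
  then obtain s' where s': "s \<le> s'" "s' \<le> s + 2 * (ln B / g) * real (card (K \<times> K))"
    and far: "\<And>ij. ij \<in> K \<times> K \<Longrightarrow> ln B / g \<le> \<bar>s' - y ij\<bar>"
    using exists_in_interval_far_from_finite[of "K \<times> K" "ln B / g" s y] fin by blast
  have "B * (u i * exp (s' * real i)) \<le> u j * exp (s' * real j) \<or>
      B * (u j * exp (s' * real j)) \<le> u i * exp (s' * real i)"
    if ij: "i \<in> K" "j \<in> K" "i \<noteq> j" for i j
  proof -
    have "ln B = g * (ln B / g)"
      using g by simp
    also have "\<dots> \<le> \<bar>real i - real j\<bar> * \<bar>s' - y (i, j)\<bar>"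
      using sep[OF ij] far[of "(i, j)"] ij B g by (intro mult_mono) auto
    also have "\<dots> = \<bar>(ln (u i) + s' * real i) - (ln (u j) + s' * real j)\<bar>"
    proof -
      have "(real i - real j) * y (i, j) = ln (u j) - ln (u i)"
        using \<open>i \<noteq> j\<close> by (simp add: y_def)
      then show ?thesis
        unfolding abs_mult[symmetric] by (simp add: algebra_simps)
    qed
    finally have "ln B + (ln (u i) + s' * real i) \<le> ln (u j) + s' * real j \<or>
        ln B + (ln (u j) + s' * real j) \<le> ln (u i) + s' * real i"
      by linarith
    moreover have "u k * exp (s' * real k) = exp (ln (u k) + s' * real k)" if "k \<in> K" for k
      using u[OF that] by (simp add: exp_add)
    moreover have "B * exp v = exp (ln B + v)" for v
      using B by (simp add: exp_add)
    ultimately show ?thesis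
      using ij by simp
  qed
  then have "lacunary_on K B (\<lambda>k. u k * exp (s' * real k))"
    unfolding lacunary_on_def by blast
  with s' show ?thesis
    by (intro that) (simp_all add: card_cartesian_product power2_eq_square)
qed

lemma arithmetic_progression_separated:
  fixes a g :: nat
  assumes "i \<in> (\<lambda>j. a + j * g) ` J" "j \<in> (\<lambda>j. a + j * g) ` J" "i \<noteq> j"
  shows "real g \<le> \<bar>real i - real j\<bar>"
proof -
  obtain i' j' where i'j': "i = a + i' * g" "j = a + j' * g"
    using assms by auto
  then have "1 \<le> \<bar>real i' - real j'\<bar>"
    using assms by (cases i' j' rule: linorder_cases) auto
  then have "1 * real g \<le> \<bar>(real i' - real j') * real g\<bar>"
    unfolding abs_mult by (intro mult_mono) auto
  then show ?thesis
    by (simp add: i'j' left_diff_distrib)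
qed

lemma exists_separated_indices:
  assumes t0: "0 \<le> t0" and l: "0 < l" and N: "0 < N" and large: "2 * real N \<le> \<kappa> * l"
  obtains K :: "nat set" where "card K = N" "finite K"
    "\<And>k. k \<in> K \<Longrightarrow> t0 \<le> real k / l \<and> real k / l \<le> t0 + \<kappa>"
    "\<And>i j. i \<in> K \<Longrightarrow> j \<in> K \<Longrightarrow> i \<noteq> j \<Longrightarrow> \<kappa> * l / (2 * real N) \<le> \<bar>real i - real j\<bar>"
proof -
  define x where "x = \<kappa> * l / real N"
  define a where "a = nat \<lceil>t0 * l\<rceil>"
  define g where "g = nat \<lfloor>x\<rfloor>"
  have x: "2 \<le> x"
    using large N by (simp add: x_def field_simps)
  have "real a = of_int \<lceil>t0 * l\<rceil>" "real g = of_int \<lfloor>x\<rfloor>"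
    using t0 l x by (simp_all add: a_def g_def)
  then have a: "t0 * l \<le> real a" "real a < t0 * l + 1" and g: "real g \<le> x" "1 \<le> real g" "x / 2 \<le> real g"
    using x by linarith+
  define K where "K = (\<lambda>j. a + j * g) ` {..<N}"
  have "inj_on (\<lambda>j. a + j * g) {..<N}"
    using g(2) by (intro inj_onI) auto
  then have "card K = N" "finite K"
    by (simp_all add: K_def card_image)
  moreover have "t0 \<le> real k / l \<and> real k / l \<le> t0 + \<kappa>" if k: "k \<in> K" for k
  proof -
    obtain j where j: "j < N" "k = a + j * g"
      using k by (auto simp: K_def)
    have "(real j + 1) * real g \<le> real N * x"
      using j g x by (intro mult_mono) auto
    also have "\<dots> = \<kappa> * l"
      using N by (simp add: x_def)
    finally have "real k \<le> (t0 + \<kappa>) * l"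
      using a(2) g(2) j by (simp add: distrib_right)
    moreover have "t0 * l \<le> real k"
      using a(1) j by (simp add: add_increasing2)
    ultimately show ?thesis
      using l by (simp add: pos_le_divide_eq pos_divide_le_eq)
  qed
  moreover have "\<kappa> * l / (2 * real N) \<le> \<bar>real i - real j\<bar>" if "i \<in> K" "j \<in> K" "i \<noteq> j" for i j
    using arithmetic_progression_separated[of i a g "{..<N}" j] that g(3) by (simp add: K_def x_def)
  ultimately show ?thesis
    by (rule that)
qed

subsection \<open>The uniform distribution on the unit circle\<close>

definition circle_measure :: "complex measure" where
  "circle_measure = distr (restrict_space lborel {0..<1}) borel (\<lambda>x. cis (2 * pi * x))"

lemma emeasure_lborel_vimage_plus:
  fixes c :: "'a :: euclidean_space"
  assumes [measurable]: "S \<in> sets borel"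
  shows "emeasure lborel ((+) c -` S) = emeasure lborel S"
proof -
  have "emeasure lborel S = emeasure (distr lborel borel ((+) c)) S"
    by (simp add: lborel_distr_plus)
  also have "\<dots> = emeasure lborel ((+) c -` S)"
    by (subst emeasure_distr) auto
  finally show ?thesis
    by simp
qed

lemma emeasure_periodic_period:
  fixes G :: "real set"
  assumes G[measurable]: "G \<in> sets borel" and periodic: "\<And>x k. of_int k + x \<in> G \<longleftrightarrow> x \<in> G"
  shows "emeasure lborel (G \<inter> {b..<b + 1}) = emeasure lborel (G \<inter> {0..<1})"
proof -
  have shift: "emeasure lborel (G \<inter> {x + of_int k..<y + of_int k}) = emeasure lborel (G \<inter> {x..<y})"
    for x y k
  proof -
    have "G \<inter> {x..<y} = (+) (of_int k) -` (G \<inter> {x + of_int k..<y + of_int k})"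
      using periodic by auto
    then show ?thesis
      by (simp only:) (rule emeasure_lborel_vimage_plus[symmetric], measurable)
  qed
  define n where "n = \<lceil>b\<rceil>"
  have n: "b \<le> of_int n" "of_int n \<le> b + 1"
    unfolding n_def by linarith+
  have "emeasure lborel (G \<inter> {b..<b + 1}) =
      emeasure lborel (G \<inter> {b..<of_int n}) + emeasure lborel (G \<inter> {of_int n..<b + 1})"
    using n by (subst plus_emeasure) (auto intro!: arg_cong[where f = "emeasure lborel"])
  also have "emeasure lborel (G \<inter> {b..<of_int n}) = emeasure lborel (G \<inter> {b + 1..<of_int n + 1})"
    using shift[of b 1 "of_int n"] by simp
  also have "\<dots> + emeasure lborel (G \<inter> {of_int n..<b + 1}) = emeasure lborel (G \<inter> {of_int n..<of_int n + 1})"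
    using n by (subst plus_emeasure) (auto intro!: arg_cong[where f = "emeasure lborel"])
  also have "\<dots> = emeasure lborel (G \<inter> {0..<1})"
    using shift[of 0 n 1] by (simp add: add.commute)
  finally show ?thesis .
qed

lemma cis_measurable [measurable]: "cis \<in> borel_measurable borel"
  by (intro borel_measurable_continuous_onI continuous_intros)

lemma angle_measurable [measurable]:
  "(\<lambda>x. cis (2 * pi * x)) \<in> borel_measurable (restrict_space lborel {0..<1::real})"
  by (intro measurable_restrict_space1) simp

lemma rotate_measurable [measurable]: "(\<lambda>z. cis \<theta> * z) \<in> borel_measurable borel"
  by (intro borel_measurable_continuous_onI continuous_intros)

lemma sets_circle_measure [simp, measurable_cong]: "sets circle_measure = sets borel"
  by (simp add: circle_measure_def)

lemma space_circle_measure [simp]: "space circle_measure = UNIV"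
  by (simp add: circle_measure_def)

lemma prob_space_circle_measure: "prob_space circle_measure"
  unfolding circle_measure_def
  by (intro prob_space.prob_space_distr prob_spaceI)
    (auto simp: space_restrict_space emeasure_restrict_space)

lemma AE_circle_measure_cmod: "AE u in circle_measure. cmod u = 1"
  unfolding circle_measure_def by (subst AE_distr_iff) auto

lemma emeasure_circle_measure:
  assumes "A \<in> sets borel"
  shows "emeasure circle_measure A = emeasure lborel ({x. cis (2 * pi * x) \<in> A} \<inter> {0..<1})"
proof -
  have "(\<lambda>x. cis (2 * pi * x)) -` A \<inter> space (restrict_space lborel {0..<1}) =
      {x. cis (2 * pi * x) \<in> A} \<inter> {0..<1}"
    by (auto simp: space_restrict_space)
  then show ?thesis
    unfolding circle_measure_def using assms by (simp add: emeasure_distr emeasure_restrict_space)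
qed

lemma distr_circle_measure_rotate: "distr circle_measure borel (\<lambda>z. cis \<theta> * z) = circle_measure"
proof (rule measure_eqI)
  fix A
  assume "A \<in> sets (distr circle_measure borel (\<lambda>z. cis \<theta> * z))"
  then have A[measurable]: "A \<in> sets borel"
    by simp
  define b where "b = \<theta> / (2 * pi)"
  define G where "G = {x. cis (2 * pi * x) \<in> A}"
  have G[measurable]: "G \<in> sets borel"
    unfolding G_def by measurable
  have "cis (2 * pi * (of_int k + x)) = cis (2 * pi * x)" for k x
    using cis_multiple_2pi[of "of_int k"] by (simp add: distrib_left flip: cis_mult)
  then have periodic: "of_int k + x \<in> G \<longleftrightarrow> x \<in> G" for k x
    by (simp add: G_def)
  have "emeasure (distr circle_measure borel (\<lambda>z. cis \<theta> * z)) A =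
      emeasure circle_measure ((\<lambda>z. cis \<theta> * z) -` A)"
    by (subst emeasure_distr) auto
  also have "\<dots> = emeasure lborel ({x. cis (2 * pi * x) \<in> (\<lambda>z. cis \<theta> * z) -` A} \<inter> {0..<1})"
    using measurable_sets[OF rotate_measurable A] by (intro emeasure_circle_measure) simp
  also have "{x. cis (2 * pi * x) \<in> (\<lambda>z. cis \<theta> * z) -` A} \<inter> {0..<1} = (+) b -` (G \<inter> {b..<b + 1})"
    by (auto simp: G_def b_def cis_mult distrib_left)
  also have "emeasure lborel \<dots> = emeasure lborel (G \<inter> {b..<b + 1})"
    by (intro emeasure_lborel_vimage_plus) measurable
  also have "\<dots> = emeasure circle_measure A"
    using emeasure_periodic_period[OF G periodic] by (simp add: emeasure_circle_measure G_def)
  finally show "emeasure (distr circle_measure borel (\<lambda>z. cis \<theta> * z)) A = emeasure circle_measure A" .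
qed simp

subsection \<open>The rotation invariant measure of a convex function\<close>

definition left_slope :: "(real \<Rightarrow> real) \<Rightarrow> real \<Rightarrow> real" where
  "left_slope f s = (SUP h\<in>{0<..}. (f s - f (s - h)) / h)"

locale lipschitz_convex =
  fixes f :: "real \<Rightarrow> real" and T :: real
  assumes convex: "convex_on UNIV f"
    and mono: "x \<le> y \<Longrightarrow> f x \<le> f y"
    and lipschitz: "x \<le> y \<Longrightarrow> f y - f x \<le> T * (y - x)"
begin

lemma slope_le: "h > 0 \<Longrightarrow> (f s - f (s - h)) / h \<le> T"
  using lipschitz[of "s - h" s] by (simp add: pos_divide_le_eq)

lemma bdd_above_slopes: "bdd_above ((\<lambda>h. (f s - f (s - h)) / h) ` {0<..})"
  using slope_le by (intro bdd_aboveI2) auto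

lemma slope_le_left_slope: "h > 0 \<Longrightarrow> (f s - f (s - h)) / h \<le> left_slope f s"
  unfolding left_slope_def by (rule cSUP_upper[OF _ bdd_above_slopes]) simp

lemma less_left_slope_iff: "t < left_slope f s \<longleftrightarrow> (\<exists>h>0. t < (f s - f (s - h)) / h)"
  unfolding left_slope_def by (subst less_cSUP_iff[OF _ bdd_above_slopes]) auto

lemma left_slope_nonneg: "0 \<le> left_slope f s"
  using slope_le_left_slope[of 1 s] mono[of "s - 1" s] by simp

lemma left_slope_le: "left_slope f s \<le> T"
  using less_left_slope_iff[of T s] slope_le by (meson leD leI)

lemma slope_mono:
  assumes "x < y" "y < z"
  shows "(f y - f x) / (y - x) \<le> (f z - f x) / (z - x)"
    and "(f z - f x) / (z - x) \<le> (f z - f y) / (z - y)"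
proof -
  have "(f x - f y) / (x - y) \<le> (f x - f z) / (x - z)" "(f x - f z) / (x - z) \<le> (f y - f z) / (y - z)"
    using convex_on_slope_le[OF convex, of x z y] assms by auto
  then show "(f y - f x) / (y - x) \<le> (f z - f x) / (z - x)"
    "(f z - f x) / (z - x) \<le> (f z - f y) / (z - y)"
    by (metis minus_diff_eq minus_divide_divide)+
qed

lemma diff_bounds_left_slope:
  assumes "x < y"
  shows "left_slope f x * (y - x) \<le> f y - f x" "f y - f x \<le> left_slope f y * (y - x)"
proof -
  have "(f x - f (x - h)) / h \<le> (f y - f x) / (y - x)" if "0 < h" for h
    using order_trans[OF slope_mono(1)[of "x - h" x y] slope_mono(2)[of "x - h" x y]] that assms by simp
  then have "left_slope f x \<le> (f y - f x) / (y - x)"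
    using less_left_slope_iff[of "(f y - f x) / (y - x)" x] by (meson not_le)
  then show "left_slope f x * (y - x) \<le> f y - f x"
    using assms by (simp add: pos_le_divide_eq)
  show "f y - f x \<le> left_slope f y * (y - x)"
    using slope_le_left_slope[of "y - x" y] assms by (simp add: pos_divide_le_eq)
qed

lemma left_slope_mono:
  assumes "x \<le> y"
  shows "left_slope f x \<le> left_slope f y"
proof (cases "x = y")
  case False
  then have "0 < y - x"
    using assms by simp
  moreover from this have "left_slope f x * (y - x) \<le> left_slope f y * (y - x)"
    using diff_bounds_left_slope[of x y] by linarith
  ultimately show ?thesis
    by simp
qed simp

lemma left_slope_tendsto: "((\<lambda>h. (f (s + h) - f s) / h) \<longlongrightarrow> left_slope f s) (at_left 0)"
proof (rule tendstoI)
  fix e :: real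
  assume "0 < e"
  then obtain h where h: "0 < h" "left_slope f s - e < (f s - f (s - h)) / h"
    using less_left_slope_iff[of "left_slope f s - e" s] by auto
  have "\<forall>\<^sub>F k in at_left 0. k \<in> {-h<..<0}"
    using h eventually_at_left_real[of "-h" 0] by simp
  then show "\<forall>\<^sub>F k in at_left 0. dist ((f (s + k) - f s) / k) (left_slope f s) < e"
  proof eventually_elim
    case (elim k)
    have slope_eq: "(f (s + k) - f s) / k = (f s - f (s + k)) / - k"
      by (metis minus_diff_eq minus_divide_divide)
    have "(f s - f (s - h)) / h \<le> (f s - f (s + k)) / - k"
      using slope_mono(2)[of "s - h" "s + k" s] elim by simp
    moreover have "(f s - f (s + k)) / - k \<le> left_slope f s"
      using slope_le_left_slope[of "- k" s] elim by simp
    ultimately show ?case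
      unfolding slope_eq using h by (simp add: dist_real_def)
  qed
qed

lemma left_slope_left_continuous:
  assumes "t < left_slope f s"
  obtains s' where "s' < s" "t < left_slope f s'"
proof -
  obtain h where h: "0 < h" "t < (f s - f (s - h)) / h"
    using assms less_left_slope_iff by auto
  have "isCont f s"
    using convex_on_continuous[OF open_UNIV convex] by (simp add: continuous_on_eq_continuous_at)
  then have "((\<lambda>x. (f x - f (s - h)) / (x - (s - h))) \<longlongrightarrow> (f s - f (s - h)) / (s - (s - h))) (at_left s)"
    using h by (intro tendsto_intros tendsto_within_subset[OF isContD]) auto
  then have "\<forall>\<^sub>F x in at_left s. t < (f x - f (s - h)) / (x - (s - h))"
    by (rule order_tendstoD) (use h in simp)
  moreover have "\<forall>\<^sub>F x in at_left s. x \<in> {s - h<..<s}"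
    using h by (intro eventually_at_left_real) simp
  ultimately have "\<forall>\<^sub>F x in at_left s. x < s \<and> t < left_slope f x"
  proof eventually_elim
    case (elim x)
    then show ?case
      using slope_le_left_slope[of "x - (s - h)" x] by auto
  qed
  then show ?thesis
    using that eventually_happens[of _ "at_left s"] by auto
qed

definition total_slope :: real where
  "total_slope = (SUP s. left_slope f s)"

text \<open>The quantile function of the mass distribution with mass left_slope f (ln r) in the disc of radius r.\<close>

definition radius :: "real \<Rightarrow> real" where
  "radius t = Inf {r. 0 < r \<and> t < left_slope f (ln r)}"

definition radial_measure :: "complex measure" where
  "radial_measure = distr (restrict_space lborel {0..<total_slope} \<Otimes>\<^sub>M circle_measure) borel
     (\<lambda>(t, u). of_real (radius t) * u)"

lemma less_total_slope_iff: "t < total_slope \<longleftrightarrow> (\<exists>r>0. t < left_slope f (ln r))"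
proof -
  have "t < total_slope \<longleftrightarrow> (\<exists>s. t < left_slope f s)"
    unfolding total_slope_def using left_slope_le
    by (subst less_cSUP_iff) (auto intro: bdd_aboveI2[where M = T])
  also have "\<dots> \<longleftrightarrow> (\<exists>r>0. t < left_slope f (ln r))"
    by (metis exp_gt_zero ln_exp)
  finally show ?thesis .
qed

lemma left_slope_le_total_slope: "0 < r \<Longrightarrow> left_slope f (ln r) \<le> total_slope"
  using less_total_slope_iff by (metis leI less_irrefl)

lemma radius_less_iff:
  assumes t: "t < total_slope" and r: "0 < r"
  shows "radius t < r \<longleftrightarrow> t < left_slope f (ln r)"
proof
  assume "radius t < r"
  moreover have "{r. 0 < r \<and> t < left_slope f (ln r)} \<noteq> {}"
    using t less_total_slope_iff by auto
  ultimately have "\<exists>r'\<in>{r. 0 < r \<and> t < left_slope f (ln r)}. r' < r"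
    unfolding radius_def by (intro cInf_lessD)
  then obtain r' where r': "0 < r'" "t < left_slope f (ln r')" "r' < r"
    by blast
  then have "left_slope f (ln r') \<le> left_slope f (ln r)"
    by (intro left_slope_mono) auto
  then show "t < left_slope f (ln r)"
    using r' by simp
next
  assume "t < left_slope f (ln r)"
  then obtain s where s: "s < ln r" "t < left_slope f s"
    by (rule left_slope_left_continuous)
  have "radius t \<le> exp s"
    unfolding radius_def using s by (intro cInf_lower bdd_belowI[of _ 0]) auto
  also have "exp s < r"
    using s r by (metis exp_less_cancel_iff exp_ln)
  finally show "radius t < r" .
qed

lemma radius_nonneg: "t < total_slope \<Longrightarrow> 0 \<le> radius t"
  unfolding radius_def using less_total_slope_iff by (intro cInf_greatest) auto

lemma radius_measurable [measurable]:
  "radius \<in> borel_measurable (restrict_space lborel {0..<total_slope})"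
proof -
  have "mono_on {0..<total_slope} radius"
  proof (rule mono_onI)
    fix t t'
    assume "t \<in> {0..<total_slope}" "t' \<in> {0..<total_slope}" "t \<le> t'"
    then show "radius t \<le> radius t'"
      unfolding radius_def using less_total_slope_iff
      by (intro cInf_superset_mono bdd_belowI[of _ 0]) auto
  qed
  then have "radius \<in> borel_measurable (restrict_space borel {0..<total_slope})"
    by (rule borel_measurable_mono_on_fnc)
  then show ?thesis
    by (simp cong: measurable_cong_sets sets_restrict_space_cong)
qed

lemma sets_radial_measure [simp, measurable_cong]: "sets radial_measure = sets borel"
  by (simp add: radial_measure_def)

lemma space_radial_measure [simp]: "space radial_measure = UNIV"
  by (simp add: radial_measure_def)

lemma polar_measurable [measurable]: "(\<lambda>(t, u). of_real (radius t) * u) \<in>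
    borel_measurable (restrict_space lborel {0..<total_slope} \<Otimes>\<^sub>M circle_measure)"
  unfolding case_prod_beta by measurable

lemma emeasure_radial_measure:
  assumes [measurable]: "A \<in> sets borel"
  shows "emeasure radial_measure A =
    (\<integral>\<^sup>+t. emeasure circle_measure {u. of_real (radius t) * u \<in> A} \<partial>restrict_space lborel {0..<total_slope})"
proof -
  interpret circle: prob_space circle_measure
    by (rule prob_space_circle_measure)
  let ?P = "restrict_space lborel {0..<total_slope} \<Otimes>\<^sub>M circle_measure"
  let ?polar = "\<lambda>(t, u). of_real (radius t) * u"
  have "emeasure radial_measure A = emeasure ?P (?polar -` A \<inter> space ?P)"
    unfolding radial_measure_def by (rule emeasure_distr) measurable
  also have "\<dots> = (\<integral>\<^sup>+t. emeasure circle_measure (Pair t -` (?polar -` A \<inter> space ?P))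
      \<partial>restrict_space lborel {0..<total_slope})"
    by (rule circle.emeasure_pair_measure_alt) measurable
  also have "\<dots> = (\<integral>\<^sup>+t. emeasure circle_measure {u. of_real (radius t) * u \<in> A}
      \<partial>restrict_space lborel {0..<total_slope})"
    by (intro nn_integral_cong arg_cong[where f = "emeasure circle_measure"])
      (auto simp: space_pair_measure)
  finally show ?thesis .
qed

lemma distr_radial_measure_rotate: "distr radial_measure borel (\<lambda>z. cis \<theta> * z) = radial_measure"
proof -
  interpret circle: prob_space circle_measure
    by (rule prob_space_circle_measure)
  let ?R = "restrict_space lborel {0..<total_slope}"
  have "distr radial_measure borel (\<lambda>z. cis \<theta> * z) =
      distr (?R \<Otimes>\<^sub>M circle_measure) borel ((\<lambda>(t, u). of_real (radius t) * u) \<circ> (\<lambda>(t, u). (t, cis \<theta> * u)))"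
    unfolding radial_measure_def by (subst distr_distr) (auto simp: comp_def case_prod_beta mult_ac)
  also have "\<dots> = distr (distr (?R \<Otimes>\<^sub>M circle_measure) (?R \<Otimes>\<^sub>M borel) (\<lambda>(t, u). (t, cis \<theta> * u)))
      borel (\<lambda>(t, u). of_real (radius t) * u)"
    by (rule distr_distr[symmetric]) (unfold case_prod_beta, measurable)
  also have "distr (?R \<Otimes>\<^sub>M circle_measure) (?R \<Otimes>\<^sub>M borel) (\<lambda>(t, u). (t, cis \<theta> * u)) = ?R \<Otimes>\<^sub>M circle_measure"
    using pair_measure_distr[of "\<lambda>t. t" ?R ?R "\<lambda>u. cis \<theta> * u" circle_measure borel]
      circle.sigma_finite_measure_axioms
    by (simp add: distr_circle_measure_rotate)
  finally show ?thesis
    by (simp add: radial_measure_def)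
qed

lemma emeasure_radial_measure_ball:
  assumes r: "0 < r"
  shows "emeasure radial_measure (ball 0 r) = ennreal (left_slope f (ln r))"
proof -
  interpret circle: prob_space circle_measure
    by (rule prob_space_circle_measure)
  let ?R = "restrict_space lborel {0..<total_slope}"
  have "emeasure radial_measure (ball 0 r) = (\<integral>\<^sup>+t. indicator {0..<left_slope f (ln r)} t \<partial>?R)"
    unfolding emeasure_radial_measure[OF borel_open[OF open_ball]]
  proof (rule nn_integral_cong)
    fix t
    assume "t \<in> space ?R"
    then have t: "0 \<le> t" "t < total_slope"
      by (auto simp: space_restrict_space)
    have "emeasure circle_measure {u. of_real (radius t) * u \<in> ball 0 r} =
        emeasure circle_measure (if radius t < r then UNIV else {})"
    proof (rule emeasure_eq_AE)
      show "AE u in circle_measure. u \<in> {u. of_real (radius t) * u \<in> ball 0 r} \<longleftrightarrow>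
          u \<in> (if radius t < r then UNIV else {})"
        using AE_circle_measure_cmod by eventually_elim (use radius_nonneg t in \<open>auto simp: norm_mult\<close>)
    qed auto
    then show "emeasure circle_measure {u. of_real (radius t) * u \<in> ball 0 r} =
        indicator {0..<left_slope f (ln r)} t"
      using t radius_less_iff[OF t(2) r] circle.emeasure_space_1 by (simp add: indicator_def)
  qed
  also have "\<dots> = emeasure ?R {0..<left_slope f (ln r)}"
    using left_slope_le_total_slope[OF r]
    by (intro nn_integral_indicator) (auto simp: sets_restrict_space_iff)
  also have "\<dots> = ennreal (left_slope f (ln r))"
    using left_slope_le_total_slope[OF r] left_slope_nonneg by (subst emeasure_restrict_space) auto
  finally show ?thesis .
qed

lemma measure_radial_measure_ball: "0 < r \<Longrightarrow> measure radial_measure (ball 0 r) = left_slope f (ln r)"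
  using emeasure_radial_measure_ball left_slope_nonneg by (simp add: measure_def)

lemma finite_measure_radial_measure: "finite_measure radial_measure"
proof (rule finite_measureI)
  interpret circle: prob_space circle_measure
    by (rule prob_space_circle_measure)
  have "emeasure radial_measure UNIV = emeasure lborel {0..<total_slope}"
    using circle.emeasure_space_1
    by (simp add: emeasure_radial_measure emeasure_restrict_space space_restrict_space)
  then show "emeasure radial_measure (space radial_measure) \<noteq> \<infinity>"
    using left_slope_le_total_slope[of 1] left_slope_nonneg[of "ln 1"] by simp
qed

lemma integrable_radial_measure:
  fixes \<phi> :: "complex \<Rightarrow> real"
  assumes "continuous_on UNIV \<phi>" "bounded (range \<phi>)"
  shows "integrable radial_measure \<phi>"
proof -
  interpret finite_measure radial_measure
    by (rule finite_measure_radial_measure)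
  obtain C where "\<And>w. norm (\<phi> w) \<le> C"
    using assms(2) by (auto simp: bounded_iff)
  then show ?thesis
    using borel_measurable_continuous_onI[OF assms(1)]
    by (intro integrable_const_bound[where B = C]) (auto cong: measurable_cong_sets)
qed

end

definition log_ramp :: "real \<Rightarrow> real \<Rightarrow> complex \<Rightarrow> real" where
  "log_ramp r R w = ln (max R (cmod w)) - ln (max r (cmod w))"

lemma continuous_on_log_ramp: "0 < r \<Longrightarrow> 0 < R \<Longrightarrow> continuous_on A (log_ramp r R)"
  unfolding log_ramp_def by (intro continuous_intros) (auto simp: max_def)

lemma log_ramp_bounds:
  assumes "0 < r" "r \<le> R"
  shows "(ln R - ln r) * indicator (ball 0 r) w \<le> log_ramp r R w"
    and "log_ramp r R w \<le> (ln R - ln r) * indicator (ball 0 R) w"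
    and "0 \<le> log_ramp r R w"
    and "log_ramp r R w \<le> ln R - ln r"
proof -
  consider "cmod w < r" | "r \<le> cmod w" "cmod w < R" | "R \<le> cmod w"
    by linarith
  then have "(ln R - ln r) * indicator (ball 0 r) w \<le> log_ramp r R w \<and>
    log_ramp r R w \<le> (ln R - ln r) * indicator (ball 0 R) w \<and> 0 \<le> log_ramp r R w \<and>
    log_ramp r R w \<le> ln R - ln r"
  proof cases
    case 1
    then show ?thesis
      using assms by (simp add: log_ramp_def)
  next
    case 2
    moreover from this have "0 < cmod w"
      using assms by linarith
    ultimately have "ln r \<le> ln (cmod w)" "ln (cmod w) \<le> ln R"
      using assms by (auto intro: ln_mono)
    then show ?thesis
      using 2 assms by (simp add: log_ramp_def)
  next
    case 3
    then show ?thesis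
      using assms by (simp add: log_ramp_def)
  qed
  then show "(ln R - ln r) * indicator (ball 0 r) w \<le> log_ramp r R w"
    "log_ramp r R w \<le> (ln R - ln r) * indicator (ball 0 R) w"
    "0 \<le> log_ramp r R w" "log_ramp r R w \<le> ln R - ln r"
    by auto
qed

text \<open>On a grid of mesh h the error is at most h * (m b - m a), which is arbitrarily small.\<close>

lemma additive_interval_function_eq_0:
  fixes D :: "real \<Rightarrow> real \<Rightarrow> real"
  assumes add: "\<And>x y z. x \<le> y \<Longrightarrow> y \<le> z \<Longrightarrow> D x z = D x y + D y z"
    and small: "\<And>x y. x < y \<Longrightarrow> \<bar>D x y\<bar> \<le> (y - x) * (m y - m x)"
    and ab: "a < b"
  shows "D a b = 0"
proof -
  have grid: "\<bar>D a (a + real k * h)\<bar> \<le> h * (m (a + real k * h) - m a)" if h: "0 < h" for h k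
  proof (induction k)
    case 0
    show ?case
      using add[of a a a] by simp
  next
    case (Suc k)
    have "D a (a + real (Suc k) * h) = D a (a + real k * h) + D (a + real k * h) (a + real (Suc k) * h)"
      using h by (intro add) (auto simp: distrib_right)
    moreover have "\<bar>D (a + real k * h) (a + real (Suc k) * h)\<bar> \<le>
        h * (m (a + real (Suc k) * h) - m (a + real k * h))"
      using small[of "a + real k * h" "a + real (Suc k) * h"] h by (simp add: algebra_simps)
    ultimately show ?case
      using Suc.IH by (simp add: algebra_simps)
  qed
  have "\<bar>D a b\<bar> \<le> (b - a) * (m b - m a) * inverse (real (Suc n))" for n
  proof -
    have "a + real (Suc n) * ((b - a) / real (Suc n)) = b"
      by (simp del: of_nat_Suc)
    then show ?thesis
      using grid[of "(b - a) / real (Suc n)" "Suc n"] ab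
      by (simp add: divide_inverse mult_ac del: of_nat_Suc)
  qed
  then have "\<bar>D a b\<bar> \<le> (b - a) * (m b - m a) * 0"
    by (intro LIMSEQ_le_const[OF tendsto_mult[OF tendsto_const LIMSEQ_inverse_real_of_nat]]) auto
  then show ?thesis
    by simp
qed

context lipschitz_convex
begin

lemma integrable_log_ramp: "0 < r \<Longrightarrow> r \<le> R \<Longrightarrow> integrable radial_measure (log_ramp r R)"
  using log_ramp_bounds(3,4)[of r R]
  by (intro integrable_radial_measure continuous_on_log_ramp)
    (auto simp: bounded_iff intro!: exI[of _ "ln R - ln r"])

lemma integral_log_ramp_bounds:
  assumes "0 < r" "r \<le> R"
  shows "(ln R - ln r) * left_slope f (ln r) \<le> (\<integral>w. log_ramp r R w \<partial>radial_measure)"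
    and "(\<integral>w. log_ramp r R w \<partial>radial_measure) \<le> (ln R - ln r) * left_slope f (ln R)"
proof -
  interpret finite_measure radial_measure
    by (rule finite_measure_radial_measure)
  have ball: "(\<integral>w. c * indicator (ball 0 x) w \<partial>radial_measure) = c * left_slope f (ln x)"
    "integrable radial_measure (\<lambda>w. c * indicator (ball 0 x) w)" if "0 < x" for x c
    using that by (auto simp: measure_radial_measure_ball less_top[symmetric]
      intro!: integrable_mult_right integrable_real_indicator)
  show "(ln R - ln r) * left_slope f (ln r) \<le> (\<integral>w. log_ramp r R w \<partial>radial_measure)"
    using assms log_ramp_bounds[OF assms] unfolding ball(1)[symmetric, OF \<open>0 < r\<close>]
    by (intro integral_mono ball integrable_log_ramp) auto
  have "0 < R"
    using assms by linarith
  then show "(\<integral>w. log_ramp r R w \<partial>radial_measure) \<le> (ln R - ln r) * left_slope f (ln R)"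
    using assms log_ramp_bounds[OF assms] unfolding ball(1)[symmetric, OF \<open>0 < R\<close>]
    by (intro integral_mono ball integrable_log_ramp) auto
qed

lemma integral_log_ramp:
  assumes "0 < r" "r < R"
  shows "(\<integral>w. log_ramp r R w \<partial>radial_measure) = f (ln R) - f (ln r)"
proof -
  define D where "D x y = (\<integral>w. log_ramp (exp x) (exp y) w \<partial>radial_measure) - (f y - f x)" for x y
  have "D (ln r) (ln R) = 0"
  proof (rule additive_interval_function_eq_0[of D "left_slope f"])
    fix x y z :: real
    assume "x \<le> y" "y \<le> z"
    moreover have "log_ramp (exp x) (exp z) = (\<lambda>w. log_ramp (exp x) (exp y) w + log_ramp (exp y) (exp z) w)"
      by (simp add: log_ramp_def fun_eq_iff)
    ultimately show "D x z = D x y + D y z"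
      by (simp add: D_def integrable_log_ramp)
  next
    fix x y :: real
    assume "x < y"
    then show "\<bar>D x y\<bar> \<le> (y - x) * (left_slope f y - left_slope f x)"
      using integral_log_ramp_bounds[of "exp x" "exp y"] diff_bounds_left_slope[of x y]
      by (simp add: D_def abs_le_iff algebra_simps)
  qed (use assms in simp)
  then show ?thesis
    using assms by (simp add: D_def)
qed

end

subsection \<open>A uniformly dense class of test functions\<close>

definition ramp :: "real \<Rightarrow> real \<Rightarrow> real \<Rightarrow> real" where
  "ramp a b x = min x b - min x a"

lemma ramp_eq_0: "a \<le> b \<Longrightarrow> x \<le> a \<Longrightarrow> ramp a b x = 0"
  by (simp add: ramp_def)

lemma ramp_eq_diff: "a \<le> b \<Longrightarrow> b \<le> x \<Longrightarrow> ramp a b x = b - a"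
  by (simp add: ramp_def)

definition linear_spline :: "(real \<Rightarrow> real) \<Rightarrow> (nat \<Rightarrow> real) \<Rightarrow> nat \<Rightarrow> real \<Rightarrow> real" where
  "linear_spline u X n x =
    (\<Sum>i<n. (u (X (Suc i)) - u (X i)) / (X (Suc i) - X i) * ramp (X i) (X (Suc i)) x)"

lemma linear_spline_below:
  assumes "strict_mono X" "x \<le> X 0"
  shows "linear_spline u X n x = 0"
  unfolding linear_spline_def
proof (rule sum.neutral, rule ballI)
  fix i
  have "X 0 \<le> X i" "X i \<le> X (Suc i)"
    using strict_mono_leD[OF assms(1)] by auto
  then have "ramp (X i) (X (Suc i)) x = 0"
    using assms(2) by (intro ramp_eq_0) auto
  then show "(u (X (Suc i)) - u (X i)) / (X (Suc i) - X i) * ramp (X i) (X (Suc i)) x = 0"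
    by (simp only: mult_zero_right)
qed

lemma linear_spline_above:
  assumes X: "strict_mono X" and x: "X n \<le> x"
  shows "linear_spline u X n x = u (X n) - u (X 0)"
proof -
  have "linear_spline u X n x = (\<Sum>i<n. u (X (Suc i)) - u (X i))"
    unfolding linear_spline_def
  proof (rule sum.cong)
    fix i
    assume "i \<in> {..<n}"
    then have "X (Suc i) \<le> x" "X i < X (Suc i)"
      using strict_mono_leD[OF X, of "Suc i" n] strict_monoD[OF X, of i "Suc i"] x by auto
    then show "(u (X (Suc i)) - u (X i)) / (X (Suc i) - X i) * ramp (X i) (X (Suc i)) x =
        u (X (Suc i)) - u (X i)"
      by (simp add: ramp_eq_diff)
  qed simp
  also have "\<dots> = u (X n) - u (X 0)"
    by (rule sum_lessThan_telescope)
  finally show ?thesis .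
qed

lemma linear_spline_between:
  assumes X: "strict_mono X" and j: "j < n" and x: "X j \<le> x" "x \<le> X (Suc j)"
  shows "linear_spline u X n x =
    u (X j) - u (X 0) + (u (X (Suc j)) - u (X j)) * ((x - X j) / (X (Suc j) - X j))"
proof -
  have "linear_spline u X n x = linear_spline u X (Suc j) x"
    unfolding linear_spline_def
  proof (intro sum.mono_neutral_right ballI)
    fix i
    assume "i \<in> {..<n} - {..<Suc j}"
    then have "x \<le> X i" "X i \<le> X (Suc i)"
      using x strict_mono_leD[OF X, of "Suc j" i] strict_mono_leD[OF X, of i "Suc i"] by auto
    then have "ramp (X i) (X (Suc i)) x = 0"
      by (intro ramp_eq_0)
    then show "(u (X (Suc i)) - u (X i)) / (X (Suc i) - X i) * ramp (X i) (X (Suc i)) x = 0"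
      by (simp only: mult_zero_right)
  qed (use j in auto)
  also have "\<dots> = linear_spline u X j x + (u (X (Suc j)) - u (X j)) / (X (Suc j) - X j) * (x - X j)"
    using x by (simp add: linear_spline_def ramp_def)
  finally show ?thesis
    using linear_spline_above[OF X x(1)] by simp
qed

lemma abs_diff_convex_combination_le:
  fixes x y z l e :: real
  assumes "\<bar>x - y\<bar> \<le> e" "\<bar>x - z\<bar> \<le> e" "0 \<le> l" "l \<le> 1"
  shows "\<bar>x - (y + (z - y) * l)\<bar> \<le> e"
proof -
  have "x - (y + (z - y) * l) = (1 - l) * (x - y) + l * (x - z)"
    by (simp add: algebra_simps)
  also have "\<bar>\<dots>\<bar> \<le> (1 - l) * \<bar>x - y\<bar> + l * \<bar>x - z\<bar>"
    using assms by (intro order_trans[OF abs_triangle_ineq]) (simp add: abs_mult)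
  also have "\<dots> \<le> (1 - l) * e + l * e"
    using assms by (intro add_mono mult_left_mono) auto
  finally show ?thesis
    by (simp add: algebra_simps)
qed

lemma exists_mesh_cell:
  fixes X :: "nat \<Rightarrow> real"
  assumes "X 0 \<le> x" "x < X n"
  obtains j where "j < n" "X j \<le> x" "x < X (Suc j)"
proof -
  have "\<exists>j<n. X j \<le> x \<and> x < X (Suc j)"
    using assms
  proof (induction n)
    case (Suc n)
    then show ?case
      by (cases "x < X n") (auto intro: less_SucI simp: not_less)
  qed simp
  then show ?thesis
    using that by blast
qed

lemma linear_spline_approx:
  assumes X: "strict_mono X" and below: "\<And>x. x \<le> X 0 \<Longrightarrow> u x = 0" and above: "\<And>x. X n \<le> x \<Longrightarrow> u x = u (X n)"
    and osc: "\<And>j x y. j < n \<Longrightarrow> x \<in> {X j..X (Suc j)} \<Longrightarrow> y \<in> {X j..X (Suc j)} \<Longrightarrow> \<bar>u x - u y\<bar> \<le> e"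
    and e: "0 \<le> e"
  shows "\<bar>u x - linear_spline u X n x\<bar> \<le> e"
proof -
  consider "x \<le> X 0" | "X n \<le> x" | "X 0 \<le> x" "x < X n"
    by linarith
  then show ?thesis
  proof cases
    case 1
    then show ?thesis
      using below e by (simp add: linear_spline_below[OF X])
  next
    case 2
    then show ?thesis
      using below[of "X 0"] above[OF 2] e by (simp add: linear_spline_above[OF X])
  next
    case 3
    then obtain j where j: "j < n" "X j \<le> x" "x < X (Suc j)"
      by (rule exists_mesh_cell)
    have "\<bar>u x - (u (X j) + (u (X (Suc j)) - u (X j)) * ((x - X j) / (X (Suc j) - X j)))\<bar> \<le> e"
      using j by (intro abs_diff_convex_combination_le osc) (auto simp: divide_simps)
    then show ?thesis
      using linear_spline_between[OF X j(1), of x u] j below[of "X 0"] by simp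
  qed
qed

lemma uniform_mesh:
  fixes u :: "real \<Rightarrow> real"
  assumes ab: "a < b" and u: "continuous_on {a..b} u" and e: "0 < e"
  obtains n :: nat and h where "0 < h" "b = a + real n * h"
    "\<And>x y. x \<in> {a..b} \<Longrightarrow> y \<in> {a..b} \<Longrightarrow> \<bar>x - y\<bar> \<le> h \<Longrightarrow> \<bar>u x - u y\<bar> \<le> e"
proof -
  have "uniformly_continuous_on {a..b} u"
    using u compact_uniformly_continuous by blast
  then obtain d where d: "0 < d"
    "\<And>x y. x \<in> {a..b} \<Longrightarrow> y \<in> {a..b} \<Longrightarrow> dist y x < d \<Longrightarrow> dist (u y) (u x) < e"
    unfolding uniformly_continuous_on_def using e by metis
  obtain n where n: "(b - a) / d < real n"
    using reals_Archimedean2 by blast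
  then have n_pos: "0 < real n"
    using ab d by (metis divide_pos_pos diff_gt_0_iff_gt less_trans)
  define h where "h = (b - a) / real n"
  have "h < d"
    using n n_pos d by (simp add: h_def field_simps)
  then show ?thesis
    using d(2) ab n_pos
    by (intro that[of h n]) (force simp: h_def dist_real_def abs_minus_commute intro!: less_imp_le)+
qed

lemma uniform_approx_by_linear_spline:
  fixes u :: "real \<Rightarrow> real"
  assumes ab: "a < b" and u: "continuous_on {a..b} u"
    and below: "\<And>x. x \<le> a \<Longrightarrow> u x = 0" and above: "\<And>x. b \<le> x \<Longrightarrow> u x = u b" and e: "0 < e"
  obtains n X where "strict_mono X" "X 0 = a" "X n = b" "\<forall>x. \<bar>u x - linear_spline u X n x\<bar> \<le> e"
proof -
  obtain n h where h: "0 < h" "b = a + real n * h"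
    and osc: "\<And>x y. x \<in> {a..b} \<Longrightarrow> y \<in> {a..b} \<Longrightarrow> \<bar>x - y\<bar> \<le> h \<Longrightarrow> \<bar>u x - u y\<bar> \<le> e"
    by (rule uniform_mesh[OF ab u e]) blast
  define X where "X i = a + real i * h" for i
  have X_ends: "X 0 = a" "X n = b"
    by (simp_all add: X_def h(2))
  have X: "strict_mono X"
    using h(1) by (auto simp: X_def strict_mono_def)
  have "\<bar>u x - linear_spline u X n x\<bar> \<le> e" for x
  proof (rule linear_spline_approx[OF X])
    show "u x = 0" if "x \<le> X 0" for x
      using below that by (simp only: X_ends)
    show "u x = u (X n)" if "X n \<le> x" for x
      using above[of x] that by (simp only: X_ends)
    show "\<bar>u x - u y\<bar> \<le> e" if "j < n" "x \<in> {X j..X (Suc j)}" "y \<in> {X j..X (Suc j)}" for j x y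
    proof (rule osc)
      have "X 0 \<le> X j" "X (Suc j) \<le> X n"
        using strict_mono_leD[OF X] \<open>j < n\<close> by auto
      then show "x \<in> {a..b}" "y \<in> {a..b}"
        using that by (auto simp: X_ends)
      show "\<bar>x - y\<bar> \<le> h"
        using that by (auto simp: X_def distrib_right abs_le_iff)
    qed
  qed (use e in simp)
  then show ?thesis
    using that X X_ends by blast
qed

lemma ramp_minus_ln_max:
  assumes "0 < r" "a < b" "b \<le> - ln r"
  shows "ramp a b (- ln (max r (cmod w))) = log_ramp (exp (- b)) (exp (- a)) w"
proof -
  have "ln (max (exp (- t)) (cmod w)) = - min (- ln (max r (cmod w))) t" if "t \<le> - ln r" for t
  proof -
    have "r \<le> exp (- t)"
      using that assms(1) by (simp add: ln_ge_iff[symmetric] flip: ln_le_cancel_iff)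
    then have "max (exp (- t)) (cmod w) = max (exp (- t)) (max r (cmod w))"
      by simp
    moreover have "0 < max r (cmod w)"
      using assms(1) by (simp add: less_max_iff_disj)
    ultimately have "ln (max (exp (- t)) (cmod w)) = max (- t) (ln (max r (cmod w)))"
      by (simp only: ln_max exp_gt_zero ln_exp)
    then show ?thesis
      by (simp add: max_def min_def)
  qed
  then show ?thesis
    using assms by (simp add: ramp_def log_ramp_def)
qed

lemma disc_fold_power:
  assumes r: "0 < r" and m: "0 < m"
  shows "of_real (r ^ m) * disc_fold r w ^ m =
    cnj w ^ m * of_real (min (cmod w ^ (2 * m)) (r ^ (2 * m)) / cmod w ^ (2 * m))"
proof (cases "cmod w \<le> r")
  case True
  then have "of_real r * disc_fold r w = cnj w"
    using r by (simp add: disc_fold_def)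
  then have "of_real (r ^ m) * disc_fold r w ^ m = cnj w ^ m"
    by (metis of_real_power power_mult_distrib)
  moreover have "cmod w ^ (2 * m) \<le> r ^ (2 * m)"
    using True by (intro power_mono) auto
  ultimately show ?thesis
    using m by (cases "w = 0") auto
next
  case False
  then have w: "w \<noteq> 0"
    using r by auto
  then have "of_real r * disc_fold r w = cnj w * of_real (r\<^sup>2 / (cmod w)\<^sup>2)"
    using False complex_norm_square[of w] by (simp add: disc_fold_def power2_eq_square field_simps)
  then have "of_real (r ^ m) * disc_fold r w ^ m = cnj w ^ m * of_real ((r\<^sup>2 / (cmod w)\<^sup>2) ^ m)"
    by (metis of_real_power power_mult_distrib)
  moreover have "r ^ (2 * m) \<le> cmod w ^ (2 * m)"
    using False r by (intro power_mono) auto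
  ultimately show ?thesis
    by (simp add: power_divide flip: power_mult)
qed

lemma abs_Re_mult_power_div_max_le:
  assumes \<alpha>: "0 < \<alpha>"
  shows "\<bar>Re (c * w ^ m)\<bar> / max (\<alpha>\<^sup>2) (cmod w ^ (2 * m)) \<le> (cmod c + 1) / \<alpha>"
proof -
  define v where "v = cmod w ^ m"
  have v: "cmod w ^ (2 * m) = v\<^sup>2" "0 \<le> v"
    by (simp_all add: v_def mult.commute flip: power_mult)
  have max_pos: "0 < max (\<alpha>\<^sup>2) (v\<^sup>2)"
    using \<alpha> by (simp add: less_max_iff_disj)
  have "\<bar>Re (c * w ^ m)\<bar> \<le> cmod c * v"
    using abs_Re_le_cmod[of "c * w ^ m"] by (simp only: norm_mult norm_power v_def)
  also have "\<dots> \<le> (cmod c + 1) * v"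
    using v by (intro mult_right_mono) auto
  finally have "\<bar>Re (c * w ^ m)\<bar> * \<alpha> \<le> (cmod c + 1) * v * \<alpha>"
    using \<alpha> by (intro mult_right_mono) auto
  also have "\<dots> \<le> (cmod c + 1) * max (\<alpha>\<^sup>2) (v\<^sup>2)"
  proof -
    have "v * \<alpha> \<le> max (\<alpha>\<^sup>2) (v\<^sup>2)"
      using sum_squares_bound[of v \<alpha>] by (simp add: le_max_iff_disj) linarith
    then show ?thesis
      unfolding mult.assoc by (rule mult_left_mono) simp
  qed
  finally show ?thesis
    unfolding v(1) using \<alpha> max_pos by (simp add: field_simps)
qed

locale test_class =
  fixes V :: "(complex \<Rightarrow> real) \<Rightarrow> bool"
  assumes V_add: "V f \<Longrightarrow> V g \<Longrightarrow> V (\<lambda>w. f w + g w)"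
    and V_scale: "V f \<Longrightarrow> V (\<lambda>w. c * f w)"
    and V_closed: "continuous_on UNIV f \<Longrightarrow> (\<And>e. 0 < e \<Longrightarrow> \<exists>g. V g \<and> (\<forall>w. \<bar>f w - g w\<bar> \<le> e)) \<Longrightarrow> V f"
    and V_log_ramp: "0 < r \<Longrightarrow> r < R \<Longrightarrow> V (log_ramp r R)"
    and V_moment: "0 < r \<Longrightarrow> 0 < m \<Longrightarrow> V (\<lambda>w. Re (a * disc_fold r w ^ m))"
begin

lemma V_sum:
  assumes "finite I" "\<And>i. i \<in> I \<Longrightarrow> V (f i)"
  shows "V (\<lambda>w. \<Sum>i\<in>I. f i w)"
  using assms
proof (induction I rule: finite_induct)
  case empty
  show ?case
    using V_scale[OF V_log_ramp[of 1 2], of 0] by simp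
qed (auto intro: V_add)

lemma V_log_spline:
  assumes X: "strict_mono X" "X n \<le> - ln r" and r: "0 < r"
  shows "V (\<lambda>w. linear_spline u X n (- ln (max r (cmod w))))"
proof -
  have "X i < X (Suc i)" "X (Suc i) \<le> - ln r" if "i < n" for i
    using strict_monoD[OF X(1), of i "Suc i"] strict_mono_leD[OF X(1), of "Suc i" n] X(2) that by auto
  then have "linear_spline u X n (- ln (max r (cmod w))) =
      (\<Sum>i<n. (u (X (Suc i)) - u (X i)) / (X (Suc i) - X i) *
        log_ramp (exp (- X (Suc i))) (exp (- X i)) w)" for w
    using r by (simp add: linear_spline_def ramp_minus_ln_max)
  then show ?thesis
    using strict_monoD[OF X(1)] by (simp only:) (intro V_sum V_scale V_log_ramp; simp)
qed

lemma V_radial_truncated: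
  assumes G: "continuous_on {0..} G" and support: "\<And>x. R \<le> x \<Longrightarrow> G x = 0" and r: "0 < r" "r < R"
  shows "V (\<lambda>w. G (max r (cmod w)))"
proof (rule V_closed)
  show "continuous_on UNIV (\<lambda>w. G (max r (cmod w)))"
    by (intro continuous_on_compose2[OF G] continuous_intros) (auto simp: le_max_iff_disj)
  fix e :: real
  assume e: "0 < e"
  define u where "u x = G (max r (exp (- x)))" for x
  have cont: "continuous_on {- ln R..- ln r} u"
    unfolding u_def by (intro continuous_on_compose2[OF G] continuous_intros) (auto simp: le_max_iff_disj)
  have below: "u x = 0" if "x \<le> - ln R" for x
  proof -
    have "R \<le> exp (- x)"
      using that r by (simp add: ln_ge_iff[symmetric] flip: ln_le_cancel_iff)
    then show ?thesis
      using support by (simp add: u_def max_def)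
  qed
  have above: "u x = u (- ln r)" if "- ln r \<le> x" for x
  proof -
    have "exp (- x) \<le> r"
      using that r by (simp flip: ln_ge_iff)
    then show ?thesis
      using r by (simp add: u_def)
  qed
  have "- ln R < - ln r"
    using r by simp
  then obtain n X where X: "strict_mono X" "X 0 = - ln R" "X n = - ln r"
    and approx: "\<forall>x. \<bar>u x - linear_spline u X n x\<bar> \<le> e"
    by (rule uniform_approx_by_linear_spline[OF _ cont below above e]) blast
  have u_eq: "u (- ln (max r (cmod w))) = G (max r (cmod w))" for w
    using r by (simp add: u_def less_max_iff_disj)
  show "\<exists>g. V g \<and> (\<forall>w. \<bar>G (max r (cmod w)) - g w\<bar> \<le> e)"
  proof (intro exI conjI allI)
    show "V (\<lambda>w. linear_spline u X n (- ln (max r (cmod w))))"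
      using X r by (intro V_log_spline) auto
    show "\<bar>G (max r (cmod w)) - linear_spline u X n (- ln (max r (cmod w)))\<bar> \<le> e" for w
      using approx unfolding u_eq[symmetric] by blast
  qed
qed

lemma V_radial:
  assumes G: "continuous_on {0..} G" and support: "\<And>x. R \<le> x \<Longrightarrow> G x = 0" and R: "0 < R"
  shows "V (\<lambda>w. G (cmod w))"
proof (rule V_closed)
  show "continuous_on UNIV (\<lambda>w. G (cmod w))"
    by (intro continuous_on_compose2[OF G] continuous_intros) auto
  fix e :: real
  assume e: "0 < e"
  have "\<exists>d>0. \<forall>x\<in>{0..}. dist x 0 < d \<longrightarrow> dist (G x) (G 0) < e / 2"
    using G e unfolding continuous_on_iff by (metis atLeast_iff order_refl half_gt_zero)
  then obtain d where d: "0 < d" "\<And>x. 0 \<le> x \<Longrightarrow> x < d \<Longrightarrow> \<bar>G x - G 0\<bar> < e / 2"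
    by (auto simp: dist_real_def)
  define r where "r = min d R / 2"
  have r: "0 < r" "r < d" "r < R"
    using d R by (auto simp: r_def min_def)
  have "\<bar>G (cmod w) - G (max r (cmod w))\<bar> \<le> e" for w
  proof (cases "cmod w \<le> r")
    case True
    then have "\<bar>G (cmod w) - G 0\<bar> < e / 2" "\<bar>G r - G 0\<bar> < e / 2"
      using d(2) r by auto
    then have "\<bar>G (cmod w) - G r\<bar> \<le> e"
      by linarith
    with True show ?thesis
      by simp
  qed (use e in simp)
  then show "\<exists>g. V g \<and> (\<forall>w. \<bar>G (cmod w) - g w\<bar> \<le> e)"
    using V_radial_truncated[OF G support r(1,3)] by blast
qed

lemma V_moment_min:
  assumes m: "0 < m" and Y: "0 < Y"
  shows "V (\<lambda>w. Re (c * w ^ m) * (min (cmod w ^ (2 * m)) Y / cmod w ^ (2 * m)))"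
proof -
  define r where "r = root (2 * m) Y"
  have r: "0 < r" "r ^ (2 * m) = Y"
    using m Y by (auto simp: r_def)
  have "r ^ m * Re (cnj c * disc_fold r w ^ m) =
      Re (c * w ^ m) * (min (cmod w ^ (2 * m)) Y / cmod w ^ (2 * m))" for w
  proof -
    have "r ^ m * Re (cnj c * disc_fold r w ^ m) = Re (cnj c * (of_real (r ^ m) * disc_fold r w ^ m))"
      by (simp add: algebra_simps flip: of_real_power)
    also have "\<dots> = Re (cnj (c * w ^ m)) * (min (cmod w ^ (2 * m)) Y / cmod w ^ (2 * m))"
      unfolding disc_fold_power[OF r(1) m] r(2) complex_cnj_mult complex_cnj_power
        mult.assoc[symmetric]
      by simp
    finally show ?thesis
      by (simp only: cnj.sel)
  qed
  then show ?thesis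
    using V_scale[OF V_moment[OF r(1) m, where a = "cnj c"], where c = "r ^ m"] by simp
qed

lemma V_moment_ramp:
  assumes "0 < m" "0 < a" "a < b"
  shows "V (\<lambda>w. Re (c * w ^ m) * (ramp a b (cmod w ^ (2 * m)) / max a (cmod w ^ (2 * m))))"
proof -
  have "ramp a b y / max a y = min y b / y - min y a / y" if "0 \<le> y" for y
    using that assms by (cases "y \<le> a") (auto simp: ramp_def diff_divide_distrib)
  then have "Re (c * w ^ m) * (ramp a b (cmod w ^ (2 * m)) / max a (cmod w ^ (2 * m))) =
      Re (c * w ^ m) * (min (cmod w ^ (2 * m)) b / cmod w ^ (2 * m)) +
      - 1 * (Re (c * w ^ m) * (min (cmod w ^ (2 * m)) a / cmod w ^ (2 * m)))" for w
    by (simp add: right_diff_distrib)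
  then show ?thesis
    using assms by (simp only:) (intro V_add V_scale V_moment_min; simp)
qed

lemma V_moment_spline:
  assumes m: "0 < m" and \<alpha>: "0 < \<alpha>" and X: "strict_mono X" "\<alpha>\<^sup>2 \<le> X 0"
  shows "V (\<lambda>w. Re (c * w ^ m) / max (\<alpha>\<^sup>2) (cmod w ^ (2 * m)) * linear_spline u X n (cmod w ^ (2 * m)))"
proof -
  have X_ge: "\<alpha>\<^sup>2 \<le> X i" "X i < X (Suc i)" for i
    using strict_mono_leD[OF X(1), of 0 i] strict_monoD[OF X(1), of i "Suc i"] X(2) by auto
  then have X_pos: "0 < X i" for i
    using \<alpha> by (meson less_le_trans zero_less_power)
  have "ramp (X i) (X (Suc i)) y / max (\<alpha>\<^sup>2) y = ramp (X i) (X (Suc i)) y / max (X i) y" for i y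
    using X_ge[of i] by (cases "y \<le> X i") (auto simp: ramp_eq_0 max_def)
  then have term_eq: "x / max (\<alpha>\<^sup>2) y * (t * ramp (X i) (X (Suc i)) y) =
      t * (x * (ramp (X i) (X (Suc i)) y / max (X i) y))" for x y t i
    by (metis mult.left_commute times_divide_eq_left times_divide_eq_right)
  show ?thesis
    unfolding linear_spline_def sum_distrib_left term_eq
    using X_ge(2) X_pos m by (intro V_sum V_scale V_moment_ramp; simp)
qed

lemma V_moment_mult_vanishing_at_0:
  assumes m: "0 < m" and \<alpha>: "0 < \<alpha>" "\<alpha>\<^sup>2 < b" and u: "continuous_on UNIV u"
    and below: "\<And>y. y \<le> \<alpha>\<^sup>2 \<Longrightarrow> u y = 0" and above: "\<And>y. b \<le> y \<Longrightarrow> u y = u b"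
  shows "V (\<lambda>w. Re (c * w ^ m) / max (\<alpha>\<^sup>2) (cmod w ^ (2 * m)) * u (cmod w ^ (2 * m)))"
proof (rule V_closed)
  let ?weight = "\<lambda>w. Re (c * w ^ m) / max (\<alpha>\<^sup>2) (cmod w ^ (2 * m))"
  have max_pos: "0 < max (\<alpha>\<^sup>2) x" for x
    using \<alpha> by (simp add: less_max_iff_disj)
  then show "continuous_on UNIV (\<lambda>w. ?weight w * u (cmod w ^ (2 * m)))"
    by (intro continuous_intros continuous_on_compose2[OF u]) (auto simp: less_imp_neq[symmetric])
  fix e :: real
  assume e: "0 < e"
  define C where "C = (cmod c + 1) / \<alpha>"
  have C: "0 < C"
    using \<alpha> by (auto simp: C_def intro!: divide_pos_pos add_nonneg_pos)
  obtain n X where X: "strict_mono X" "X 0 = \<alpha>\<^sup>2" "X n = b"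
    and approx: "\<forall>y. \<bar>u y - linear_spline u X n y\<bar> \<le> e / C"
    by (rule uniform_approx_by_linear_spline[OF \<alpha>(2) continuous_on_subset[OF u] below above, of "e / C"])
      (use e C in auto)
  let ?g = "\<lambda>w. ?weight w * linear_spline u X n (cmod w ^ (2 * m))"
  have "\<bar>?weight w * u (cmod w ^ (2 * m)) - ?g w\<bar> \<le> e" for w
  proof -
    have "?weight w * u (cmod w ^ (2 * m)) - ?g w =
        ?weight w * (u (cmod w ^ (2 * m)) - linear_spline u X n (cmod w ^ (2 * m)))"
      by (simp only: right_diff_distrib)
    also have "\<bar>\<dots>\<bar> \<le> C * (e / C)"
      unfolding abs_mult abs_divide abs_of_pos[OF max_pos] C_def
      by (intro mult_mono abs_Re_mult_power_div_max_le approx[unfolded C_def, rule_format])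
        (use \<alpha> in auto)
    finally show ?thesis
      using C by simp
  qed
  moreover have "V ?g"
    using X by (intro V_moment_spline m \<alpha>(1)) auto
  ultimately show "\<exists>g. V g \<and> (\<forall>w. \<bar>?weight w * u (cmod w ^ (2 * m)) - g w\<bar> \<le> e)"
    by blast
qed

lemma V_angular_vanishing_at_0:
  assumes G: "continuous_on {0..} G" and support: "\<And>x. R \<le> x \<Longrightarrow> G x = 0" and R: "0 < R" and m: "0 < m"
    and \<alpha>: "0 < \<alpha>"
  shows "V (\<lambda>w. Re (c * w ^ m) / max (\<alpha>\<^sup>2) (cmod w ^ (2 * m)) *
    (max 0 (cmod w ^ (2 * m) - \<alpha>\<^sup>2) * G (cmod w)))"
proof -
  define u where "u y = max 0 (y - \<alpha>\<^sup>2) * G (root (2 * m) \<bar>y\<bar>)" for y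
  define b where "b = R ^ (2 * m) + \<alpha>\<^sup>2"
  have "continuous_on UNIV u"
    unfolding u_def by (intro continuous_intros continuous_on_compose2[OF G]) (use m in auto)
  moreover have "u y = 0" if "y \<le> \<alpha>\<^sup>2" for y
    using that by (simp add: u_def)
  moreover have "u y = 0" if "b \<le> y" for y
  proof -
    have "R ^ (2 * m) \<le> \<bar>y\<bar>"
      using that zero_le_power2[of \<alpha>] unfolding b_def by linarith
    then have "R \<le> root (2 * m) \<bar>y\<bar>"
      using real_root_le_mono[of "2 * m" "R ^ (2 * m)" "\<bar>y\<bar>"] m R by (simp add: real_root_power_cancel)
    then show ?thesis
      by (simp add: u_def support)
  qed
  moreover have "\<alpha>\<^sup>2 < b"
    using R by (simp add: b_def)
  ultimately have "V (\<lambda>w. Re (c * w ^ m) / max (\<alpha>\<^sup>2) (cmod w ^ (2 * m)) * u (cmod w ^ (2 * m)))"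
    using m \<alpha> by (intro V_moment_mult_vanishing_at_0[where b = b]) auto
  moreover have "u (cmod w ^ (2 * m)) = max 0 (cmod w ^ (2 * m) - \<alpha>\<^sup>2) * G (cmod w)" for w
    using m by (simp add: u_def real_root_power_cancel)
  ultimately show ?thesis
    by (simp only:)
qed

lemma V_angular:
  assumes G: "continuous_on {0..} G" and support: "\<And>x. R \<le> x \<Longrightarrow> G x = 0" and R: "0 < R" and m: "0 < m"
  shows "V (\<lambda>w. G (cmod w) * Re (c * w ^ m))"
proof (rule V_closed)
  show "continuous_on UNIV (\<lambda>w. G (cmod w) * Re (c * w ^ m))"
    by (intro continuous_intros continuous_on_compose2[OF G]) auto
  fix e :: real
  assume e: "0 < e"
  have "compact (G ` {0..R})"
    by (intro compact_continuous_image continuous_on_subset[OF G]) auto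
  then obtain C where C: "0 < C" "\<And>x. x \<in> {0..R} \<Longrightarrow> \<bar>G x\<bar> \<le> C"
    using compact_imp_bounded bounded_pos by (metis image_eqI real_norm_def)
  then have G_le: "\<bar>G x\<bar> \<le> C" if "0 \<le> x" for x
    using support[of x] that by (cases "x \<le> R") auto
  define \<alpha> where "\<alpha> = e / (C * (cmod c + 1))"
  have c1: "0 < cmod c + 1"
    by (simp add: add_nonneg_pos)
  have \<alpha>: "0 < \<alpha>"
    using e C c1 by (simp add: \<alpha>_def)
  let ?weight = "\<lambda>w. Re (c * w ^ m) / max (\<alpha>\<^sup>2) (cmod w ^ (2 * m))"
  let ?g = "\<lambda>w. ?weight w * (max 0 (cmod w ^ (2 * m) - \<alpha>\<^sup>2) * G (cmod w))"
  have "\<bar>G (cmod w) * Re (c * w ^ m) - ?g w\<bar> \<le> e" for w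
  proof -
    have "g * x - x / max (\<alpha>\<^sup>2) y * (max 0 (y - \<alpha>\<^sup>2) * g) = \<alpha>\<^sup>2 * g * (x / max (\<alpha>\<^sup>2) y)" for g x y
      using \<alpha> by (cases "\<alpha>\<^sup>2 \<le> y") (auto simp: divide_simps algebra_simps)
    then have "G (cmod w) * Re (c * w ^ m) - ?g w = \<alpha>\<^sup>2 * G (cmod w) * ?weight w" .
    also have "\<bar>\<dots>\<bar> = \<alpha>\<^sup>2 * \<bar>G (cmod w)\<bar> * (\<bar>Re (c * w ^ m)\<bar> / max (\<alpha>\<^sup>2) (cmod w ^ (2 * m)))"
      using \<alpha> by (simp only: abs_mult abs_divide abs_power2) (simp add: max_def)
    also have "\<dots> \<le> \<alpha>\<^sup>2 * C * ((cmod c + 1) / \<alpha>)"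
      using C \<alpha>
      by (intro mult_mono abs_Re_mult_power_div_max_le G_le)
        (auto simp: le_max_iff_disj intro!: divide_nonneg_nonneg)
    also have "\<dots> = e"
      using \<alpha> C c1 by (simp add: \<alpha>_def power2_eq_square)
    finally show ?thesis .
  qed
  then show "\<exists>g. V g \<and> (\<forall>w. \<bar>G (cmod w) * Re (c * w ^ m) - g w\<bar> \<le> e)"
    using V_angular_vanishing_at_0[OF G support R m \<alpha>] by blast
qed

end

inductive angular_poly :: "(complex \<Rightarrow> real) \<Rightarrow> bool" where
  base: "continuous_on {0..} G \<Longrightarrow> angular_poly (\<lambda>w. G (cmod w) * Re (c * w ^ m))"
| add: "angular_poly f \<Longrightarrow> angular_poly g \<Longrightarrow> angular_poly (\<lambda>w. f w + g w)"

lemma Re_mult_Re_power: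
  assumes "m \<le> n"
  shows "Re (c * w ^ m) * Re (d * w ^ n) =
    Re (c * d / 2 * w ^ (m + n)) + cmod w ^ (2 * m) * Re (cnj c * d / 2 * w ^ (n - m))"
proof -
  have prod: "Re x * Re y = Re (x * y / 2) + Re (cnj x * y / 2)" for x y
    by (simp add: field_simps)
  have "cnj (w ^ m) * w ^ n = (cnj w * w) ^ m * w ^ (n - m)"
    using assms by (simp add: power_mult_distrib mult.assoc flip: power_add)
  also have "\<dots> = of_real (cmod w ^ (2 * m)) * w ^ (n - m)"
    using complex_norm_square[of w] by (simp add: power_mult mult.commute[of w])
  finally have "cnj (c * w ^ m) * (d * w ^ n) / 2 = cmod w ^ (2 * m) *\<^sub>R (cnj c * d / 2 * w ^ (n - m))"
    by (simp add: scaleR_conv_of_real mult_ac)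
  moreover have "c * w ^ m * (d * w ^ n) / 2 = c * d / 2 * w ^ (m + n)"
    by (simp add: power_add mult_ac)
  ultimately show ?thesis
    using prod[of "c * w ^ m" "d * w ^ n"] by (simp only: scaleR_complex.sel)
qed

lemma angular_poly_mult_base:
  assumes "continuous_on {0..} G" "continuous_on {0..} H"
  shows "angular_poly (\<lambda>w. (G (cmod w) * Re (c * w ^ m)) * (H (cmod w) * Re (d * w ^ n)))"
  using assms
proof (induction m n arbitrary: c d G H rule: linorder_wlog)
  case (le m n)
  have "(G (cmod w) * Re (c * w ^ m)) * (H (cmod w) * Re (d * w ^ n)) =
      (\<lambda>x. G x * H x) (cmod w) * Re (c * d / 2 * w ^ (m + n)) +
      (\<lambda>x. G x * H x * x ^ (2 * m)) (cmod w) * Re (cnj c * d / 2 * w ^ (n - m))" for w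
  proof -
    have "(G (cmod w) * Re (c * w ^ m)) * (H (cmod w) * Re (d * w ^ n)) =
        (G (cmod w) * H (cmod w)) * (Re (c * w ^ m) * Re (d * w ^ n))"
      by (simp only: mult_ac)
    then show ?thesis
      by (simp only: Re_mult_Re_power[OF le(1)] distrib_left mult.assoc)
  qed
  then show ?case
    using le by (simp only:) (intro angular_poly.intros continuous_intros)
next
  case (sym m n)
  then show ?case
    by (subst mult.commute)
qed

lemma angular_poly_mult:
  assumes "angular_poly f" "angular_poly g"
  shows "angular_poly (\<lambda>w. f w * g w)"
  using assms(1)
proof induction
  case (base G c m)
  show ?case
    using assms(2)
  proof induction
    case (base H d n)
    show ?case
      using \<open>continuous_on {0..} G\<close> base by (rule angular_poly_mult_base)
  next
    case (add f g)
    from angular_poly.add[OF add.IH] show ?case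
      by (simp only: distrib_left)
  qed
next
  case (add f g)
  from angular_poly.add[OF add.IH] show ?case
    by (simp only: distrib_right)
qed

lemma real_polynomial_function_imp_angular_poly:
  assumes "real_polynomial_function f"
  shows "angular_poly f"
  using assms
proof induction
  case (linear f)
  then interpret bounded_linear f .
  define c where "c = of_real (f 1) - \<i> * of_real (f \<i>)"
  have "f w = 1 * Re (c * w ^ 1)" for w
  proof -
    have "f w = f (Re w *\<^sub>R 1 + Im w *\<^sub>R \<i>)"
      by (metis complex_eq scaleR_conv_of_real mult.commute mult.right_neutral)
    also have "\<dots> = Re w * f 1 + Im w * f \<i>"
      by (simp only: add scaleR) simp
    finally show ?thesis
      by (simp add: c_def)
  qed
  then show ?case
    using angular_poly.base[OF continuous_on_const[of _ 1], of c 1] by presburger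
next
  case (const c)
  show ?case
    using angular_poly.base[OF continuous_on_const[of _ c], of 1 0] by simp
qed (auto intro: angular_poly.add angular_poly_mult)

context test_class
begin

lemma V_cutoff_mult_angular_poly:
  assumes "angular_poly f" and \<kappa>: "continuous_on {0..} \<kappa>" and support: "\<And>x. R \<le> x \<Longrightarrow> \<kappa> x = 0" and R: "0 < R"
  shows "V (\<lambda>w. \<kappa> (cmod w) * f w)"
  using assms(1)
proof induction
  case (base G c m)
  define H where "H x = \<kappa> x * G x" for x
  have H: "continuous_on {0..} H" "\<And>x. R \<le> x \<Longrightarrow> H x = 0"
    unfolding H_def by (auto intro!: continuous_intros \<kappa> base simp: support)
  show ?case
  proof (cases "m = 0")
    case True
    then show ?thesis
      using V_scale[OF V_radial[OF H R], of "Re c"] by (simp add: H_def mult_ac)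
  next
    case False
    then show ?thesis
      using V_angular[OF H R, of m c] by (simp add: H_def mult.assoc)
  qed
next
  case (add f g)
  then show ?case
    by (simp add: distrib_left V_add)
qed

lemma V_compact_support:
  assumes \<phi>: "continuous_on UNIV \<phi>" and \<rho>: "0 < \<rho>" and support: "\<And>w. \<rho> \<le> cmod w \<Longrightarrow> \<phi> w = 0"
  shows "V \<phi>"
proof (rule V_closed[OF \<phi>])
  fix e :: real
  assume e: "0 < e"
  obtain p where p: "real_polynomial_function p" "\<And>w. w \<in> cball 0 (\<rho> + 1) \<Longrightarrow> \<bar>\<phi> w - p w\<bar> < e"
    by (rule Stone_Weierstrass_real_polynomial_function[OF compact_cball[of 0 "\<rho> + 1"]
          continuous_on_subset[OF \<phi>] e])
      auto
  define \<kappa> where "\<kappa> x = max 0 (min 1 (\<rho> + 1 - x))" for x :: real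
  have "V (\<lambda>w. \<kappa> (cmod w) * p w)"
    using \<rho> unfolding \<kappa>_def
    by (intro V_cutoff_mult_angular_poly[where R = "\<rho> + 1"] real_polynomial_function_imp_angular_poly
        p continuous_intros)
      auto
  moreover have "\<bar>\<phi> w - \<kappa> (cmod w) * p w\<bar> \<le> e" for w
  proof (cases "cmod w \<le> \<rho> + 1")
    case True
    have "\<phi> w = \<kappa> (cmod w) * \<phi> w"
      using support[of w] by (cases "\<rho> \<le> cmod w") (auto simp: \<kappa>_def)
    then have "\<phi> w - \<kappa> (cmod w) * p w = \<kappa> (cmod w) * (\<phi> w - p w)"
      by (simp only: right_diff_distrib)
    also have "\<bar>\<dots>\<bar> \<le> 1 * e"
      using p(2)[of w] True unfolding abs_mult by (intro mult_mono) (auto simp: \<kappa>_def)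
    finally show ?thesis
      by simp
  next
    case False
    then show ?thesis
      using support[of w] e by (simp add: \<kappa>_def)
  qed
  ultimately show "\<exists>g. V g \<and> (\<forall>w. \<bar>\<phi> w - g w\<bar> \<le> e)"
    by blast
qed

end

subsection \<open>Coefficient profiles and arrays\<close>

lemma continuous_on_Icc_less_imp_interval:
  fixes g :: "real \<Rightarrow> real"
  assumes g: "continuous_on {a..b} g" and ab: "a < b" and t: "t \<in> {a..b}" "c < g t"
  obtains t0 \<kappa> where "a \<le> t0" "0 < \<kappa>" "t0 + \<kappa> < b" "\<forall>x\<in>{t0..t0 + \<kappa>}. c < g x"
proof -
  have "\<exists>d>0. \<forall>x\<in>{a..b}. dist x t < d \<longrightarrow> dist (g x) (g t) < g t - c"
    using g t unfolding continuous_on_iff by simp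
  then obtain d where d: "0 < d" "\<And>x. x \<in> {a..b} \<Longrightarrow> dist x t < d \<Longrightarrow> dist (g x) (g t) < g t - c"
    by blast
  define w where "w = min d (b - a)"
  have w: "0 < w" "w \<le> d" "w \<le> b - a"
    using d ab by (auto simp: w_def)
  define t0 where "t0 = min t (b - w / 2)"
  have t0: "a \<le> t0" "t0 + w / 4 < b"
    using t w by (auto simp: t0_def min_def)
  moreover have "c < g x" if "t0 \<le> x" "x \<le> t0 + w / 4" for x
  proof -
    have "\<bar>x - t\<bar> < d"
      using that w t by (auto simp: t0_def min_def abs_less_iff split: if_splits)
    then have "dist (g x) (g t) < g t - c"
      using that t0 by (intro d(2)) (auto simp: dist_real_def)
    then show ?thesis
      by (simp add: dist_real_def abs_less_iff)
  qed
  ultimately show ?thesis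
    using w by (intro that[of t0 "w / 4"]) auto
qed

locale coefficient_profile =
  fixes p :: "real \<Rightarrow> real" and T0 :: real
  assumes p_nonneg: "\<And>t. 0 \<le> t \<Longrightarrow> 0 \<le> p t"
    and T0: "0 < T0"
    and p_pos: "\<And>t. 0 \<le> t \<Longrightarrow> t < T0 \<Longrightarrow> p t > 0"
    and p_zero: "\<And>t. t > T0 \<Longrightarrow> p t = 0"
    and p_cont: "continuous_on {0..T0} p"
begin

abbreviation "I \<equiv> legendre_I p"

lemma pos_imp_le_T0: "p t > 0 \<Longrightarrow> t \<le> T0"
  using p_zero[of t] by (cases "t \<le> T0") auto

lemma legendre_set_nonempty: "{s * t + ln (p t) | t. 0 \<le> t \<and> p t > 0} \<noteq> {}"
  using p_pos[of 0] T0 by auto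

lemma legendre_set_bdd_above: "bdd_above {s * t + ln (p t) | t. 0 \<le> t \<and> p t > 0}"
proof -
  have "compact (p ` {0..T0})"
    by (intro compact_continuous_image p_cont) auto
  then obtain P where P: "\<And>t. t \<in> {0..T0} \<Longrightarrow> \<bar>p t\<bar> \<le> P"
    by (metis bounded_iff compact_imp_bounded image_eqI real_norm_def)
  have "s * t + ln (p t) \<le> \<bar>s\<bar> * T0 + ln P" if t: "0 \<le> t" "p t > 0" for t
  proof -
    have "t \<le> T0"
      using pos_imp_le_T0 t by blast
    then have "s * t \<le> \<bar>s\<bar> * T0" "ln (p t) \<le> ln P"
      using t P[of t] by (auto intro!: mult_mono ln_mono)
    then show ?thesis
      by simp
  qed
  then show ?thesis
    by (intro bdd_aboveI[where M = "\<bar>s\<bar> * T0 + ln P"]) auto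
qed

lemma legendre_ge: "0 \<le> t \<Longrightarrow> p t > 0 \<Longrightarrow> s * t + ln (p t) \<le> I s"
  unfolding legendre_I_def by (intro cSup_upper[OF _ legendre_set_bdd_above]) auto

lemma legendre_le:
  assumes "\<And>t. 0 \<le> t \<Longrightarrow> t \<le> T0 \<Longrightarrow> p t > 0 \<Longrightarrow> s * t + ln (p t) \<le> C"
  shows "I s \<le> C"
  unfolding legendre_I_def
  using assms pos_imp_le_T0 by (intro cSup_least[OF legendre_set_nonempty]) auto

lemma profile_mult_exp_le:
  assumes "0 \<le> t"
  shows "p t * exp (s * t) \<le> exp (I s)"
proof (cases "p t > 0")
  case True
  then have "p t * exp (s * t) = exp (s * t + ln (p t))"
    by (simp add: exp_add)
  also have "\<dots> \<le> exp (I s)"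
    using legendre_ge[OF assms True] by simp
  finally show ?thesis .
next
  case False
  then have "p t = 0"
    using p_nonneg[OF assms] by simp
  then show ?thesis
    by simp
qed

lemma near_maximizer_interval:
  assumes "0 < e"
  obtains t0 \<kappa> where "0 \<le> t0" "0 < \<kappa>" "t0 + \<kappa> < T0"
    "\<forall>t\<in>{t0..t0 + \<kappa>}. exp (I s - e) < p t * exp (s * t)"
proof -
  have "\<exists>x\<in>{s * t + ln (p t) | t. 0 \<le> t \<and> p t > 0}. I s - e < x"
    using assms unfolding legendre_I_def by (intro less_cSupD legendre_set_nonempty) simp
  then obtain t where t: "0 \<le> t" "p t > 0" "I s - e < s * t + ln (p t)"
    by auto
  then have "exp (I s - e) < exp (s * t + ln (p t))"
    by simp
  also have "\<dots> = p t * exp (s * t)"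
    using t by (simp add: exp_add)
  finally have "exp (I s - e) < p t * exp (s * t)" .
  moreover have "continuous_on {0..T0} (\<lambda>t. p t * exp (s * t))"
    by (intro continuous_intros p_cont)
  ultimately show ?thesis
    using continuous_on_Icc_less_imp_interval[of 0 T0 "\<lambda>t. p t * exp (s * t)" t "exp (I s - e)"]
      T0 t(1,2) pos_imp_le_T0 that by auto
qed

sublocale lipschitz_convex I T0
proof
  show "convex_on UNIV I"
  proof (rule convex_onI)
    fix u x y :: real
    assume u: "0 < u" "u < 1"
    show "I ((1 - u) *\<^sub>R x + u *\<^sub>R y) \<le> (1 - u) * I x + u * I y"
    proof (rule legendre_le)
      fix t
      assume t: "0 \<le> t" "p t > 0"
      have "((1 - u) *\<^sub>R x + u *\<^sub>R y) * t + ln (p t) =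
          (1 - u) * (x * t + ln (p t)) + u * (y * t + ln (p t))"
        by (simp add: algebra_simps)
      also have "\<dots> \<le> (1 - u) * I x + u * I y"
        using u t by (intro add_mono mult_left_mono legendre_ge) auto
      finally show "((1 - u) *\<^sub>R x + u *\<^sub>R y) * t + ln (p t) \<le> (1 - u) * I x + u * I y" .
    qed
  qed simp
next
  fix x y :: real
  assume xy: "x \<le> y"
  show "I x \<le> I y"
  proof (rule legendre_le)
    fix t
    assume t: "0 \<le> t" "p t > 0"
    then show "x * t + ln (p t) \<le> I y"
      using legendre_ge[of t y] mult_right_mono[OF xy, of t] by simp
  qed
  have "I y \<le> I x + T0 * (y - x)"
  proof (rule legendre_le)
    fix t
    assume t: "0 \<le> t" "t \<le> T0" "p t > 0"
    then show "y * t + ln (p t) \<le> I x + T0 * (y - x)"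
      using legendre_ge[of t x] mult_left_mono[of t T0 "y - x"] xy by (simp add: algebra_simps)
  qed
  then show "I y - I x \<le> T0 * (y - x)"
    by simp
qed

end

locale coefficient_array = coefficient_profile p T0 for p :: "real \<Rightarrow> real" and T0 :: real +
  fixes L :: "nat \<Rightarrow> nat" and \<delta> :: "nat \<Rightarrow> real" and pc :: "nat \<Rightarrow> nat \<Rightarrow> complex"
  assumes L_pos: "\<And>n. 0 < L n"
    and L_lim: "filterlim L at_top sequentially"
    and \<delta>_range: "\<And>n. - T0 < \<delta> n \<and> \<delta> n < T0"
    and \<delta>_lim: "\<delta> \<longlonglongrightarrow> 0"
    and coef: "(\<lambda>n. Max ((\<lambda>k. \<bar>cmod (pc k n) powr (1 / real (L n))
                     - p (min (real k / real (L n)) T0)\<bar>)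
                   ` {0..nat \<lfloor>(T0 - \<delta> n) * real (L n)\<rfloor>})) \<longlonglongrightarrow> 0"
begin

definition deg :: "nat \<Rightarrow> nat" where
  "deg n = nat \<lfloor>(T0 - \<delta> n) * real (L n)\<rfloor>"

definition coef_error :: "nat \<Rightarrow> real" where
  "coef_error n = Max ((\<lambda>k. \<bar>cmod (pc k n) powr (1 / real (L n)) - p (min (real k / real (L n)) T0)\<bar>) ` {0..deg n})"

lemma coef_error_lim: "coef_error \<longlonglongrightarrow> 0"
  using coef unfolding coef_error_def deg_def .

lemma abs_coef_root_diff_le:
  "k \<le> deg n \<Longrightarrow> \<bar>cmod (pc k n) powr (1 / real (L n)) - p (min (real k / real (L n)) T0)\<bar> \<le> coef_error n"
  unfolding coef_error_def by (intro Max_ge) auto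

lemma coef_error_nonneg: "0 \<le> coef_error n"
  using abs_coef_root_diff_le[of 0 n] by linarith

lemma real_L_pos: "0 < real (L n)"
  using L_pos by simp

lemma real_L_lim: "filterlim (\<lambda>n. real (L n)) at_top sequentially"
  using filterlim_compose[OF filterlim_real_sequentially L_lim] .

lemma eventually_real_L_ge: "\<forall>\<^sub>F n in sequentially. C \<le> real (L n)"
  using real_L_lim unfolding filterlim_at_top by blast

lemma le_deg_iff: "k \<le> deg n \<longleftrightarrow> real k / real (L n) \<le> T0 - \<delta> n"
proof -
  have "0 \<le> (T0 - \<delta> n) * real (L n)"
    using \<delta>_range[of n] by simp
  then have "k \<le> deg n \<longleftrightarrow> real k \<le> (T0 - \<delta> n) * real (L n)"
    unfolding deg_def by (simp add: le_nat_iff le_floor_iff)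
  then show ?thesis
    using real_L_pos[of n] by (simp add: pos_divide_le_eq)
qed

lemma deg_le: "real (deg n) \<le> 2 * T0 * real (L n)"
proof -
  have "real (deg n) / real (L n) \<le> T0 - \<delta> n"
    using le_deg_iff by blast
  also have "\<dots> \<le> 2 * T0"
    using \<delta>_range[of n] by simp
  finally show ?thesis
    using real_L_pos[of n] by (simp add: pos_divide_le_eq)
qed

lemma Suc_deg_le: "real (Suc (deg n)) \<le> (2 * T0 + 1) * real (L n)"
  using deg_le[of n] L_pos[of n] by (simp add: distrib_right Suc_le_eq)

lemma coef_root_power:
  "(cmod (pc k n) powr (1 / real (L n)) * exp (s * (real k / real (L n)))) ^ L n =
    cmod (pc k n) * exp (s * real k)"
proof -
  have "(cmod (pc k n) powr (1 / real (L n))) ^ L n = cmod (pc k n)"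
    using L_pos[of n] by (cases "pc k n = 0") (auto simp: powr_powr simp flip: powr_realpow)
  moreover have "exp (s * (real k / real (L n))) ^ L n = exp (s * real k)"
    using real_L_pos[of n] by (simp flip: exp_of_nat_mult)
  ultimately show ?thesis
    by (simp add: power_mult_distrib)
qed

lemma coef_root_mult_exp_le:
  assumes k: "k \<le> deg n"
  shows "cmod (pc k n) powr (1 / real (L n)) * exp (s * (real k / real (L n))) \<le>
    exp (I s) * exp (\<bar>s\<bar> * \<bar>\<delta> n\<bar>) + coef_error n * exp (\<bar>s\<bar> * (2 * T0))"
proof -
  define t where "t = real k / real (L n)"
  define u where "u = min t T0"
  have t: "0 \<le> t" "t \<le> T0 - \<delta> n" "t \<le> 2 * T0"
    using k le_deg_iff[of k n] \<delta>_range[of n] by (auto simp: t_def)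
  have u: "0 \<le> u" "0 \<le> t - u" "t - u \<le> \<bar>\<delta> n\<bar>"
    using t T0 by (auto simp: u_def min_def)
  have "cmod (pc k n) powr (1 / real (L n)) * exp (s * t) \<le> (p u + coef_error n) * exp (s * t)"
    using abs_coef_root_diff_le[OF k] by (intro mult_right_mono) (auto simp: u_def t_def)
  also have "\<dots> = p u * exp (s * u) * exp (s * (t - u)) + coef_error n * exp (s * t)"
    by (simp add: algebra_simps exp_diff)
  also have "\<dots> \<le> exp (I s) * exp (\<bar>s\<bar> * \<bar>\<delta> n\<bar>) + coef_error n * exp (\<bar>s\<bar> * (2 * T0))"
  proof (intro add_mono mult_mono profile_mult_exp_le u coef_error_nonneg order_refl)
    have "s * (t - u) \<le> \<bar>s\<bar> * \<bar>\<delta> n\<bar>"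
      using u by (intro mult_mono) auto
    then show "exp (s * (t - u)) \<le> exp (\<bar>s\<bar> * \<bar>\<delta> n\<bar>)"
      by simp
    have "s * t \<le> \<bar>s\<bar> * (2 * T0)"
      using t by (intro mult_mono) auto
    then show "exp (s * t) \<le> exp (\<bar>s\<bar> * (2 * T0))"
      by simp
  qed auto
  finally show ?thesis
    by (simp add: t_def)
qed

lemma coef_upper:
  assumes e: "0 < e"
  shows "\<forall>\<^sub>F n in sequentially. \<forall>k\<le>deg n. cmod (pc k n) * exp (s * real k) \<le> exp (real (L n) * (I s + e))"
proof -
  have "(\<lambda>n. exp (I s) * exp (\<bar>s\<bar> * \<bar>\<delta> n\<bar>) + coef_error n * exp (\<bar>s\<bar> * (2 * T0))) \<longlonglongrightarrow>
      exp (I s) * exp (\<bar>s\<bar> * \<bar>0\<bar>) + 0 * exp (\<bar>s\<bar> * (2 * T0))"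
    by (intro tendsto_intros \<delta>_lim coef_error_lim)
  then have "\<forall>\<^sub>F n in sequentially.
      exp (I s) * exp (\<bar>s\<bar> * \<bar>\<delta> n\<bar>) + coef_error n * exp (\<bar>s\<bar> * (2 * T0)) < exp (I s + e)"
    by (rule order_tendstoD) (use e in simp)
  then show ?thesis
  proof eventually_elim
    case (elim n)
    show ?case
    proof (intro allI impI)
      fix k
      assume "k \<le> deg n"
      then have "cmod (pc k n) powr (1 / real (L n)) * exp (s * (real k / real (L n))) \<le> exp (I s + e)"
        using coef_root_mult_exp_le[of k n s] elim by linarith
      from power_mono[OF this, of "L n"]
      show "cmod (pc k n) * exp (s * real k) \<le> exp (real (L n) * (I s + e))"
        unfolding coef_root_power by (simp add: exp_of_nat_mult)
    qed
  qed
qed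

lemma coef_root_mult_exp_ge:
  assumes k: "k \<le> deg n" and t: "real k / real (L n) \<le> T0"
  shows "p (real k / real (L n)) * exp (s * (real k / real (L n))) - coef_error n * exp (\<bar>s\<bar> * T0) \<le>
    cmod (pc k n) powr (1 / real (L n)) * exp (s * (real k / real (L n)))"
proof -
  let ?t = "real k / real (L n)"
  have "s * ?t \<le> \<bar>s\<bar> * T0"
    using t by (intro mult_mono) auto
  then have "coef_error n * exp (s * ?t) \<le> coef_error n * exp (\<bar>s\<bar> * T0)"
    by (intro mult_left_mono coef_error_nonneg) simp
  then have "p ?t * exp (s * ?t) - coef_error n * exp (\<bar>s\<bar> * T0) \<le> (p ?t - coef_error n) * exp (s * ?t)"
    by (simp add: left_diff_distrib)
  also have "\<dots> \<le> cmod (pc k n) powr (1 / real (L n)) * exp (s * ?t)"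
    using abs_coef_root_diff_le[OF k] t by (intro mult_right_mono) auto
  finally show ?thesis .
qed

lemma coef_lower:
  assumes e: "0 < e"
  obtains t0 \<kappa> where "0 \<le> t0" "0 < \<kappa>"
    "\<forall>\<^sub>F n in sequentially. \<forall>k. t0 \<le> real k / real (L n) \<and> real k / real (L n) \<le> t0 + \<kappa> \<longrightarrow>
      k \<le> deg n \<and> exp (real (L n) * (I s - e)) \<le> cmod (pc k n) * exp (s * real k)"
proof -
  obtain t0 \<kappa> where t0: "0 \<le> t0" "0 < \<kappa>" "t0 + \<kappa> < T0"
    and near: "\<forall>t\<in>{t0..t0 + \<kappa>}. exp (I s - e / 2) < p t * exp (s * t)"
    by (rule near_maximizer_interval[of "e / 2" s]) (use e in auto)
  have "(\<lambda>n. exp (I s - e / 2) - coef_error n * exp (\<bar>s\<bar> * T0)) \<longlonglongrightarrow> exp (I s - e / 2) - 0 * exp (\<bar>s\<bar> * T0)"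
    by (intro tendsto_intros coef_error_lim)
  then have "\<forall>\<^sub>F n in sequentially. exp (I s - e) < exp (I s - e / 2) - coef_error n * exp (\<bar>s\<bar> * T0)"
    by (rule order_tendstoD) (use e in simp)
  moreover have "\<forall>\<^sub>F n in sequentially. \<delta> n < T0 - (t0 + \<kappa>)"
    by (rule order_tendstoD(2)[OF \<delta>_lim]) (use t0 in simp)
  ultimately have "\<forall>\<^sub>F n in sequentially. \<forall>k. t0 \<le> real k / real (L n) \<and> real k / real (L n) \<le> t0 + \<kappa> \<longrightarrow>
      k \<le> deg n \<and> exp (real (L n) * (I s - e)) \<le> cmod (pc k n) * exp (s * real k)"
  proof eventually_elim
    case (elim n)
    show ?case
    proof (intro allI impI)
      fix k
      assume t: "t0 \<le> real k / real (L n) \<and> real k / real (L n) \<le> t0 + \<kappa>"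
      then have k: "k \<le> deg n"
        using elim by (simp add: le_deg_iff)
      moreover have "exp (I s - e / 2) < p (real k / real (L n)) * exp (s * (real k / real (L n)))"
        using near t by (meson atLeastAtMost_iff)
      moreover have "real k / real (L n) \<le> T0"
        using t t0(3) by linarith
      ultimately have "exp (I s - e) \<le>
          cmod (pc k n) powr (1 / real (L n)) * exp (s * (real k / real (L n)))"
        using coef_root_mult_exp_ge[of k n s] elim by linarith
      from power_mono[OF this, of "L n"]
      show "k \<le> deg n \<and> exp (real (L n) * (I s - e)) \<le> cmod (pc k n) * exp (s * real k)"
        unfolding coef_root_power using k by (simp add: exp_of_nat_mult)
    qed
  qed
  with t0 show ?thesis
    by (intro that)
qed

lemma eventually_lacunary_coefs:
  assumes e: "0 < e" and N: "0 < N" and B: "1 < B"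
  shows "\<forall>\<^sub>F n in sequentially. \<exists>s' K. s \<le> s' \<and> s' \<le> s + e \<and> K \<subseteq> {..deg n} \<and> card K = N \<and>
    lacunary_on K B (\<lambda>k. cmod (pc k n) * exp (s' * real k)) \<and>
    (\<forall>k\<in>K. exp (real (L n) * (I s - e)) \<le> cmod (pc k n) * exp (s' * real k))"
proof -
  obtain t0 \<kappa> where t0: "0 \<le> t0" "0 < \<kappa>"
    and lower: "\<forall>\<^sub>F n in sequentially. \<forall>k. t0 \<le> real k / real (L n) \<and> real k / real (L n) \<le> t0 + \<kappa> \<longrightarrow>
      k \<le> deg n \<and> exp (real (L n) * (I s - e)) \<le> cmod (pc k n) * exp (s * real k)"
    by (rule coef_lower[OF e])
  from lower eventually_real_L_ge[of "2 * real N / \<kappa>"]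
    eventually_real_L_ge[of "4 * real N ^ 3 * ln B / (\<kappa> * e)"]
  show ?thesis
  proof eventually_elim
    case (elim n)
    let ?l = "real (L n)"
    define g where "g = \<kappa> * ?l / (2 * real N)"
    have g: "0 < g"
      using t0 real_L_pos[of n] N by (simp add: g_def)
    obtain K where K: "card K = N" "finite K"
      and K_range: "\<And>k. k \<in> K \<Longrightarrow> t0 \<le> real k / ?l \<and> real k / ?l \<le> t0 + \<kappa>"
      and sep: "\<And>i j. i \<in> K \<Longrightarrow> j \<in> K \<Longrightarrow> i \<noteq> j \<Longrightarrow> g \<le> \<bar>real i - real j\<bar>"
      using exists_separated_indices[of t0 ?l N \<kappa>] t0 real_L_pos[of n] N elim(2) unfolding g_def
      by (metis mult.commute pos_divide_le_eq)
    have K_coef: "k \<le> deg n" "exp (?l * (I s - e)) \<le> cmod (pc k n) * exp (s * real k)" if "k \<in> K" for k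
      using elim(1) K_range[OF that] by auto
    have pc_pos: "0 < cmod (pc k n)" if "k \<in> K" for k
      using K_coef(2)[OF that] exp_gt_zero[of "?l * (I s - e)"] by (auto simp del: exp_gt_zero)
    obtain s' where s': "s \<le> s'" "s' \<le> s + 2 * (ln B / g) * real ((card K)\<^sup>2)"
      and lac: "lacunary_on K B (\<lambda>k. cmod (pc k n) * exp (s' * real k))"
      by (rule exists_lacunary_exp_shift[OF K(2) g B pc_pos sep]) blast
    have "2 * (ln B / g) * real ((card K)\<^sup>2) = 4 * real N ^ 3 * ln B / (\<kappa> * ?l)"
      using N by (simp add: K(1) g_def power2_eq_square power3_eq_cube)
    also have "\<dots> \<le> e"
      using elim(3) t0 real_L_pos[of n] e by (simp add: field_simps)
    finally have "s' \<le> s + e"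
      using s' by linarith
    moreover have "cmod (pc k n) * exp (s * real k) \<le> cmod (pc k n) * exp (s' * real k)" for k
      using s'(1) by (intro mult_left_mono) (auto intro: mult_right_mono)
    ultimately show ?case
      using s'(1) lac K(1) K_coef order_trans by (intro exI[of _ s'] exI[of _ K]) blast
  qed
qed

end

subsection \<open>Independent variables with a logarithmic moment\<close>

lemma ln_one_plus_le_imp_le_exp:
  fixes x :: real
  assumes "0 \<le> x" "ln (1 + x) \<le> a"
  shows "x \<le> exp a"
proof -
  have "exp (ln (1 + x)) \<le> exp a"
    using assms(2) by simp
  then show ?thesis
    using assms(1) by simp
qed

lemma exists_power_add_mult_le:
  fixes q0 \<theta> :: real
  assumes "0 \<le> q0" "q0 < 1" "0 < \<theta>"
  obtains N :: nat and q \<tau> :: real where "0 < N" "0 < \<tau>" "q0 + \<tau> \<le> q" "q ^ N + real N * \<tau> \<le> \<theta>"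
proof -
  define q where "q = (q0 + 1) / 2"
  have q: "0 < q" "q < 1" "q0 < q"
    using assms by (auto simp: q_def)
  obtain n where "q ^ n < \<theta> / 2"
    using real_arch_pow_inv[of "\<theta> / 2" q] q assms by auto
  moreover have "q ^ Suc n \<le> q ^ n"
    using q by (intro power_decreasing) auto
  ultimately have "q ^ Suc n \<le> \<theta> / 2"
    by linarith
  moreover define \<tau> where "\<tau> = min (q - q0) (\<theta> / (2 * real (Suc n)))"
  have "\<tau> \<le> \<theta> / (2 * real (Suc n))"
    by (simp add: \<tau>_def)
  then have "real (Suc n) * \<tau> \<le> \<theta> / 2"
    by (simp add: field_simps)
  moreover have "0 < \<tau>" "q0 + \<tau> \<le> q"
    using q assms by (auto simp: \<tau>_def)
  ultimately show ?thesis
    by (intro that[of "Suc n" \<tau> q]) auto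
qed

locale iid_log_moment = prob_space M for M :: "'a measure" +
  fixes \<xi> :: "nat \<Rightarrow> 'a \<Rightarrow> complex"
  assumes meas [measurable]: "\<And>k. \<xi> k \<in> borel_measurable M"
    and indep: "indep_vars (\<lambda>_. borel) \<xi> UNIV"
    and ident: "\<And>k. distr M borel (\<xi> k) = distr M borel (\<xi> 0)"
    and nondeg: "\<not> (\<exists>c. AE \<omega> in M. \<xi> 0 \<omega> = c)"
    and logmom: "integrable M (\<lambda>\<omega>. ln (1 + cmod (\<xi> 0 \<omega>)))"
begin

lemma prob_ident:
  assumes [measurable]: "Measurable.pred borel P"
  shows "prob {\<omega>\<in>space M. P (\<xi> k \<omega>)} = prob {\<omega>\<in>space M. P (\<xi> 0 \<omega>)}"
proof -
  have "prob {\<omega>\<in>space M. P (\<xi> j \<omega>)} = measure (distr M borel (\<xi> j)) {x \<in> space borel. P x}" for j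
    by (subst measure_distr) (auto intro!: arg_cong[where f = prob])
  then show ?thesis
    using ident by metis
qed

lemma log_tail_tendsto_0:
  "((\<lambda>t. t * prob {\<omega>\<in>space M. t < ln (1 + cmod (\<xi> k \<omega>))}) \<longlongrightarrow> 0) at_top"
proof -
  have "prob {\<omega>\<in>space M. t < ln (1 + cmod (\<xi> k \<omega>))} = prob {\<omega>\<in>space M. t < ln (1 + cmod (\<xi> 0 \<omega>))}" for t
    by (rule prob_ident[where P = "\<lambda>x. t < ln (1 + cmod x)"]) measurable
  then show ?thesis
    using integrable_imp_tail_tendsto_0[OF logmom] by simp
qed

lemma tight:
  assumes "0 < \<tau>"
  obtains R where "0 \<le> R" "\<And>k. prob {\<omega>\<in>space M. R < cmod (\<xi> k \<omega>)} \<le> \<tau>"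
proof -
  let ?P = "\<lambda>t. prob {\<omega>\<in>space M. t < ln (1 + cmod (\<xi> 0 \<omega>))}"
  have "\<forall>\<^sub>F t in at_top. t * ?P t < \<tau>"
    using order_tendstoD(2)[OF log_tail_tendsto_0 assms] .
  then have "\<forall>\<^sub>F t in at_top. 1 \<le> t \<and> t * ?P t < \<tau>"
    using eventually_ge_at_top[of 1] by eventually_elim simp
  then obtain t where t: "1 \<le> t" "t * ?P t < \<tau>"
    using eventually_happens[of _ "at_top :: real filter"] by auto
  have "prob {\<omega>\<in>space M. exp t < cmod (\<xi> k \<omega>)} \<le> \<tau>" for k
  proof -
    have "prob {\<omega>\<in>space M. exp t < cmod (\<xi> k \<omega>)} = prob {\<omega>\<in>space M. exp t < cmod (\<xi> 0 \<omega>)}"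
      by (rule prob_ident[where P = "\<lambda>x. exp t < cmod x"]) measurable
    also have "\<dots> \<le> ?P t"
    proof (intro finite_measure_mono subsetI)
      fix \<omega>
      assume "\<omega> \<in> {\<omega>\<in>space M. exp t < cmod (\<xi> 0 \<omega>)}"
      then show "\<omega> \<in> {\<omega>\<in>space M. t < ln (1 + cmod (\<xi> 0 \<omega>))}"
        using ln_one_plus_le_imp_le_exp[of "cmod (\<xi> 0 \<omega>)" t] by force
    qed measurable
    also have "\<dots> \<le> t * ?P t"
      using t(1) mult_right_mono[of 1 t "?P t"] by simp
    finally show ?thesis
      using t by simp
  qed
  then show ?thesis
    by (intro that[of "exp t"]) auto
qed

lemma whp_le_exp:
  fixes l :: "nat \<Rightarrow> real" and N :: "nat \<Rightarrow> nat"
  assumes l: "filterlim l at_top sequentially" and N: "\<And>n. real (N n) \<le> C * l n" and e: "0 < e"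
  shows "\<forall>\<^sub>F (n, \<omega>) in whp M. \<forall>k<N n. cmod (\<xi> k \<omega>) \<le> exp (e * l n)"
  unfolding eventually_whp
proof (intro allI impI)
  fix \<theta> :: real
  assume \<theta>: "0 < \<theta>"
  let ?P = "\<lambda>n. prob {\<omega>\<in>space M. e * l n < ln (1 + cmod (\<xi> 0 \<omega>))}"
  have "filterlim (\<lambda>n. e * l n) at_top sequentially"
    using filterlim_tendsto_pos_mult_at_top[OF tendsto_const e l] .
  from filterlim_compose[OF log_tail_tendsto_0 this]
  have "(\<lambda>n. C / e * (e * l n * ?P n)) \<longlonglongrightarrow> C / e * 0"
    by (intro tendsto_mult_left)
  then have "\<forall>\<^sub>F n in sequentially. C / e * (e * l n * ?P n) < \<theta>"
    by (rule order_tendstoD) (use \<theta> in simp)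
  then show "\<forall>\<^sub>F n in sequentially. \<exists>E\<in>events. prob E \<le> \<theta> \<and>
      (\<forall>\<omega>\<in>space M - E. case (n, \<omega>) of (n, \<omega>) \<Rightarrow> \<forall>k<N n. cmod (\<xi> k \<omega>) \<le> exp (e * l n))"
  proof eventually_elim
    case (elim n)
    define E where "E k = {\<omega>\<in>space M. e * l n < ln (1 + cmod (\<xi> k \<omega>))}" for k
    have [measurable]: "E k \<in> events" for k
      unfolding E_def by measurable
    have "prob (E k) = ?P n" for k
      unfolding E_def by (rule prob_ident[where P = "\<lambda>x. e * l n < ln (1 + cmod x)"]) measurable
    then have "prob (\<Union>k\<in>{..<N n}. E k) \<le> real (N n) * ?P n"
      using measure_UNION_le[of "{..<N n}" E M] by simp
    also have "\<dots> \<le> (C * l n) * ?P n"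
      by (intro mult_right_mono N) simp
    finally have "prob (\<Union>k\<in>{..<N n}. E k) \<le> \<theta>"
      using elim e by simp
    moreover have "cmod (\<xi> k \<omega>) \<le> exp (e * l n)"
      if "\<omega> \<in> space M - (\<Union>k\<in>{..<N n}. E k)" "k < N n" for \<omega> k
      using that by (intro ln_one_plus_le_imp_le_exp) (auto simp: E_def not_less)
    ultimately show ?case
      by (intro bexI[of _ "\<Union>k\<in>{..<N n}. E k"]) auto
  qed
qed

lemma concentration_scaled_le:
  assumes "a \<noteq> 0"
  shows "concentration M (\<lambda>\<omega>. a * \<xi> k \<omega>) (c * cmod a) \<le> concentration M (\<xi> 0) c"
proof (rule concentration_least)
  fix b
  have "dist (a * x) b = cmod a * dist x (b / a)" for x
    using assms by (simp add: dist_norm right_diff_distrib flip: norm_mult)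
  then have "prob {\<omega>\<in>space M. dist (a * \<xi> k \<omega>) b \<le> c * cmod a} =
      prob {\<omega>\<in>space M. dist (\<xi> k \<omega>) (b / a) \<le> c}"
    using assms by (simp add: mult.commute[of c])
  also have "\<dots> \<le> concentration M (\<xi> k) c"
    by (rule prob_dist_le_concentration)
  also have "\<dots> = concentration M (\<xi> 0) c"
    by (rule concentration_cong_distr) (use ident in auto)
  finally show "prob {\<omega>\<in>space M. dist (a * \<xi> k \<omega>) b \<le> c * cmod a} \<le> concentration M (\<xi> 0) c" .
qed

lemma small_ball_lacunary:
  assumes \<theta>: "0 < \<theta>"
  obtains N :: nat and B c :: real where "0 < N" "1 < B" "0 < c"
    "\<And>D K (a :: nat \<Rightarrow> complex) \<eta>. finite D \<Longrightarrow> K \<subseteq> D \<Longrightarrow> card K = N \<Longrightarrow> lacunary_on K B (\<lambda>k. cmod (a k)) \<Longrightarrow>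
      0 < \<eta> \<Longrightarrow> (\<And>k. k \<in> K \<Longrightarrow> \<eta> \<le> c * cmod (a k)) \<Longrightarrow>
      prob {\<omega>\<in>space M. cmod (\<Sum>k\<in>D. a k * \<xi> k \<omega>) \<le> \<eta>} \<le> \<theta>"
proof -
  obtain c where c: "0 < c" "concentration M (\<xi> 0) c < 1"
    by (rule nondegenerate_imp_concentration_less_1[OF meas nondeg])
  obtain N :: nat and q \<tau> where N: "0 < N" and \<tau>: "0 < \<tau>" "concentration M (\<xi> 0) c + \<tau> \<le> q"
    and total: "q ^ N + real N * \<tau> \<le> \<theta>"
    using exists_power_add_mult_le[OF concentration_nonneg c(2) \<theta>] by blast
  obtain R where R: "0 \<le> R" and tail: "\<And>k. prob {\<omega>\<in>space M. R < cmod (\<xi> k \<omega>)} \<le> \<tau>"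
    by (rule tight[OF \<tau>(1)]) blast
  define B where "B = max 2 (2 * R * real N / c)"
  have B: "1 < B" "2 * R * real N \<le> c * B"
    using c(1) mult_left_mono[of "2 * R * real N / c" B c] by (auto simp: B_def)
  have "prob {\<omega>\<in>space M. cmod (\<Sum>k\<in>D. a k * \<xi> k \<omega>) \<le> \<eta>} \<le> \<theta>"
    if D: "finite D" "K \<subseteq> D" and K: "card K = N" and lac: "lacunary_on K B (\<lambda>k. cmod (a k))"
      and \<eta>: "0 < \<eta>" "\<And>k. k \<in> K \<Longrightarrow> \<eta> \<le> c / 2 * cmod (a k)" for D K \<eta> and a :: "nat \<Rightarrow> complex"
  proof -
    have a: "a k \<noteq> 0" if "k \<in> K" for k
      using \<eta>(1) \<eta>(2)[OF that] by auto
    have "concentration M (\<lambda>\<omega>. \<Sum>k\<in>D. a k * \<xi> k \<omega>) \<eta> \<le> q ^ card K + real (card K) * \<tau>"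
    proof (rule concentration_sum_le_lacunary[OF D _ lac _ _ _ _ B(1) _ R])
      show "indep_vars (\<lambda>_. borel) (\<lambda>k \<omega>. a k * \<xi> k \<omega>) D"
        by (rule indep_vars_compose2[OF indep_vars_subset[OF indep]]) auto
      fix k
      assume k: "k \<in> K"
      show "prob {\<omega>\<in>space M. R * cmod (a k) < cmod (a k * \<xi> k \<omega>)} \<le> \<tau>"
        using tail[of k] a[OF k] by (simp add: norm_mult mult.commute[of R])
      show "concentration M (\<lambda>\<omega>. a k * \<xi> k \<omega>) (c * cmod (a k)) + \<tau> \<le> q"
        using concentration_scaled_le[OF a[OF k], of k c] \<tau>(2) by linarith
    qed (use a \<eta>(2) B(2) K in \<open>auto simp: field_simps\<close>)
    then show ?thesis
      using prob_dist_le_concentration[of "\<lambda>\<omega>. \<Sum>k\<in>D. a k * \<xi> k \<omega>" 0 \<eta>] total K by simp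
  qed
  then show ?thesis
    using c B N by (intro that[of N B "c / 2"]) auto
qed

end

subsection \<open>Asymptotics of the random polynomials\<close>

lemma tendsto_of_approximations:
  fixes f :: "'a \<Rightarrow> 'b :: metric_space"
  assumes "\<And>e. 0 < e \<Longrightarrow> \<exists>g y. (g \<longlongrightarrow> y) F \<and> (\<forall>x. dist (f x) (g x) \<le> e) \<and> dist y z \<le> e"
  shows "(f \<longlongrightarrow> z) F"
proof (rule tendstoI)
  fix e :: real
  assume "0 < e"
  then obtain g y where g: "(g \<longlongrightarrow> y) F" "\<And>x. dist (f x) (g x) \<le> e / 3" "dist y z \<le> e / 3"
    using assms[of "e / 3"] by auto
  have "\<forall>\<^sub>F x in F. dist (g x) y < e / 3"
    using tendstoD[OF g(1), of "e / 3"] \<open>0 < e\<close> by simp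
  then show "\<forall>\<^sub>F x in F. dist (f x) z < e"
  proof eventually_elim
    case (elim x)
    then show ?case
      using g(2)[of x] g(3) dist_triangle[of "f x" z "g x"] dist_triangle[of "g x" z y] by linarith
  qed
qed

lemma bounded_range_of_uniformly_close:
  fixes f g :: "'a \<Rightarrow> real"
  assumes "bounded (range g)" "\<And>x. \<bar>f x - g x\<bar> \<le> e"
  shows "bounded (range f)"
proof -
  obtain C where C: "\<And>x. \<bar>g x\<bar> \<le> C"
    using assms(1) by (auto simp: bounded_iff)
  have "\<bar>f x\<bar> \<le> C + e" for x
    using C[of x] assms(2)[of x] by linarith
  then show ?thesis
    by (auto simp: bounded_iff)
qed

locale random_polynomials = iid_log_moment M \<xi> + coefficient_array p T0 L \<delta> pc
  for M :: "'a measure" and \<xi> :: "nat \<Rightarrow> 'a \<Rightarrow> complex"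
    and p :: "real \<Rightarrow> real" and T0 :: real and L :: "nat \<Rightarrow> nat" and \<delta> :: "nat \<Rightarrow> real"
    and pc :: "nat \<Rightarrow> nat \<Rightarrow> complex"
begin

definition F :: "nat \<Rightarrow> 'a \<Rightarrow> complex poly" where
  "F n \<omega> = (\<Sum>k\<le>deg n. monom (\<xi> k \<omega> * pc k n) k)"

lemma degree_F_le: "real (degree (F n \<omega>)) \<le> 2 * T0 * real (L n)"
proof -
  have "degree (F n \<omega>) \<le> deg n"
    unfolding F_def by (intro degree_sum_le) (auto intro: order_trans[OF degree_monom_le])
  then show ?thesis
    using deg_le[of n] by linarith
qed

lemma poly_F: "poly (F n \<omega>) z = (\<Sum>k\<le>deg n. (pc k n * z ^ k) * \<xi> k \<omega>)"
  unfolding F_def by (simp add: poly_sum poly_monom mult_ac)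

lemma poly_F_measurable [measurable]: "(\<lambda>\<omega>. poly (F n \<omega>) z) \<in> borel_measurable M"
  unfolding poly_F by measurable

lemma cmod_coef_mult_power: "cmod z = exp s \<Longrightarrow> cmod (pc k n * z ^ k) = cmod (pc k n) * exp (s * real k)"
  by (simp add: norm_mult norm_power mult.commute flip: exp_of_nat_mult)

lemma whp_cmod_poly_F_le:
  assumes e: "0 < e"
  shows "\<forall>\<^sub>F (n, \<omega>) in whp M. \<forall>z. cmod z = exp s \<longrightarrow> cmod (poly (F n \<omega>) z) \<le> exp (real (L n) * (I s + e))"
proof -
  have e3: "0 < e / 3"
    using e by simp
  have "\<forall>\<^sub>F x in at_top. (2 * T0 + 1) * x \<le> exp (e / 3 * x)"
    using e by real_asymp
  then have "\<forall>\<^sub>F n in sequentially. (2 * T0 + 1) * real (L n) \<le> exp (e / 3 * real (L n))"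
    by (rule eventually_compose_filterlim[OF _ real_L_lim])
  from eventually_sequentially_imp_whp[OF this] eventually_sequentially_imp_whp[OF coef_upper[OF e3, of s]]
    whp_le_exp[OF real_L_lim Suc_deg_le e3]
  show ?thesis
  proof eventually_elim
    case (elim x)
    obtain n \<omega> where x: "x = (n, \<omega>)"
      by fastforce
    let ?l = "real (L n)"
    have "cmod (poly (F n \<omega>) z) \<le> exp (?l * (I s + e))" if z: "cmod z = exp s" for z
    proof -
      have term_le: "cmod (pc k n * z ^ k * \<xi> k \<omega>) \<le>
          exp (?l * (I s + e / 3)) * exp (e / 3 * ?l)" if "k \<in> {..deg n}"
        for k
        unfolding norm_mult[of _ "\<xi> k \<omega>"] cmod_coef_mult_power[OF z]
        using elim that by (intro mult_mono) (auto simp: x less_Suc_eq_le)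
      have "cmod (poly (F n \<omega>) z) \<le> real (card {..deg n}) * (exp (?l * (I s + e / 3)) * exp (e / 3 * ?l))"
        unfolding poly_F by (rule sum_norm_bound) (rule term_le)
      also have "\<dots> \<le> exp (e / 3 * ?l) * (exp (?l * (I s + e / 3)) * exp (e / 3 * ?l))"
        using elim Suc_deg_le[of n] by (intro mult_right_mono) (auto simp: x)
      also have "\<dots> = exp (?l * (I s + e))"
        by (simp add: algebra_simps flip: exp_add)
      finally show ?thesis .
    qed
    then show ?case
      by (simp add: x)
  qed
qed

lemma small_ball_poly_F:
  assumes \<theta>: "0 < \<theta>" and e: "0 < e"
  shows "\<forall>\<^sub>F n in sequentially. \<exists>s'. s \<le> s' \<and> s' \<le> s + e \<and> (\<forall>z. cmod z = exp s' \<longrightarrow>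
    prob {\<omega>\<in>space M. cmod (poly (F n \<omega>) z) \<le> exp (real (L n) * (I s - e))} \<le> \<theta>)"
proof -
  obtain N :: nat and B c :: real where N: "0 < N" and B: "1 < B" and c: "0 < c"
    and small_ball: "\<And>D K a \<eta>. finite D \<Longrightarrow> K \<subseteq> D \<Longrightarrow> card K = N \<Longrightarrow> lacunary_on K B (\<lambda>k. cmod (a k)) \<Longrightarrow>
      0 < \<eta> \<Longrightarrow> (\<And>k. k \<in> K \<Longrightarrow> \<eta> \<le> c * cmod (a k)) \<Longrightarrow>
      prob {\<omega>\<in>space M. cmod (\<Sum>k\<in>D. a k * \<xi> k \<omega>) \<le> \<eta>} \<le> \<theta>"
    by (rule small_ball_lacunary[OF \<theta>]) blast
  have e2: "0 < e / 2"
    using e by simp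
  have "(\<lambda>n. exp (- (e / 2 * real (L n)))) \<longlonglongrightarrow> 0"
    by (intro filterlim_compose[OF exp_at_bot] filterlim_compose[OF filterlim_uminus_at_bot_at_top]
        filterlim_tendsto_pos_mult_at_top[OF tendsto_const e2 real_L_lim])
  then have "\<forall>\<^sub>F n in sequentially. exp (- (e / 2 * real (L n))) < c"
    by (rule order_tendstoD) (rule c)
  with eventually_lacunary_coefs[OF e2 N B, of s] show ?thesis
  proof eventually_elim
    case (elim n)
    let ?l = "real (L n)"
    from elim obtain s' K where s': "s \<le> s'" "s' \<le> s + e / 2" and K: "K \<subseteq> {..deg n}" "card K = N"
      and lac: "lacunary_on K B (\<lambda>k. cmod (pc k n) * exp (s' * real k))"
      and lower: "\<And>k. k \<in> K \<Longrightarrow> exp (?l * (I s - e / 2)) \<le> cmod (pc k n) * exp (s' * real k)"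
      by blast
    have "prob {\<omega>\<in>space M. cmod (poly (F n \<omega>) z) \<le> exp (?l * (I s - e))} \<le> \<theta>" if z: "cmod z = exp s'"
      for z
      unfolding poly_F
    proof (rule small_ball[OF _ K])
      show "lacunary_on K B (\<lambda>k. cmod (pc k n * z ^ k))"
        unfolding cmod_coef_mult_power[OF z] by (rule lac)
      fix k
      assume k: "k \<in> K"
      have "exp (?l * (I s - e)) = exp (- (e / 2 * ?l)) * exp (?l * (I s - e / 2))"
        by (simp add: algebra_simps flip: exp_add)
      also have "\<dots> \<le> c * (cmod (pc k n) * exp (s' * real k))"
        using elim(2) c lower[OF k] by (intro mult_mono) auto
      finally show "exp (?l * (I s - e)) \<le> c * cmod (pc k n * z ^ k)"
        unfolding cmod_coef_mult_power[OF z] .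
    qed auto
    then show ?case
      using s' e by (intro exI[of _ s']) auto
  qed
qed

lemma log_mahler_F_ge:
  assumes N: "0 < N" "2 * T0 * (ln 2 / real N) \<le> e / 3" and e': "e' \<le> e / 3" "2 * T0 * e' \<le> e / 3"
    and s': "s \<le> s'" "s' \<le> s + e'"
    and large: "\<And>j. j < N \<Longrightarrow>
      exp (real (L n) * (I s - e')) <
      cmod (poly (F n \<omega>) (of_real (exp s') * cis (2 * pi * real j / real N)))"
  shows "F n \<omega> \<noteq> 0 \<and> real (L n) * (I s - e) \<le> log_mahler (F n \<omega>) (exp s)"
proof
  let ?l = "real (L n)"
  have "real (degree (F n \<omega>)) * (ln 2 / real N + (s' - s)) \<le> 2 * T0 * ?l * (ln 2 / real N + e')"
    using degree_F_le s' T0 by (intro mult_mono add_mono) auto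
  also have "\<dots> = ?l * (2 * T0 * (ln 2 / real N) + 2 * T0 * e')"
    by (simp add: algebra_simps)
  also have "\<dots> \<le> ?l * (e / 3 + e / 3)"
    using N e' by (intro mult_left_mono add_mono) auto
  finally have "?l * (I s - e' - 2 * e / 3) \<le> log_mahler (F n \<omega>) (exp s)"
    using log_mahler_ge_of_large_values[OF N(1) s'(1) large] by (simp add: algebra_simps)
  moreover have "?l * (I s - e) \<le> ?l * (I s - e' - 2 * e / 3)"
    using e' by (intro mult_left_mono) auto
  ultimately show "?l * (I s - e) \<le> log_mahler (F n \<omega>) (exp s)"
    by linarith
  show "F n \<omega> \<noteq> 0"
    using large[OF N(1)] exp_gt_zero[of "?l * (I s - e')"] by (auto simp del: exp_gt_zero)
qed

lemma whp_log_mahler_F_ge: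
  assumes e: "0 < e"
  shows "\<forall>\<^sub>F (n, \<omega>) in whp M. F n \<omega> \<noteq> 0 \<and> real (L n) * (I s - e) \<le> log_mahler (F n \<omega>) (exp s)"
  unfolding eventually_whp
proof (intro allI impI)
  fix \<theta> :: real
  assume \<theta>: "0 < \<theta>"
  define e' where "e' = min (e / 3) (e / (6 * T0))"
  have e': "0 < e'" "e' \<le> e / 3" "2 * T0 * e' \<le> e / 3"
    using e T0 mult_left_mono[of e' "e / (6 * T0)" "2 * T0"] by (auto simp: e'_def)
  obtain N :: nat where N': "6 * T0 * ln 2 / e < real N"
    using reals_Archimedean2 by blast
  moreover have "0 < 6 * T0 * ln 2 / e"
    using T0 e by simp
  ultimately have "0 < real N"
    by linarith
  with N' e have N: "0 < N" "2 * T0 * (ln 2 / real N) \<le> e / 3"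
    by (simp_all add: field_simps)
  have "\<forall>\<^sub>F n in sequentially. \<exists>s'. s \<le> s' \<and> s' \<le> s + e' \<and> (\<forall>z. cmod z = exp s' \<longrightarrow>
      prob {\<omega>\<in>space M. cmod (poly (F n \<omega>) z) \<le> exp (real (L n) * (I s - e'))} \<le> \<theta> / real N)"
    using \<theta> N e' by (intro small_ball_poly_F) auto
  then show "\<forall>\<^sub>F n in sequentially. \<exists>E\<in>events. prob E \<le> \<theta> \<and> (\<forall>\<omega>\<in>space M - E. case (n, \<omega>) of (n, \<omega>) \<Rightarrow>
      F n \<omega> \<noteq> 0 \<and> real (L n) * (I s - e) \<le> log_mahler (F n \<omega>) (exp s))"
  proof eventually_elim
    case (elim n)
    then obtain s' where s': "s \<le> s'" "s' \<le> s + e'"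
      and small: "\<And>z. cmod z = exp s' \<Longrightarrow>
        prob {\<omega>\<in>space M. cmod (poly (F n \<omega>) z) \<le> exp (real (L n) * (I s - e'))} \<le> \<theta> / real N"
      by blast
    let ?z = "\<lambda>j. of_real (exp s') * cis (2 * pi * real j / real N)"
    have "\<exists>E\<in>events. prob E \<le> \<theta> \<and>
        (\<forall>\<omega>\<in>space M - E. \<forall>j<N. exp (real (L n) * (I s - e')) < cmod (poly (F n \<omega>) (?z j)))"
      by (intro union_bound_event N small) (measurable, simp add: norm_mult)
    then show ?case
      using log_mahler_F_ge[OF N e'(2,3) s'] by fastforce
  qed
qed

lemma log_mahler_F_tendsto: "((\<lambda>(n, \<omega>). log_mahler (F n \<omega>) (exp s) / real (L n)) \<longlongrightarrow> I s) (whp M)"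
proof (rule tendstoI)
  fix e :: real
  assume "0 < e"
  then have e2: "0 < e / 2"
    by simp
  from whp_log_mahler_F_ge[OF e2, of s] whp_cmod_poly_F_le[OF e2, of s]
  show "\<forall>\<^sub>F x in whp M. dist (case x of (n, \<omega>) \<Rightarrow> log_mahler (F n \<omega>) (exp s) / real (L n)) (I s) < e"
  proof eventually_elim
    case (elim x)
    obtain n \<omega> where x: "x = (n, \<omega>)"
      by fastforce
    have l: "0 < real (L n)"
      by (rule real_L_pos)
    have "log_mahler (F n \<omega>) (exp s) \<le> ln (exp (real (L n) * (I s + e / 2)))"
      using elim by (intro log_mahler_le) (auto simp: x)
    then have "log_mahler (F n \<omega>) (exp s) / real (L n) \<le> I s + e / 2"
      using l by (simp add: pos_divide_le_eq mult.commute)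
    moreover have "I s - e / 2 \<le> log_mahler (F n \<omega>) (exp s) / real (L n)"
      using elim l by (simp add: x pos_le_divide_eq mult.commute)
    ultimately show ?case
      using \<open>0 < e\<close> by (simp add: x dist_real_def abs_less_iff)
  qed
qed

definition zero_average :: "(complex \<Rightarrow> real) \<Rightarrow> nat \<times> 'a \<Rightarrow> real" where
  "zero_average \<phi> = (\<lambda>(n, \<omega>). zero_measure_integral (F n \<omega>) \<phi> / real (L n))"

lemma zero_average_add: "zero_average (\<lambda>w. f w + g w) x = zero_average f x + zero_average g x"
  by (simp add: zero_average_def zero_measure_integral_add add_divide_distrib split: prod.split)

lemma zero_average_mult_left: "zero_average (\<lambda>w. c * f w) x = c * zero_average f x"
  by (simp add: zero_average_def zero_measure_integral_mult_left split: prod.split)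

lemma dist_zero_average_le:
  assumes "\<And>w. \<bar>f w - g w\<bar> \<le> e"
  shows "dist (zero_average f x) (zero_average g x) \<le> 2 * T0 * e"
proof -
  obtain n \<omega> where x: "x = (n, \<omega>)"
    by fastforce
  have "0 \<le> e"
    using assms[of 0] by linarith
  have "\<bar>zero_measure_integral (F n \<omega>) f - zero_measure_integral (F n \<omega>) g\<bar> \<le> real (degree (F n \<omega>)) * e"
    unfolding zero_measure_integral_diff[symmetric] by (rule abs_zero_measure_integral_le[OF assms])
  also have "\<dots> \<le> 2 * T0 * real (L n) * e"
    using \<open>0 \<le> e\<close> by (intro mult_right_mono degree_F_le)
  finally show ?thesis
    using real_L_pos[of n]
    by (simp add: x zero_average_def dist_real_def pos_divide_le_eq mult_ac flip: diff_divide_distrib)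
qed

lemma zero_average_log_ramp_tendsto:
  assumes "0 < r" "r < R"
  shows "(zero_average (log_ramp r R) \<longlongrightarrow> integral\<^sup>L radial_measure (log_ramp r R)) (whp M)"
proof -
  have "zero_average (log_ramp r R) x = (case x of (n, \<omega>) \<Rightarrow> log_mahler (F n \<omega>) (exp (ln R)) / real (L n)) -
      (case x of (n, \<omega>) \<Rightarrow> log_mahler (F n \<omega>) (exp (ln r)) / real (L n))" for x
    using assms
    by (simp add: zero_average_def log_mahler_def log_ramp_def[abs_def] zero_measure_integral_diff
        diff_divide_distrib add_divide_distrib split: prod.split)
  moreover have "integral\<^sup>L radial_measure (log_ramp r R) = I (ln R) - I (ln r)"
    using integral_log_ramp assms by simp
  ultimately show ?thesis
    using tendsto_diff[OF log_mahler_F_tendsto log_mahler_F_tendsto] by presburger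
qed

lemma zero_average_moment_tendsto_0:
  assumes r: "0 < r" and m: "0 < m"
  shows "(zero_average (\<lambda>w. Re (a * disc_fold r w ^ m)) \<longlongrightarrow> 0) (whp M)"
proof (rule tendstoI)
  fix e :: real
  assume e: "0 < e"
  define C where "C = 2 * cmod a * real m + 1"
  have C: "0 < C"
    by (simp add: C_def add_nonneg_pos)
  define e' where "e' = e / (4 * C)"
  have e': "0 < e'"
    using e C by (simp add: e'_def)
  let ?\<phi> = "\<lambda>w. Re (a * disc_fold r w ^ m)"
  from whp_log_mahler_F_ge[OF e', of "ln r"] whp_cmod_poly_F_le[OF e', of "ln r"]
  show "\<forall>\<^sub>F x in whp M. dist (zero_average ?\<phi> x) 0 < e"
  proof eventually_elim
    case (elim x)
    obtain n \<omega> where x: "x = (n, \<omega>)"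
      by fastforce
    let ?l = "real (L n)"
    have l: "0 < ?l"
      by (rule real_L_pos)
    have "\<bar>zero_measure_integral (F n \<omega>) ?\<phi>\<bar> \<le>
        2 * cmod a * real m * (ln (exp (?l * (I (ln r) + e'))) - log_mahler (F n \<omega>) r)"
      using elim r m by (intro disc_fold_moment_le) (auto simp: x)
    also have "\<dots> \<le> 2 * cmod a * real m * (2 * e' * ?l)"
      using elim r by (intro mult_left_mono) (auto simp: x algebra_simps)
    also have "\<dots> \<le> C * (2 * e' * ?l)"
      using e' l by (intro mult_right_mono) (auto simp: C_def)
    also have "\<dots> = e / 2 * ?l"
      using C by (simp add: e'_def)
    finally have "\<bar>zero_measure_integral (F n \<omega>) ?\<phi>\<bar> / ?l \<le> e / 2"
      using l by (simp add: pos_divide_le_eq)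
    then have "\<bar>zero_measure_integral (F n \<omega>) ?\<phi>\<bar> / ?l < e"
      using e by linarith
    then show ?case
      by (simp add: x zero_average_def)
  qed
qed

lemma integral_moment_eq_0:
  assumes r: "0 < r" and m: "0 < m"
  shows "(\<integral>w. Re (a * disc_fold r w ^ m) \<partial>radial_measure) = 0"
proof -
  let ?\<phi> = "\<lambda>w. Re (a * disc_fold r w ^ m)"
  define \<theta> where "\<theta> = pi / real m"
  have "real m * - \<theta> = - pi"
    using m by (simp add: \<theta>_def)
  then have "cis (- \<theta>) ^ m = -1"
    by (simp only: Complex.DeMoivre) (simp add: complex_eq_iff)
  then have rotate: "?\<phi> (cis \<theta> * w) = - ?\<phi> w" for w
    unfolding disc_fold_rotate power_mult_distrib by simp
  have meas: "?\<phi> \<in> borel_measurable borel"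
    by (intro borel_measurable_continuous_onI continuous_intros continuous_on_disc_fold r)
  have "integral\<^sup>L radial_measure ?\<phi> = integral\<^sup>L (distr radial_measure borel (\<lambda>w. cis \<theta> * w)) ?\<phi>"
    by (simp add: distr_radial_measure_rotate)
  also have "\<dots> = (\<integral>w. ?\<phi> (cis \<theta> * w) \<partial>radial_measure)"
    by (rule integral_distr[OF _ meas]) measurable
  also have "\<dots> = - integral\<^sup>L radial_measure ?\<phi>"
    unfolding rotate by (rule Bochner_Integration.integral_minus)
  finally show ?thesis
    by simp
qed

definition converges :: "(complex \<Rightarrow> real) \<Rightarrow> bool" where
  "converges \<phi> \<longleftrightarrow> continuous_on UNIV \<phi> \<and> bounded (range \<phi>) \<and>
    (zero_average \<phi> \<longlongrightarrow> integral\<^sup>L radial_measure \<phi>) (whp M)"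

lemma converges_imp_integrable: "converges \<phi> \<Longrightarrow> integrable radial_measure \<phi>"
  unfolding converges_def by (intro integrable_radial_measure) auto

lemma dist_integral_radial_measure_le:
  assumes "integrable radial_measure f" "integrable radial_measure g" "\<And>w. \<bar>f w - g w\<bar> \<le> e"
  shows "dist (integral\<^sup>L radial_measure f) (integral\<^sup>L radial_measure g) \<le> measure radial_measure UNIV * e"
proof -
  interpret finite_measure radial_measure
    by (rule finite_measure_radial_measure)
  have "\<bar>integral\<^sup>L radial_measure (\<lambda>w. f w - g w)\<bar> \<le> integral\<^sup>L radial_measure (\<lambda>w. \<bar>f w - g w\<bar>)"
    using integral_norm_bound[of radial_measure "\<lambda>w. f w - g w"] by simp
  also have "\<dots> \<le> integral\<^sup>L radial_measure (\<lambda>w. e)"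
    using assms by (intro integral_mono integrable_abs Bochner_Integration.integrable_diff) auto
  finally show ?thesis
    using assms by (simp add: dist_real_def)
qed

lemma converges_add:
  assumes "converges f" "converges g"
  shows "converges (\<lambda>w. f w + g w)"
  unfolding converges_def
proof (intro conjI)
  show "continuous_on UNIV (\<lambda>w. f w + g w)" "bounded (range (\<lambda>w. f w + g w))"
    using assms bounded_plus_comp[of f UNIV g] by (auto simp: converges_def intro: continuous_intros)
  show "(zero_average (\<lambda>w. f w + g w) \<longlongrightarrow> integral\<^sup>L radial_measure (\<lambda>w. f w + g w)) (whp M)"
    unfolding zero_average_add[abs_def]
      Bochner_Integration.integral_add[OF assms[THEN converges_imp_integrable]]
    using assms by (auto simp: converges_def intro: tendsto_add)
qed

lemma converges_mult_left:
  assumes "converges f"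
  shows "converges (\<lambda>w. c * f w)"
  unfolding converges_def
proof (intro conjI)
  show "continuous_on UNIV (\<lambda>w. c * f w)"
    using assms by (auto simp: converges_def intro: continuous_intros)
  show "bounded (range (\<lambda>w. c * f w))"
    using assms bounded_scaling[of "range f" c] by (simp add: converges_def image_image)
  show "(zero_average (\<lambda>w. c * f w) \<longlongrightarrow> integral\<^sup>L radial_measure (\<lambda>w. c * f w)) (whp M)"
    unfolding zero_average_mult_left[abs_def] integral_mult_right_zero
    using assms by (auto simp: converges_def intro: tendsto_mult_left)
qed

lemma converges_uniform_closure:
  assumes f: "continuous_on UNIV f" and approx: "\<And>e. 0 < e \<Longrightarrow> \<exists>g. converges g \<and> (\<forall>w. \<bar>f w - g w\<bar> \<le> e)"
  shows "converges f"
proof -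
  obtain g where "bounded (range g)" "\<And>w. \<bar>f w - g w\<bar> \<le> 1"
    using approx[of 1] by (auto simp: converges_def)
  then have bounded: "bounded (range f)"
    by (rule bounded_range_of_uniformly_close)
  have "(zero_average f \<longlongrightarrow> integral\<^sup>L radial_measure f) (whp M)"
  proof (rule tendsto_of_approximations)
    fix e :: real
    assume e: "0 < e"
    define C where "C = max (2 * T0) (measure radial_measure UNIV)"
    have C: "0 < C" "2 * T0 \<le> C" "measure radial_measure UNIV \<le> C"
      using T0 by (auto simp: C_def less_max_iff_disj)
    obtain g where g: "converges g" "\<And>w. \<bar>f w - g w\<bar> \<le> e / C"
      using approx[of "e / C"] e C by auto
    have "dist (zero_average f x) (zero_average g x) \<le> e" for x
    proof -
      have "2 * T0 * (e / C) \<le> C * (e / C)"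
        using C e by (intro mult_right_mono) auto
      then show ?thesis
        using dist_zero_average_le[of f g "e / C" x] g(2) C by simp
    qed
    moreover have "dist (integral\<^sup>L radial_measure g) (integral\<^sup>L radial_measure f) \<le> e"
    proof -
      have "measure radial_measure UNIV * (e / C) \<le> C * (e / C)"
        using C e by (intro mult_right_mono) auto
      moreover have "\<bar>g w - f w\<bar> \<le> e / C" for w
        using g(2)[of w] by (simp add: abs_minus_commute)
      ultimately show ?thesis
        using dist_integral_radial_measure_le[of g f "e / C"] g(1) C f bounded
        by (simp add: converges_imp_integrable integrable_radial_measure)
    qed
    ultimately show "\<exists>g y. (g \<longlongrightarrow> y) (whp M) \<and> (\<forall>x. dist (zero_average f x) (g x) \<le> e) \<and>
        dist y (integral\<^sup>L radial_measure f) \<le> e"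
      using g(1) unfolding converges_def by blast
  qed
  with f bounded show ?thesis
    by (simp add: converges_def)
qed

lemma converges_log_ramp:
  assumes "0 < r" "r < R"
  shows "converges (log_ramp r R)"
proof -
  have "bounded (range (log_ramp r R))"
    using log_ramp_bounds(3,4)[of r R] assms by (auto simp: bounded_iff intro!: exI[of _ "ln R - ln r"])
  then show ?thesis
    using assms by (simp add: converges_def continuous_on_log_ramp zero_average_log_ramp_tendsto)
qed

lemma converges_moment:
  assumes r: "0 < r" and m: "0 < m"
  shows "converges (\<lambda>w. Re (a * disc_fold r w ^ m))"
proof -
  have "\<bar>Re (a * disc_fold r w ^ m)\<bar> \<le> cmod a" for w
  proof -
    have "\<bar>Re (a * disc_fold r w ^ m)\<bar> \<le> cmod a * cmod (disc_fold r w) ^ m"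
      using abs_Re_le_cmod[of "a * disc_fold r w ^ m"] by (simp only: norm_mult norm_power)
    also have "\<dots> \<le> cmod a * 1"
      by (intro mult_left_mono power_le_one cmod_disc_fold_le_1 r) auto
    finally show ?thesis
      by simp
  qed
  then have "bounded (range (\<lambda>w. Re (a * disc_fold r w ^ m)))"
    unfolding bounded_iff by auto
  moreover have "continuous_on UNIV (\<lambda>w. Re (a * disc_fold r w ^ m))"
    by (intro continuous_intros continuous_on_disc_fold r)
  ultimately show ?thesis
    using zero_average_moment_tendsto_0[OF r m] integral_moment_eq_0[OF r m]
    by (simp only: converges_def)
qed

sublocale test_class converges
  by unfold_locales
    (fact converges_add converges_mult_left converges_uniform_closure converges_log_ramp converges_moment)+

lemma test_fun_tendsto:
  assumes "test_fun \<phi>"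
  shows "(zero_average \<phi> \<longlongrightarrow> integral\<^sup>L radial_measure \<phi>) (whp M)"
proof -
  have smooth: "smooth_fun \<phi>" and support: "compact (closure {z. \<phi> z \<noteq> 0})"
    using assms by (auto simp: test_fun_def)
  obtain \<phi>' where "\<And>x. (\<phi> has_derivative \<phi>' x) (at x)"
    using smooth by (rule smooth_fun.cases) blast
  then have cont: "continuous_on UNIV \<phi>"
    by (meson continuous_at_imp_continuous_on has_derivative_continuous)
  have "bounded {z. \<phi> z \<noteq> 0}"
    using support by (meson bounded_subset closure_subset compact_imp_bounded)
  then obtain \<rho> where \<rho>: "0 < \<rho>" "\<And>z. \<phi> z \<noteq> 0 \<Longrightarrow> cmod z \<le> \<rho>"
    by (auto simp: bounded_pos)
  then have "\<phi> w = 0" if "\<rho> + 1 \<le> cmod w" for w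
    using that by force
  then have "converges \<phi>"
    using \<rho>(1) by (intro V_compact_support[OF cont, of "\<rho> + 1"]) auto
  then show ?thesis
    by (simp add: converges_def)
qed

lemma test_fun_prob_tendsto_0:
  assumes "test_fun \<phi>" "0 < \<epsilon>"
  shows "(\<lambda>n. prob {\<omega>\<in>space M. \<bar>zero_average \<phi> (n, \<omega>) - integral\<^sup>L radial_measure \<phi>\<bar> > \<epsilon>}) \<longlonglongrightarrow> 0"
proof -
  have "\<forall>\<^sub>F x in whp M. \<not> \<bar>zero_average \<phi> x - integral\<^sup>L radial_measure \<phi>\<bar> > \<epsilon>"
    using tendstoD[OF test_fun_tendsto[OF assms(1)] assms(2)]
    by eventually_elim (simp add: dist_real_def)
  from eventually_whp_imp_tendsto_prob[OF this] show ?thesis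
    by simp
qed

end

theorem theorem2:
  fixes M :: "'a measure"
    and \<xi> :: "nat \<Rightarrow> 'a \<Rightarrow> complex"
    and p :: "real \<Rightarrow> real"
    and T0 :: real
    and L :: "nat \<Rightarrow> nat"
    and \<delta> :: "nat \<Rightarrow> real"
    and pc :: "nat \<Rightarrow> nat \<Rightarrow> complex"
  assumes "prob_space M"
    and meas: "\<And>k. \<xi> k \<in> borel_measurable M"
    and indep: "prob_space.indep_vars M (\<lambda>_. borel) \<xi> UNIV"
    and ident: "\<And>k. distr M borel (\<xi> k) = distr M borel (\<xi> 0)"
    and nondeg: "\<not> (\<exists>c. AE \<omega> in M. \<xi> 0 \<omega> = c)"
    and nozero: "measure M {\<omega> \<in> space M. \<xi> 0 \<omega> = 0} = 0"
    and logmom: "integrable M (\<lambda>\<omega>. ln (1 + cmod (\<xi> 0 \<omega>)))"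
    and p_nonneg: "\<And>t. 0 \<le> t \<Longrightarrow> 0 \<le> p t"
    and T0: "0 < T0"
    and L_pos: "\<And>n. 0 < L n"
    and L_lim: "filterlim L at_top sequentially"
    and \<delta>_range: "\<And>n. - T0 < \<delta> n \<and> \<delta> n < T0"
    and \<delta>_lim: "\<delta> \<longlonglongrightarrow> 0"
    and deg_int: "\<And>n. (T0 - \<delta> n) * real (L n) \<in> \<int>"
    and p_pos: "\<And>t. 0 \<le> t \<Longrightarrow> t < T0 \<Longrightarrow> p t > 0"
    and p_zero: "\<And>t. t > T0 \<Longrightarrow> p t = 0"
    and p_cont: "continuous_on {0..T0} p"
    and coef: "(\<lambda>n. Max ((\<lambda>k. \<bar>cmod (pc k n) powr (1 / real (L n))
                     - p (min (real k / real (L n)) T0)\<bar>)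
                   ` {0..nat \<lfloor>(T0 - \<delta> n) * real (L n)\<rfloor>})) \<longlonglongrightarrow> 0"
  shows "\<exists>\<mu> :: complex measure.
           sets \<mu> = sets borel
         \<and> (\<forall>\<theta>::real. distr \<mu> borel (\<lambda>z. cis \<theta> * z) = \<mu>)
         \<and> (\<forall>r>0. emeasure \<mu> (ball 0 r) < \<infinity>
                 \<and> ((\<lambda>h. (legendre_I p (ln r + h) - legendre_I p (ln r)) / h)
                      \<longlongrightarrow> measure \<mu> (ball 0 r)) (at_left 0))
         \<and> (\<forall>\<phi>. test_fun \<phi> \<longrightarrow> (\<forall>\<epsilon>>0.
              ((\<lambda>n. measure M {\<omega> \<in> space M.
                   \<bar>zero_measure_integral
                      (\<Sum>k\<le>nat \<lfloor>(T0 - \<delta> n) * real (L n)\<rfloor>. monom (\<xi> k \<omega> * pc k n) k) \<phi>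
                      / real (L n) - integral\<^sup>L \<mu> \<phi>\<bar> > \<epsilon>}) \<longlongrightarrow> 0) sequentially))"
proof -
  interpret random_polynomials M \<xi> p T0 L \<delta> pc
    by (intro random_polynomials.intro iid_log_moment.intro iid_log_moment_axioms.intro
        coefficient_array.intro coefficient_profile.intro coefficient_array_axioms.intro) (fact assms)+
  show ?thesis
  proof (intro exI[of _ radial_measure] conjI allI impI)
    show "distr radial_measure borel (\<lambda>z. cis \<theta> * z) = radial_measure" for \<theta>
      by (rule distr_radial_measure_rotate)
    fix r :: real
    assume r: "0 < r"
    show "emeasure radial_measure (ball 0 r) < \<infinity>"
      by (simp add: emeasure_radial_measure_ball[OF r])
    show "((\<lambda>h. (I (ln r + h) - I (ln r)) / h) \<longlongrightarrow> measure radial_measure (ball 0 r)) (at_left 0)"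
      unfolding measure_radial_measure_ball[OF r] by (rule left_slope_tendsto)
  next
    fix \<phi> and \<epsilon> :: real
    assume "test_fun \<phi>" "0 < \<epsilon>"
    from test_fun_prob_tendsto_0[OF this]
    show "(\<lambda>n. prob {\<omega> \<in> space M. \<bar>zero_measure_integral
        (\<Sum>k\<le>nat \<lfloor>(T0 - \<delta> n) * real (L n)\<rfloor>. monom (\<xi> k \<omega> * pc k n) k) \<phi> / real (L n) -
        integral\<^sup>L radial_measure \<phi>\<bar> > \<epsilon>}) \<longlonglongrightarrow> 0"
      by (simp add: zero_average_def F_def deg_def)
  qed simp
qed

end
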